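(* Let $\mathcal A$ be the reflection arrangement of the Coxeter group of type $A_\ell$, i.e. of the symmetric group $S_{\ell+1}$ acting by permutation of coordinates on $V=\{(x_1,\dots,x_{\ell+1})\in\mathbb{C}^{\ell+1}\mid\sum_{i=1}^{\ell+1}x_i=0\}$. Then the space $\tilde{\mathcal A}=\operatorname{Spec}\tilde S_{\mathcal A}$ is isomorphic to the subspace arrangement $$L_\ell=\bigcup_{1\le i<j\le\ell+1}\{x\in\mathbb{C}^{\ell+1}\mid x_i=x_j=0\}$$ (with its reduced structure).
   Context: Let $S=\mathbb{C}[V]$, and let $p_1,\dots,p_\ell$ be homogeneous algebraically independent generators of $S^W$, $W=S_{\ell+1}$. Let $J$ be their Jacobian matrix with respect to linear coordinates on $V$. $\Delta=\det J$ is a reduced equation of $\mathcal A=\bigcup_{i<j}\{x_i=x_j\}\subset V$. $S_{\mathcal A}=S/S\Delta$ has total ring of fractions $Q_{\mathcal A}$. $\tilde I_{\mathcal A}\subset S_{\mathcal A}$ is the ideal generated by all $(\ell-1)\times(\ell-1)$ minors of $J$ (equal to $S_{\mathcal A}$ if $\ell=1$), and $\tilde S_{\mathcal A}=\operatorname{End}_{S_{\mathcal A}}(\tilde I_{\mathcal A})=\{q\in Q_{\mathcal A}\mid q\tilde I_{\mathcal A}\subseteq\tilde I_{\mathcal A}\}$; as an $S$-module it is isomorphic to $\operatorname{coker}(J\colon S^\ell\to S^\ell)$. *)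

theory Defs
  imports
    "HOL-Analysis.Abstract_Topology"
    "HOL-Analysis.Derivative"
    "HOL-Algebra.QuotRing"
    "HOL-Combinatorics.Permutations"
    "Jordan_Normal_Form.Determinant"
begin

section \<open>Localization and total ring of fractions\<close>

(* The class a/s in the localization of R at the multiplicative set M:
   a/s = b/t iff u (t a - s b) = 0 for some u in M. *)
definition fraction :: "('a, 'm) ring_scheme \<Rightarrow> 'a set \<Rightarrow> 'a \<Rightarrow> 'a \<Rightarrow> ('a \<times> 'a) set" where
  "fraction R M a s = {(b, t). b \<in> carrier R \<and> t \<in> M \<and>
     (\<exists>u\<in>M. u \<otimes>\<^bsub>R\<^esub> (t \<otimes>\<^bsub>R\<^esub> a) = u \<otimes>\<^bsub>R\<^esub> (s \<otimes>\<^bsub>R\<^esub> b))}"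

(* The unions below run over all representatives; each of them contributes the same class. *)
definition localization :: "('a, 'm) ring_scheme \<Rightarrow> 'a set \<Rightarrow> ('a \<times> 'a) set ring" where
  "localization R M =
    \<lparr>carrier = {fraction R M a s | a s. a \<in> carrier R \<and> s \<in> M},
     mult = (\<lambda>X Y. \<Union>(a, s)\<in>X. \<Union>(b, t)\<in>Y. fraction R M (a \<otimes>\<^bsub>R\<^esub> b) (s \<otimes>\<^bsub>R\<^esub> t)),
     one = fraction R M \<one>\<^bsub>R\<^esub> \<one>\<^bsub>R\<^esub>,
     zero = fraction R M \<zero>\<^bsub>R\<^esub> \<one>\<^bsub>R\<^esub>,
     add = (\<lambda>X Y. \<Union>(a, s)\<in>X. \<Union>(b, t)\<in>Y.
              fraction R M ((t \<otimes>\<^bsub>R\<^esub> a) \<oplus>\<^bsub>R\<^esub> (s \<otimes>\<^bsub>R\<^esub> b)) (s \<otimes>\<^bsub>R\<^esub> t))\<rparr>"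

definition nonzerodivisors :: "('a, 'm) ring_scheme \<Rightarrow> 'a set" where
  "nonzerodivisors R =
    {s \<in> carrier R. \<forall>a\<in>carrier R. s \<otimes>\<^bsub>R\<^esub> a = \<zero>\<^bsub>R\<^esub> \<longrightarrow> a = \<zero>\<^bsub>R\<^esub>}"

definition total_fractions :: "('a, 'm) ring_scheme \<Rightarrow> ('a \<times> 'a) set ring" where
  "total_fractions R = localization R (nonzerodivisors R)"

definition to_fractions :: "('a, 'm) ring_scheme \<Rightarrow> 'a \<Rightarrow> ('a \<times> 'a) set" where
  "to_fractions R a = fraction R (nonzerodivisors R) a \<one>\<^bsub>R\<^esub>"

section \<open>Spectra as ringed spaces over the complex numbers\<close>

(* A ringed space whose section rings are complex algebras: scalar U c is the constant c
   regarded as a section over U. *)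
record ('p, 's) ringed_space =
  points :: "'p topology"
  sections :: "'p set \<Rightarrow> 's ring"
  restriction :: "'p set \<Rightarrow> 'p set \<Rightarrow> 's \<Rightarrow> 's"
  scalar :: "'p set \<Rightarrow> complex \<Rightarrow> 's"

definition zariski :: "('a, 'm) ring_scheme \<Rightarrow> 'a set topology" where
  "zariski R = topology_generated_by {{P. primeideal P R \<and> f \<notin> P} | f. f \<in> carrier R}"

definition stalk :: "('a, 'm) ring_scheme \<Rightarrow> 'a set \<Rightarrow> ('a \<times> 'a) set ring" where
  "stalk R P = localization R (carrier R - P)"

(* Sections over U are the families s(P) in R_P, P in U, that are locally given by a
   single fraction f/g. *)
definition spec_sections ::
    "('a, 'm) ring_scheme \<Rightarrow> 'a set set \<Rightarrow> ('a set \<Rightarrow> ('a \<times> 'a) set) ring" where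
  "spec_sections R U =
    \<lparr>carrier = {s \<in> (\<Pi>\<^sub>E P\<in>U. carrier (stalk R P)).
        \<forall>P\<in>U. \<exists>U' f g. openin (zariski R) U' \<and> P \<in> U' \<and> U' \<subseteq> U \<and>
          f \<in> carrier R \<and> g \<in> carrier R \<and>
          (\<forall>Q\<in>U'. g \<notin> Q \<and> s Q = fraction R (carrier R - Q) f g)},
     mult = (\<lambda>s t. \<lambda>P\<in>U. s P \<otimes>\<^bsub>stalk R P\<^esub> t P),
     one = (\<lambda>P\<in>U. \<one>\<^bsub>stalk R P\<^esub>),
     zero = (\<lambda>P\<in>U. \<zero>\<^bsub>stalk R P\<^esub>),
     add = (\<lambda>s t. \<lambda>P\<in>U. s P \<oplus>\<^bsub>stalk R P\<^esub> t P)\<rparr>"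

(* Spec of the complex algebra R with structure map \<sigma>. *)
definition Spec :: "('a, 'm) ring_scheme \<Rightarrow> (complex \<Rightarrow> 'a) \<Rightarrow>
    ('a set, 'a set \<Rightarrow> ('a \<times> 'a) set) ringed_space" where
  "Spec R \<sigma> =
    \<lparr>points = zariski R,
     sections = spec_sections R,
     restriction = (\<lambda>U U' s. restrict s U'),
     scalar = (\<lambda>U c. \<lambda>P\<in>U. fraction R (carrier R - P) (\<sigma> c) \<one>\<^bsub>R\<^esub>)\<rparr>"

(* Isomorphism of ringed spaces over the complex numbers: a homeomorphism h from X to Y with
   compatible algebra isomorphisms \<phi> U from the sections of Y over U to the sections of X over
   the preimage of U.  Between spectra such an isomorphism is automatically one of locally
   ringed spaces, since ring isomorphisms of local rings are local. *)
definition isomorphic_over_C ::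
    "('p, 's) ringed_space \<Rightarrow> ('q, 't) ringed_space \<Rightarrow> bool"  (infix \<open>\<cong>\<^sub>C\<close> 50) where
  "X \<cong>\<^sub>C Y \<longleftrightarrow>
    (\<exists>h \<phi>. homeomorphic_map (points X) (points Y) h \<and>
      (let pre = (\<lambda>U. {x \<in> topspace (points X). h x \<in> U}) in
        (\<forall>U. openin (points Y) U \<longrightarrow>
           \<phi> U \<in> ring_iso (sections Y U) (sections X (pre U)) \<and>
           (\<forall>c. \<phi> U (scalar Y U c) = scalar X (pre U) c)) \<and>
        (\<forall>U U' s. openin (points Y) U \<and> openin (points Y) U' \<and> U' \<subseteq> U \<and>
             s \<in> carrier (sections Y U) \<longrightarrow>
           \<phi> U' (restriction Y U U' s) = restriction X (pre U) (pre U') (\<phi> U s))))"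

section \<open>Polynomial functions and coordinate rings\<close>

text \<open>Coordinates are numbered from \<open>0\<close>.\<close>

definition cspace :: "nat \<Rightarrow> (nat \<Rightarrow> complex) set" where
  "cspace n = {x. \<forall>i\<ge>n. x i = 0}"

(* Complex polynomials in n variables, identified with the functions they induce. *)
inductive_set poly_funs :: "nat \<Rightarrow> ((nat \<Rightarrow> complex) \<Rightarrow> complex) set" for n :: nat where
  const: "(\<lambda>x. c) \<in> poly_funs n"
| coord: "i < n \<Longrightarrow> (\<lambda>x. x i) \<in> poly_funs n"
| add: "f \<in> poly_funs n \<Longrightarrow> g \<in> poly_funs n \<Longrightarrow> (\<lambda>x. f x + g x) \<in> poly_funs n"
| mult: "f \<in> poly_funs n \<Longrightarrow> g \<in> poly_funs n \<Longrightarrow> (\<lambda>x. f x * g x) \<in> poly_funs n"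

(* The ring of polynomial functions on X, i.e. the polynomial ring modulo the vanishing ideal
   of X: the coordinate ring of a Zariski closed X with its reduced structure. *)
definition coord_ring ::
    "nat \<Rightarrow> (nat \<Rightarrow> complex) set \<Rightarrow> ((nat \<Rightarrow> complex) \<Rightarrow> complex) ring" where
  "coord_ring n X =
    \<lparr>carrier = {restrict f X | f. f \<in> poly_funs n},
     mult = (\<lambda>f g. \<lambda>x\<in>X. f x * g x),
     one = (\<lambda>x\<in>X. 1),
     zero = (\<lambda>x\<in>X. 0),
     add = (\<lambda>f g. \<lambda>x\<in>X. f x + g x)\<rparr>"

definition const_fun :: "(nat \<Rightarrow> complex) set \<Rightarrow> complex \<Rightarrow> (nat \<Rightarrow> complex) \<Rightarrow> complex" where
  "const_fun X c = (\<lambda>x\<in>X. c)"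

definition variety :: "nat \<Rightarrow> (nat \<Rightarrow> complex) set \<Rightarrow>
    (((nat \<Rightarrow> complex) \<Rightarrow> complex) set,
     ((nat \<Rightarrow> complex) \<Rightarrow> complex) set \<Rightarrow>
       (((nat \<Rightarrow> complex) \<Rightarrow> complex) \<times> ((nat \<Rightarrow> complex) \<Rightarrow> complex)) set) ringed_space" where
  "variety n X = Spec (coord_ring n X) (const_fun X)"

section \<open>The reflection representation of type \<open>A\<close> and its basic invariants\<close>

definition refl_space :: "nat \<Rightarrow> (nat \<Rightarrow> complex) set" where
  "refl_space l = {x \<in> cspace (l + 1). (\<Sum>i\<le>l. x i) = 0}"

definition S_V :: "nat \<Rightarrow> ((nat \<Rightarrow> complex) \<Rightarrow> complex) ring" where
  "S_V l = coord_ring (l + 1) (refl_space l)"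

definition invariants :: "nat \<Rightarrow> ((nat \<Rightarrow> complex) \<Rightarrow> complex) set" where
  "invariants l =
    {f \<in> carrier (S_V l). \<forall>\<pi>. \<pi> permutes {..l} \<longrightarrow> (\<forall>x\<in>refl_space l. f (x \<circ> \<pi>) = f x)}"

definition homogeneous_on :: "(nat \<Rightarrow> complex) set \<Rightarrow> ((nat \<Rightarrow> complex) \<Rightarrow> complex) \<Rightarrow> bool" where
  "homogeneous_on X f \<longleftrightarrow> (\<exists>d::nat. \<forall>c. \<forall>x\<in>X. f (\<lambda>k. c * x k) = c ^ d * f x)"

(* p 0, ..., p (l - 1) are homogeneous algebraically independent generators of the algebra of
   invariants; p i for i \<ge> l is irrelevant. *)
definition basic_invariants :: "nat \<Rightarrow> (nat \<Rightarrow> (nat \<Rightarrow> complex) \<Rightarrow> complex) \<Rightarrow> bool" where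
  "basic_invariants l p \<longleftrightarrow>
    (\<forall>i<l. p i \<in> invariants l \<and> homogeneous_on (refl_space l) (p i)) \<and>
    (\<forall>F\<in>poly_funs l. (\<forall>x\<in>refl_space l. F (\<lambda>i. p i x) = 0) \<longrightarrow> (\<forall>y. F y = 0)) \<and>
    (\<forall>f\<in>invariants l. \<exists>F\<in>poly_funs l. f = (\<lambda>x\<in>refl_space l. F (\<lambda>i. p i x)))"

(* Linear coordinates c on V are given by the basis b of V dual to them:
   x = c 0 * b 0 + ... + c (l - 1) * b (l - 1). *)
definition linear_coordinates :: "nat \<Rightarrow> (nat \<Rightarrow> nat \<Rightarrow> complex) \<Rightarrow> bool" where
  "linear_coordinates l b \<longleftrightarrow>
    (\<forall>j<l. b j \<in> refl_space l) \<and>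
    (\<forall>x\<in>refl_space l. \<exists>!c. c \<in> cspace l \<and> x = (\<lambda>i. \<Sum>j<l. c j * b j i))"

section \<open>The ring \<open>\<tilde>S\<close> of the arrangement\<close>

(* The partial derivative with respect to the j-th coordinate is the derivative along b j. *)
definition jacobian_matrix :: "nat \<Rightarrow> (nat \<Rightarrow> (nat \<Rightarrow> complex) \<Rightarrow> complex) \<Rightarrow>
    (nat \<Rightarrow> nat \<Rightarrow> complex) \<Rightarrow> (nat \<Rightarrow> complex) \<Rightarrow> complex mat" where
  "jacobian_matrix l p b x = mat l l (\<lambda>(i, j). deriv (\<lambda>t. p i (\<lambda>k. x k + t * b j k)) 0)"

definition Delta :: "nat \<Rightarrow> (nat \<Rightarrow> (nat \<Rightarrow> complex) \<Rightarrow> complex) \<Rightarrow>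
    (nat \<Rightarrow> nat \<Rightarrow> complex) \<Rightarrow> (nat \<Rightarrow> complex) \<Rightarrow> complex" where
  "Delta l p b = (\<lambda>x\<in>refl_space l. det (jacobian_matrix l p b x))"

(* The minor obtained by deleting row i and column j; for l = 1 it is the determinant 1 of the
   empty matrix, so that the ideal of minors is the unit ideal. *)
definition jacobian_minor :: "nat \<Rightarrow> (nat \<Rightarrow> (nat \<Rightarrow> complex) \<Rightarrow> complex) \<Rightarrow>
    (nat \<Rightarrow> nat \<Rightarrow> complex) \<Rightarrow> nat \<Rightarrow> nat \<Rightarrow> (nat \<Rightarrow> complex) \<Rightarrow> complex" where
  "jacobian_minor l p b i j = (\<lambda>x\<in>refl_space l. det (mat_delete (jacobian_matrix l p b x) i j))"

definition S_A :: "nat \<Rightarrow> (nat \<Rightarrow> (nat \<Rightarrow> complex) \<Rightarrow> complex) \<Rightarrow>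
    (nat \<Rightarrow> nat \<Rightarrow> complex) \<Rightarrow> ((nat \<Rightarrow> complex) \<Rightarrow> complex) set ring" where
  "S_A l p b = S_V l Quot (PIdl\<^bsub>S_V l\<^esub> (Delta l p b))"

definition to_S_A :: "nat \<Rightarrow> (nat \<Rightarrow> (nat \<Rightarrow> complex) \<Rightarrow> complex) \<Rightarrow>
    (nat \<Rightarrow> nat \<Rightarrow> complex) \<Rightarrow> ((nat \<Rightarrow> complex) \<Rightarrow> complex) \<Rightarrow>
    ((nat \<Rightarrow> complex) \<Rightarrow> complex) set" where
  "to_S_A l p b f = (PIdl\<^bsub>S_V l\<^esub> (Delta l p b)) +>\<^bsub>S_V l\<^esub> f"

definition I_tilde :: "nat \<Rightarrow> (nat \<Rightarrow> (nat \<Rightarrow> complex) \<Rightarrow> complex) \<Rightarrow>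
    (nat \<Rightarrow> nat \<Rightarrow> complex) \<Rightarrow> ((nat \<Rightarrow> complex) \<Rightarrow> complex) set set" where
  "I_tilde l p b =
    Idl\<^bsub>S_A l p b\<^esub> {to_S_A l p b (jacobian_minor l p b i j) | i j. i < l \<and> j < l}"

definition Q_A :: "nat \<Rightarrow> (nat \<Rightarrow> (nat \<Rightarrow> complex) \<Rightarrow> complex) \<Rightarrow>
    (nat \<Rightarrow> nat \<Rightarrow> complex) \<Rightarrow>
    (((nat \<Rightarrow> complex) \<Rightarrow> complex) set \<times> ((nat \<Rightarrow> complex) \<Rightarrow> complex) set) set ring" where
  "Q_A l p b = total_fractions (S_A l p b)"

(* The endomorphism ring of I_tilde, as the subring of all q in Q_A with q I_tilde \<subseteq> I_tilde. *)
definition S_tilde :: "nat \<Rightarrow> (nat \<Rightarrow> (nat \<Rightarrow> complex) \<Rightarrow> complex) \<Rightarrow>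
    (nat \<Rightarrow> nat \<Rightarrow> complex) \<Rightarrow>
    (((nat \<Rightarrow> complex) \<Rightarrow> complex) set \<times> ((nat \<Rightarrow> complex) \<Rightarrow> complex) set) set ring" where
  "S_tilde l p b = (Q_A l p b)
    \<lparr>carrier := {q \<in> carrier (Q_A l p b).
       \<forall>a\<in>I_tilde l p b. q \<otimes>\<^bsub>Q_A l p b\<^esub> to_fractions (S_A l p b) a
         \<in> to_fractions (S_A l p b) ` I_tilde l p b}\<rparr>"

definition S_tilde_const :: "nat \<Rightarrow> (nat \<Rightarrow> (nat \<Rightarrow> complex) \<Rightarrow> complex) \<Rightarrow>
    (nat \<Rightarrow> nat \<Rightarrow> complex) \<Rightarrow> complex \<Rightarrow>
    (((nat \<Rightarrow> complex) \<Rightarrow> complex) set \<times> ((nat \<Rightarrow> complex) \<Rightarrow> complex) set) set" where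
  "S_tilde_const l p b c = to_fractions (S_A l p b) (to_S_A l p b (const_fun (refl_space l) c))"

section \<open>The subspace arrangement\<close>

definition L_arr :: "nat \<Rightarrow> (nat \<Rightarrow> complex) set" where
  "L_arr l = (\<Union>j\<le>l. \<Union>i<j. {x \<in> cspace (l + 1). x i = 0 \<and> x j = 0})"

end

theory Submission
  imports Defs
begin

text \<open>
  The isomorphism is induced by \<open>x \<mapsto> x - a (1, \<dots>, 1)\<close>, where \<open>a\<close> is the repeated coordinate of
  a point \<open>x\<close> of \<open>\<A>\<close>: it maps the mirror \<open>x\<^sub>i = x\<^sub>j\<close> onto the component \<open>y\<^sub>i = y\<^sub>j = 0\<close> of
  \<open>L\<close>.  Comparison with the power sums, by a degree count, shows that \<open>det J\<close> is a nonzero constant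
  times the Vandermonde product.  Let \<open>E\<^sub>k\<close> be, up to a constant, the Vandermonde product in the
  variables other than \<open>x\<^sub>k\<close>, with signs such that \<open>\<Sum>\<^sub>k E\<^sub>k = 0\<close>.  On the mirror \<open>x\<^sub>i = x\<^sub>j\<close>
  all \<open>E\<^sub>k\<close> with \<open>k \<noteq> i, j\<close> vanish and \<open>E\<^sub>i = - E\<^sub>j\<close>.  As the invariants have no derivative
  along the root of a mirror, the minors of \<open>J\<close> and the functions \<open>E\<^sub>k\<close> generate the same ideal
  modulo \<open>\<Delta>\<close>.

  Since \<open>a = x\<^sub>k\<close> wherever \<open>E\<^sub>k\<close> does not vanish, a polynomial \<open>g (x, a)\<close> multiplies \<open>E\<^sub>k\<close> by
  the polynomial \<open>g (x, x\<^sub>k)\<close> and so preserves the ideal.  Conversely, an endomorphism multiplies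
  \<open>E\<^sub>k\<close> by a polynomial \<open>g\<^sub>k\<close>, and \<open>g\<^sub>i = g\<^sub>j\<close> on \<open>x\<^sub>i = x\<^sub>j\<close>; Newton interpolation yields a single
  polynomial \<open>g\<close> with \<open>g\<^sub>k = g (x, x\<^sub>k)\<close> for all \<open>k\<close>.
\<close>

section \<open>Functoriality of the spectrum\<close>

text \<open>The basic invariants are arbitrary, so there is no formula for \<open>J\<close>. Two
  facts replace it: on a mirror every invariant has zero derivative along the root, and the power
  sums, whose Jacobian matrix \<open>Jq\<close> is explicit, are polynomials in the invariants. The
  functions \<open>E k\<close> are the coordinates of a vector field, the last column of the
  adjugate of \<open>Jq\<close>: it annihilates all power sums of degree up to \<open>l\<close>, and
  Lagrange interpolation at the nodes x_k turns this into the Vandermonde formula. The repeated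
  coordinate a need not be a function on the arrangement: where mirrors with disjoint index pairs
  meet, it can have two values. It exists as a fraction, with the denominator
  \<open>\<delta>\<close>, and this is why endomorphisms of the ideal of minors, and not just
  elements of \<open>S_A\<close>, appear. All divisibility rests on two elementary facts: a
  polynomial that vanishes on a mirror is a multiple of its equation, and a product that vanishes on
  an affine subspace has a vanishing factor.\<close>

lemma primeideal_subset:
  assumes "primeideal P R"
  shows "P \<subseteq> carrier R"
  using ideal.Icarr[OF primeideal.axioms(1)[OF assms]] by blast

locale cring_iso =
  R1: cring R1 + R2: cring R2
  for R1 :: "('a, 'm) ring_scheme" (structure) and R2 :: "('b, 'n) ring_scheme" (structure) +
  fixes \<alpha> :: "'a \<Rightarrow> 'b"
  assumes iso: "\<alpha> \<in> ring_iso R1 R2"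
begin

lemmas iso_closed = ring_iso_memE(1)[OF iso]
  and iso_mult = ring_iso_memE(2)[OF iso]
  and iso_add = ring_iso_memE(3)[OF iso]
  and iso_one = ring_iso_memE(4)[OF iso]
  and iso_bij = ring_iso_memE(5)[OF iso]

lemma iso_inj: "inj_on \<alpha> (carrier R1)"
  using iso_bij by (simp add: bij_betw_def)

lemma iso_img: "\<alpha> ` carrier R1 = carrier R2"
  using iso_bij by (simp add: bij_betw_def)

text \<open>Elements of a localization are concrete classes of pairs, so an isomorphism acts on them
  by taking images of both components.\<close>

abbreviation fimg :: "('a \<times> 'a) set \<Rightarrow> ('b \<times> 'b) set" where
  "fimg X \<equiv> map_prod \<alpha> \<alpha> ` X"

lemma cring_iso_inverse: "cring_iso R2 R1 (inv_into (carrier R1) \<alpha>)"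
  by (intro cring_iso.intro cring_iso_axioms.intro ring_iso_set_sym iso)
    (unfold_locales)

lemma fraction_transport:
  assumes "M \<subseteq> carrier R1" "a \<in> carrier R1" "s \<in> carrier R1"
  shows "fraction R2 (\<alpha> ` M) (\<alpha> a) (\<alpha> s) = fimg (fraction R1 M a s)"
proof -
  have key: "\<alpha> u \<otimes>\<^bsub>R2\<^esub> (\<alpha> t \<otimes>\<^bsub>R2\<^esub> \<alpha> a) = \<alpha> u \<otimes>\<^bsub>R2\<^esub> (\<alpha> s \<otimes>\<^bsub>R2\<^esub> \<alpha> b) \<longleftrightarrow>
      u \<otimes>\<^bsub>R1\<^esub> (t \<otimes>\<^bsub>R1\<^esub> a) = u \<otimes>\<^bsub>R1\<^esub> (s \<otimes>\<^bsub>R1\<^esub> b)"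
    if "u \<in> M" "t \<in> M" "b \<in> carrier R1" for u t b
  proof -
    have c: "u \<in> carrier R1" "t \<in> carrier R1" using that assms(1) by auto
    have "\<alpha> u \<otimes>\<^bsub>R2\<^esub> (\<alpha> t \<otimes>\<^bsub>R2\<^esub> \<alpha> a) = \<alpha> (u \<otimes>\<^bsub>R1\<^esub> (t \<otimes>\<^bsub>R1\<^esub> a))"
      "\<alpha> u \<otimes>\<^bsub>R2\<^esub> (\<alpha> s \<otimes>\<^bsub>R2\<^esub> \<alpha> b) = \<alpha> (u \<otimes>\<^bsub>R1\<^esub> (s \<otimes>\<^bsub>R1\<^esub> b))"
      using c that assms by (simp_all add: iso_mult)
    moreover have "u \<otimes>\<^bsub>R1\<^esub> (t \<otimes>\<^bsub>R1\<^esub> a) \<in> carrier R1" "u \<otimes>\<^bsub>R1\<^esub> (s \<otimes>\<^bsub>R1\<^esub> b) \<in> carrier R1"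
      using c that assms by simp_all
    ultimately show ?thesis using iso_inj by (metis inj_onD)
  qed
  show ?thesis
  proof (intro Set.set_eqI iffI)
    fix z assume "z \<in> fraction R2 (\<alpha> ` M) (\<alpha> a) (\<alpha> s)"
    then obtain b t u where *: "z = (\<alpha> b, \<alpha> t)" "b \<in> carrier R1" "t \<in> M" "u \<in> M"
      "\<alpha> u \<otimes>\<^bsub>R2\<^esub> (\<alpha> t \<otimes>\<^bsub>R2\<^esub> \<alpha> a) = \<alpha> u \<otimes>\<^bsub>R2\<^esub> (\<alpha> s \<otimes>\<^bsub>R2\<^esub> \<alpha> b)"
      unfolding fraction_def iso_img[symmetric] by blast
    then have "(b, t) \<in> fraction R1 M a s" unfolding fraction_def using key by auto
    then show "z \<in> fimg (fraction R1 M a s)" using *(1) by force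
  next
    fix z assume "z \<in> fimg (fraction R1 M a s)"
    then obtain b t u where *: "z = (\<alpha> b, \<alpha> t)" "b \<in> carrier R1" "t \<in> M" "u \<in> M"
      "u \<otimes>\<^bsub>R1\<^esub> (t \<otimes>\<^bsub>R1\<^esub> a) = u \<otimes>\<^bsub>R1\<^esub> (s \<otimes>\<^bsub>R1\<^esub> b)"
      unfolding fraction_def by auto
    then show "z \<in> fraction R2 (\<alpha> ` M) (\<alpha> a) (\<alpha> s)"
      unfolding fraction_def using key iso_closed by auto
  qed
qed

lemma localization_carrier_transport:
  assumes "M \<subseteq> carrier R1"
  shows "carrier (localization R2 (\<alpha> ` M)) = (\<lambda>X. fimg X) ` carrier (localization R1 M)"
proof -
  have "carrier (localization R2 (\<alpha> ` M)) =
      {fraction R2 (\<alpha> ` M) (\<alpha> a) (\<alpha> s) | a s. a \<in> carrier R1 \<and> s \<in> M}"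
    unfolding localization_def iso_img[symmetric] by auto
  also have "\<dots> = {fimg (fraction R1 M a s) | a s. a \<in> carrier R1 \<and> s \<in> M}"
    using fraction_transport[OF assms] assms by (metis (no_types, opaque_lifting) subsetD)
  also have "\<dots> = (\<lambda>X. fimg X) ` carrier (localization R1 M)"
    unfolding localization_def by auto
  finally show ?thesis .
qed

lemma localization_one_transport:
  assumes "M \<subseteq> carrier R1"
  shows "\<one>\<^bsub>localization R2 (\<alpha> ` M)\<^esub> = fimg \<one>\<^bsub>localization R1 M\<^esub>"
  using fraction_transport[OF assms, of "\<one>\<^bsub>R1\<^esub>" "\<one>\<^bsub>R1\<^esub>"]
  by (simp add: localization_def iso_one)

text \<open>The operations are unions over all representatives, so it suffices to transport each
  single fraction, and \<open>X\<close> and \<open>Y\<close> may be arbitrary sets of pairs.\<close>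

lemma localization_mult_transport:
  assumes "M \<subseteq> carrier R1" "X \<subseteq> carrier R1 \<times> carrier R1" "Y \<subseteq> carrier R1 \<times> carrier R1"
  shows "fimg X \<otimes>\<^bsub>localization R2 (\<alpha> ` M)\<^esub> fimg Y = fimg (X \<otimes>\<^bsub>localization R1 M\<^esub> Y)"
proof -
  have *: "fraction R2 (\<alpha> ` M) (\<alpha> a \<otimes>\<^bsub>R2\<^esub> \<alpha> b) (\<alpha> s \<otimes>\<^bsub>R2\<^esub> \<alpha> t) =
      fimg (fraction R1 M (a \<otimes>\<^bsub>R1\<^esub> b) (s \<otimes>\<^bsub>R1\<^esub> t))"
    if "(a, s) \<in> X" "(b, t) \<in> Y" for a s b t
  proof -
    have "a \<in> carrier R1" "s \<in> carrier R1" "b \<in> carrier R1" "t \<in> carrier R1"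
      using that assms by auto
    then show ?thesis
      using fraction_transport[OF assms(1), of "a \<otimes>\<^bsub>R1\<^esub> b" "s \<otimes>\<^bsub>R1\<^esub> t"] by (simp add: iso_mult)
  qed
  have "fimg X \<otimes>\<^bsub>localization R2 (\<alpha> ` M)\<^esub> fimg Y =
     (\<Union>(a, s)\<in>X. \<Union>(b, t)\<in>Y. fraction R2 (\<alpha> ` M) (\<alpha> a \<otimes>\<^bsub>R2\<^esub> \<alpha> b) (\<alpha> s \<otimes>\<^bsub>R2\<^esub> \<alpha> t))"
    by (simp add: localization_def case_prod_beta)
  also have "\<dots> = (\<Union>(a, s)\<in>X. \<Union>(b, t)\<in>Y. fimg (fraction R1 M (a \<otimes>\<^bsub>R1\<^esub> b) (s \<otimes>\<^bsub>R1\<^esub> t)))"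
    using * by (intro SUP_cong refl) (auto simp: case_prod_beta)
  also have "\<dots> = fimg (X \<otimes>\<^bsub>localization R1 M\<^esub> Y)"
    unfolding localization_def by (simp add: image_UN case_prod_beta)
  finally show ?thesis .
qed

lemma localization_add_transport:
  assumes "M \<subseteq> carrier R1" "X \<subseteq> carrier R1 \<times> carrier R1" "Y \<subseteq> carrier R1 \<times> carrier R1"
  shows "fimg X \<oplus>\<^bsub>localization R2 (\<alpha> ` M)\<^esub> fimg Y = fimg (X \<oplus>\<^bsub>localization R1 M\<^esub> Y)"
proof -
  have *: "fraction R2 (\<alpha> ` M) ((\<alpha> t \<otimes>\<^bsub>R2\<^esub> \<alpha> a) \<oplus>\<^bsub>R2\<^esub> (\<alpha> s \<otimes>\<^bsub>R2\<^esub> \<alpha> b)) (\<alpha> s \<otimes>\<^bsub>R2\<^esub> \<alpha> t) =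
      fimg (fraction R1 M ((t \<otimes>\<^bsub>R1\<^esub> a) \<oplus>\<^bsub>R1\<^esub> (s \<otimes>\<^bsub>R1\<^esub> b)) (s \<otimes>\<^bsub>R1\<^esub> t))"
    if "(a, s) \<in> X" "(b, t) \<in> Y" for a s b t
  proof -
    have "a \<in> carrier R1" "s \<in> carrier R1" "b \<in> carrier R1" "t \<in> carrier R1"
      using that assms by auto
    then show ?thesis
      using fraction_transport[OF assms(1), of "(t \<otimes>\<^bsub>R1\<^esub> a) \<oplus>\<^bsub>R1\<^esub> (s \<otimes>\<^bsub>R1\<^esub> b)" "s \<otimes>\<^bsub>R1\<^esub> t"]
      by (simp add: iso_mult iso_add)
  qed
  have "fimg X \<oplus>\<^bsub>localization R2 (\<alpha> ` M)\<^esub> fimg Y =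
     (\<Union>(a, s)\<in>X. \<Union>(b, t)\<in>Y. fraction R2 (\<alpha> ` M)
        ((\<alpha> t \<otimes>\<^bsub>R2\<^esub> \<alpha> a) \<oplus>\<^bsub>R2\<^esub> (\<alpha> s \<otimes>\<^bsub>R2\<^esub> \<alpha> b)) (\<alpha> s \<otimes>\<^bsub>R2\<^esub> \<alpha> t))"
    by (simp add: localization_def case_prod_beta)
  also have "\<dots> = (\<Union>(a, s)\<in>X. \<Union>(b, t)\<in>Y.
      fimg (fraction R1 M ((t \<otimes>\<^bsub>R1\<^esub> a) \<oplus>\<^bsub>R1\<^esub> (s \<otimes>\<^bsub>R1\<^esub> b)) (s \<otimes>\<^bsub>R1\<^esub> t)))"
    using * by (intro SUP_cong refl) (auto simp: case_prod_beta)
  also have "\<dots> = fimg (X \<oplus>\<^bsub>localization R1 M\<^esub> Y)"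
    unfolding localization_def by (simp add: image_UN case_prod_beta)
  finally show ?thesis .
qed

lemma localization_carrier_subset:
  assumes "M \<subseteq> carrier R1" "X \<in> carrier (localization R1 M)"
  shows "X \<subseteq> carrier R1 \<times> carrier R1"
  using assms unfolding localization_def fraction_def by auto

lemma fimg_inj:
  assumes "X \<subseteq> carrier R1 \<times> carrier R1" "Y \<subseteq> carrier R1 \<times> carrier R1" "fimg X = fimg Y"
  shows "X = Y"
proof -
  have "inj_on (map_prod \<alpha> \<alpha>) (carrier R1 \<times> carrier R1)"
    using iso_inj by (auto simp: inj_on_def)
  then show ?thesis using assms by (meson inj_on_image_eq_iff)
qed

abbreviation preimg :: "'b set \<Rightarrow> 'a set" where
  "preimg Q \<equiv> inv_into (carrier R1) \<alpha> ` Q"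

lemma preimg_image: "P \<subseteq> carrier R1 \<Longrightarrow> preimg (\<alpha> ` P) = P"
  using iso_inj by (simp add: inv_into_image_cancel)

lemma preimg_image_family:
  assumes "\<And>P. P \<in> U \<Longrightarrow> P \<subseteq> carrier R1"
  shows "(\<lambda>Q. preimg Q) ` (`) \<alpha> ` U = U"
proof -
  have "(\<lambda>Q. preimg Q) ` (`) \<alpha> ` U = (\<lambda>P. P) ` U"
    unfolding image_image[of "\<lambda>Q. preimg Q"]
    by (intro image_cong refl preimg_image assms)
  then show ?thesis by simp
qed

lemma image_preimg: "Q \<subseteq> carrier R2 \<Longrightarrow> \<alpha> ` preimg Q = Q"
  using iso_img by (simp add: image_inv_into_cancel)

lemma complement_image:
  assumes "P \<subseteq> carrier R1"
  shows "carrier R2 - \<alpha> ` P = \<alpha> ` (carrier R1 - P)"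
  using assms iso_img iso_inj by (metis inj_on_image_set_diff Diff_subset)

text \<open>The image under \<open>\<alpha>\<close> is the preimage under the inverse isomorphism,
  and preimages of prime ideals are prime.\<close>

lemma primeideal_image:
  assumes "primeideal P R1"
  shows "primeideal (\<alpha> ` P) R2"
proof -
  let ?\<beta> = "inv_into (carrier R1) \<alpha>"
  interpret B: cring_iso R2 R1 ?\<beta> by (rule cring_iso_inverse)
  have h: "ring_hom_ring R2 R1 ?\<beta>"
    using B.iso by (intro ring_hom_ringI2 R1.ring_axioms R2.ring_axioms) (simp add: ring_iso_def)
  have P: "P \<subseteq> carrier R1"
    using assms by (rule primeideal_subset)
  have "\<alpha> ` P = {r \<in> carrier R2. ?\<beta> r \<in> P}"
  proof (intro Set.set_eqI iffI)
    fix r assume "r \<in> \<alpha> ` P"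
    then obtain x where "x \<in> P" "r = \<alpha> x" by auto
    then show "r \<in> {r \<in> carrier R2. ?\<beta> r \<in> P}"
      using P iso_closed iso_inj by (auto simp: inv_into_f_f)
  next
    fix r assume "r \<in> {r \<in> carrier R2. ?\<beta> r \<in> P}"
    then show "r \<in> \<alpha> ` P"
      using iso_img by (metis (no_types, lifting) f_inv_into_f image_eqI mem_Collect_eq)
  qed
  then show ?thesis
    using ring_hom_ring.primeideal_vimage[OF h R2.is_cring assms] by simp
qed

end

section \<open>Prime spectra and structure sheaves under a ring isomorphism\<close>

lemma (in cring) topspace_zariski: "topspace (zariski R) = {P. primeideal P R}"
proof -
  \<comment> \<open>Hence the basic open set belonging to 1 is already the whole set of
    primes.\<close>
  have "\<one> \<notin> P" if "primeideal P R" for P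
    using ideal.one_imp_carrier[OF primeideal.axioms(1)[OF that]] primeideal.I_notcarr[OF that]
    by auto
  then show ?thesis
    unfolding zariski_def topology_generated_by_topspace by auto
qed

context cring_iso
begin

lemma continuous_image: "continuous_map (zariski R1) (zariski R2) ((`) \<alpha>)"
proof -
  have "continuous_map (zariski R1)
      (topology_generated_by {{P. primeideal P R2 \<and> f \<notin> P} | f. f \<in> carrier R2}) ((`) \<alpha>)"
  proof (rule continuous_on_generated_topo)
    fix U assume "U \<in> {{P. primeideal P R2 \<and> f \<notin> P} | f. f \<in> carrier R2}"
    then obtain f where f: "f \<in> carrier R1" and U: "U = {P. primeideal P R2 \<and> \<alpha> f \<notin> P}"
      unfolding iso_img[symmetric] by blast
    have "(`) \<alpha> -` U \<inter> topspace (zariski R1) = {P. primeideal P R1 \<and> f \<notin> P}"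
      unfolding R1.topspace_zariski U
      using f primeideal_image inj_on_image_mem_iff[OF iso_inj f primeideal_subset] by blast
    then show "openin (zariski R1) ((`) \<alpha> -` U \<inter> topspace (zariski R1))"
      unfolding zariski_def using f by (auto intro!: topology_generated_by_Basis)
  next
    show "(`) \<alpha> ` topspace (zariski R1) \<subseteq> \<Union>{{P. primeideal P R2 \<and> f \<notin> P} | f. f \<in> carrier R2}"
      using R2.topspace_zariski primeideal_image
      unfolding R1.topspace_zariski zariski_def topology_generated_by_topspace by blast
  qed
  then show ?thesis by (simp add: zariski_def)
qed

lemma homeomorphic_maps_image:
  "homeomorphic_maps (zariski R1) (zariski R2) ((`) \<alpha>) preimg"
  unfolding homeomorphic_maps_def R1.topspace_zariski R2.topspace_zariski
  using continuous_image cring_iso.continuous_image[OF cring_iso_inverse]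
  by (simp add: preimg_image image_preimg primeideal_subset)

lemma openin_image:
  assumes "openin (zariski R1) U"
  shows "openin (zariski R2) ((`) \<alpha> ` U)"
  using homeomorphic_maps_image assms
  by (metis homeomorphic_maps_map homeomorphic_map_openness_eq)

definition push :: "'a set set \<Rightarrow> ('a set \<Rightarrow> ('a \<times> 'a) set) \<Rightarrow> 'b set \<Rightarrow> ('b \<times> 'b) set" where
  "push U s = (\<lambda>Q \<in> (`) \<alpha> ` U. fimg (s (preimg Q)))"

lemma push_apply: "P \<in> U \<Longrightarrow> P \<subseteq> carrier R1 \<Longrightarrow> push U s (\<alpha> ` P) = fimg (s P)"
  by (auto simp: push_def preimg_image)

lemma openin_subset_carrier:
  assumes "openin (zariski R1) U" "P \<in> U"
  shows "P \<subseteq> carrier R1"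
  using assms openin_subset[OF assms(1)] by (auto simp: R1.topspace_zariski dest!: primeideal_subset)

lemma push_closed:
  assumes U: "openin (zariski R1) U" and s: "s \<in> carrier (spec_sections R1 U)"
  shows "push U s \<in> carrier (spec_sections R2 ((`) \<alpha> ` U))"
proof -
  note sub = openin_subset_carrier[OF U]
  have 1: "push U s \<in> (\<Pi>\<^sub>E Q\<in>(`) \<alpha> ` U. carrier (stalk R2 Q))"
  proof (rule PiE_I)
    fix Q assume "Q \<in> (`) \<alpha> ` U"
    then obtain P where P: "P \<in> U" "Q = \<alpha> ` P" by auto
    have "s P \<in> carrier (stalk R1 P)" using s P(1) by (auto simp: spec_sections_def)
    then show "push U s Q \<in> carrier (stalk R2 Q)"
      using P sub push_apply
      by (simp add: stalk_def complement_image localization_carrier_transport)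
  qed (simp add: push_def)
  have 2: "\<exists>U' f g. openin (zariski R2) U' \<and> Q \<in> U' \<and> U' \<subseteq> (`) \<alpha> ` U \<and>
          f \<in> carrier R2 \<and> g \<in> carrier R2 \<and>
          (\<forall>Q\<in>U'. g \<notin> Q \<and> push U s Q = fraction R2 (carrier R2 - Q) f g)"
    if "Q \<in> (`) \<alpha> ` U" for Q
  proof -
    obtain P where P: "P \<in> U" "Q = \<alpha> ` P" using \<open>Q \<in> (`) \<alpha> ` U\<close> by auto
    obtain U' f g where U': "openin (zariski R1) U'" "P \<in> U'" "U' \<subseteq> U"
      and fg: "f \<in> carrier R1" "g \<in> carrier R1"
      and loc: "\<And>Q. Q \<in> U' \<Longrightarrow> g \<notin> Q \<and> s Q = fraction R1 (carrier R1 - Q) f g"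
      using s P(1) unfolding spec_sections_def by auto
    show ?thesis
    proof (intro exI conjI ballI)
      show "openin (zariski R2) ((`) \<alpha> ` U')" using U' openin_image by blast
      show "Q \<in> (`) \<alpha> ` U'" "(`) \<alpha> ` U' \<subseteq> (`) \<alpha> ` U" using U' P by auto
      show "\<alpha> f \<in> carrier R2" "\<alpha> g \<in> carrier R2" using fg iso_closed by auto
      fix T assume "T \<in> (`) \<alpha> ` U'"
      then obtain T' where T': "T' \<in> U'" "T = \<alpha> ` T'" by auto
      have subT: "T' \<subseteq> carrier R1" using T' U' sub by auto
      show "\<alpha> g \<notin> T" using loc[OF T'(1)] T'(2) fg subT iso_inj by (auto simp: inj_on_image_mem_iff)
      show "push U s T = fraction R2 (carrier R2 - T) (\<alpha> f) (\<alpha> g)"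
        using loc[OF T'(1)] T' U'(3) subT fg
        by (simp add: push_apply subsetD complement_image fraction_transport)
    qed
  qed
  show ?thesis using 1 2 by (simp add: spec_sections_def)
qed

lemma stalk_subset:
  assumes "s \<in> carrier (spec_sections R1 U)" "P \<in> U"
  shows "s P \<subseteq> carrier R1 \<times> carrier R1"
proof -
  have "s P \<in> carrier (stalk R1 P)" using assms by (auto simp: spec_sections_def)
  then show ?thesis unfolding stalk_def by (rule localization_carrier_subset[rotated]) auto
qed

lemma push_inj:
  assumes U: "openin (zariski R1) U"
    and s: "s \<in> carrier (spec_sections R1 U)" and t: "t \<in> carrier (spec_sections R1 U)"
    and eq: "push U s = push U t"
  shows "s = t"
proof -
  have "s \<in> extensional U" "t \<in> extensional U"
    using s t by (auto simp: spec_sections_def PiE_def)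
  moreover have "s P = t P" if "P \<in> U" for P
  proof -
    have "fimg (s P) = fimg (t P)"
      using fun_cong[OF eq, of "\<alpha> ` P"] push_apply[OF that openin_subset_carrier[OF U that]] by simp
    then show ?thesis using fimg_inj stalk_subset[OF s that] stalk_subset[OF t that] by blast
  qed
  ultimately show ?thesis by (rule extensionalityI)
qed

lemma push_inverse:
  assumes U: "openin (zariski R1) U" and s: "s \<in> carrier (spec_sections R1 U)"
  shows "cring_iso.push R2 (inv_into (carrier R1) \<alpha>) ((`) \<alpha> ` U) (push U s) = s"
proof -
  let ?\<beta> = "inv_into (carrier R1) \<alpha>"
  interpret B: cring_iso R2 R1 ?\<beta> by (rule cring_iso_inverse)
  note sub = openin_subset_carrier[OF U]
  have UU: "(`) ?\<beta> ` (`) \<alpha> ` U = U"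
    by (rule preimg_image_family) (rule sub)
  have ap: "B.push ((`) \<alpha> ` U) (push U s) P = s P" if "P \<in> U" for P
  proof -
    have "B.push ((`) \<alpha> ` U) (push U s) (?\<beta> ` (\<alpha> ` P)) = map_prod ?\<beta> ?\<beta> ` push U s (\<alpha> ` P)"
      using that sub[OF that] iso_closed by (intro B.push_apply) auto
    also have "\<dots> = map_prod ?\<beta> ?\<beta> ` map_prod \<alpha> \<alpha> ` s P"
      using that sub[OF that] by (simp add: push_apply)
    also have "\<dots> = s P"
    proof -
      have "map_prod ?\<beta> ?\<beta> (map_prod \<alpha> \<alpha> z) = z" if "z \<in> s P" for z
        using stalk_subset[OF s \<open>P \<in> U\<close>] that iso_inj by (cases z) (auto simp: inv_into_f_f)
      then show ?thesis by (force simp: image_image)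
    qed
    finally show ?thesis using sub[OF that] by (simp add: preimg_image)
  qed
  have "s \<in> extensional U" using s by (auto simp: spec_sections_def PiE_def)
  moreover have "B.push ((`) \<alpha> ` U) (push U s) \<in> extensional U"
    using UU by (simp add: B.push_def)
  ultimately show ?thesis using ap extensionalityI by blast
qed

lemma push_iso:
  assumes U: "openin (zariski R1) U"
  shows "push U \<in> ring_iso (spec_sections R1 U) (spec_sections R2 ((`) \<alpha> ` U))"
proof (rule ring_iso_memI)
  note sub = openin_subset_carrier[OF U]
  let ?\<beta> = "inv_into (carrier R1) \<alpha>"
  interpret B: cring_iso R2 R1 ?\<beta> by (rule cring_iso_inverse)
  have eqI: "push U s = t" if "t \<in> extensional ((`) \<alpha> ` U)" "\<And>P. P \<in> U \<Longrightarrow> fimg (s P) = t (\<alpha> ` P)" for s t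
  proof (rule extensionalityI[OF _ that(1)])
    fix Q assume "Q \<in> (`) \<alpha> ` U"
    then obtain P where "P \<in> U" "Q = \<alpha> ` P" by auto
    then show "push U s Q = t Q" using that(2) push_apply sub by simp
  qed (simp add: push_def)
  show "push U s \<in> carrier (spec_sections R2 ((`) \<alpha> ` U))" if "s \<in> carrier (spec_sections R1 U)" for s
    using push_closed[OF U that] .
  show "push U (s \<otimes>\<^bsub>spec_sections R1 U\<^esub> t) = push U s \<otimes>\<^bsub>spec_sections R2 ((`) \<alpha> ` U)\<^esub> push U t"
    if "s \<in> carrier (spec_sections R1 U)" "t \<in> carrier (spec_sections R1 U)" for s t
    using stalk_subset[OF that(1)] stalk_subset[OF that(2)] sub
    by (intro eqI) (auto simp: spec_sections_def stalk_def push_apply complement_image localization_mult_transport)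
  show "push U (s \<oplus>\<^bsub>spec_sections R1 U\<^esub> t) = push U s \<oplus>\<^bsub>spec_sections R2 ((`) \<alpha> ` U)\<^esub> push U t"
    if "s \<in> carrier (spec_sections R1 U)" "t \<in> carrier (spec_sections R1 U)" for s t
    using stalk_subset[OF that(1)] stalk_subset[OF that(2)] sub
    by (intro eqI) (auto simp: spec_sections_def stalk_def push_apply complement_image localization_add_transport)
  show "push U \<one>\<^bsub>spec_sections R1 U\<^esub> = \<one>\<^bsub>spec_sections R2 ((`) \<alpha> ` U)\<^esub>"
    using sub
    by (intro eqI) (auto simp: spec_sections_def stalk_def complement_image localization_one_transport)
  show "bij_betw (push U) (carrier (spec_sections R1 U)) (carrier (spec_sections R2 ((`) \<alpha> ` U)))"
  proof (rule bij_betw_imageI)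
    show "inj_on (push U) (carrier (spec_sections R1 U))"
      using push_inj[OF U] by (auto simp: inj_on_def)
    have UU: "(`) ?\<beta> ` (`) \<alpha> ` U = U"
      by (rule preimg_image_family) (rule sub)
    have "t \<in> push U ` carrier (spec_sections R1 U)" if t: "t \<in> carrier (spec_sections R2 ((`) \<alpha> ` U))" for t
    proof -
      note U2 = openin_image[OF U]
      let ?s = "B.push ((`) \<alpha> ` U) t"
      have s: "?s \<in> carrier (spec_sections R1 U)" using B.push_closed[OF U2 t] UU by simp
      \<comment> \<open>The push along the inverse sends both \<open>push U ?s\<close> and
        \<open>t\<close> to \<open>?s\<close>. It is injective, so a one-sided inverse law is enough
        for surjectivity.\<close>
      have "B.push ((`) \<alpha> ` U) (push U ?s) = ?s" using push_inverse[OF U s] .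
      then have "push U ?s = t" using B.push_inj[OF U2 push_closed[OF U s] t] by simp
      then show ?thesis using s by force
    qed
    then show "push U ` carrier (spec_sections R1 U) = carrier (spec_sections R2 ((`) \<alpha> ` U))"
      using push_closed[OF U] by auto
  qed
qed

text \<open>Spec is contravariant: the map of spaces takes preimages under \<open>\<alpha>\<close>,
  realised as images under the inverse. The preimage of an open \<open>U\<close> then consists of
  the images of its points under \<open>\<alpha>\<close>, so \<open>push U\<close> is the required
  map on sections over \<open>U\<close>.\<close>

theorem Spec_isomorphic:
  assumes c: "\<And>c. \<sigma>1 c \<in> carrier R1" "\<And>c. \<alpha> (\<sigma>1 c) = \<sigma>2 c"
  shows "Spec R2 \<sigma>2 \<cong>\<^sub>C Spec R1 \<sigma>1"
proof -
  let ?\<beta> = "inv_into (carrier R1) \<alpha>"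
  interpret B: cring_iso R2 R1 ?\<beta> by (rule cring_iso_inverse)
  have pre: "{x \<in> topspace (zariski R2). ?\<beta> ` x \<in> U} = (`) \<alpha> ` U" if U: "openin (zariski R1) U" for U
  proof (intro Set.set_eqI iffI)
    fix x assume "x \<in> {x \<in> topspace (zariski R2). ?\<beta> ` x \<in> U}"
    then have "x \<subseteq> carrier R2" "?\<beta> ` x \<in> U"
      by (auto simp: R2.topspace_zariski dest!: primeideal_subset)
    then show "x \<in> (`) \<alpha> ` U" using image_preimg by (metis image_eqI)
  next
    fix x assume "x \<in> (`) \<alpha> ` U"
    then obtain P where P: "P \<in> U" "x = \<alpha> ` P" by auto
    then have "primeideal P R1" using openin_subset[OF U] by (auto simp: R1.topspace_zariski)
    then show "x \<in> {x \<in> topspace (zariski R2). ?\<beta> ` x \<in> U}"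
      using P primeideal_image by (auto simp: R2.topspace_zariski preimg_image primeideal_subset)
  qed
  have h: "homeomorphic_map (zariski R2) (zariski R1) ((`) ?\<beta>)"
    using homeomorphic_maps_image homeomorphic_maps_map by blast
  have sc: "push U (scalar (Spec R1 \<sigma>1) U c) = scalar (Spec R2 \<sigma>2) ((`) \<alpha> ` U) c"
    if U: "openin (zariski R1) U" for U c
  proof (rule extensionalityI[where A = "(`) \<alpha> ` U"])
    fix Q assume "Q \<in> (`) \<alpha> ` U"
    then obtain P where P: "P \<in> U" "Q = \<alpha> ` P" by auto
    have "fimg (fraction R1 (carrier R1 - P) (\<sigma>1 c) \<one>\<^bsub>R1\<^esub>) = fraction R2 (carrier R2 - Q) (\<sigma>2 c) \<one>\<^bsub>R2\<^esub>"
      using P openin_subset_carrier[OF U P(1)] fraction_transport[of "carrier R1 - P" "\<sigma>1 c" "\<one>\<^bsub>R1\<^esub>"] c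
      by (simp add: complement_image iso_one)
    then show "push U (scalar (Spec R1 \<sigma>1) U c) Q = scalar (Spec R2 \<sigma>2) ((`) \<alpha> ` U) c Q"
      using P openin_subset_carrier[OF U P(1)] by (simp add: push_apply Spec_def)
  qed (auto simp: push_def Spec_def)
  have rs: "push U' (restrict s U') = restrict (push U s) ((`) \<alpha> ` U')" if "U' \<subseteq> U" "openin (zariski R1) U" for U U' s
    using that openin_subset_carrier[OF that(2)]
    by (auto simp: push_def fun_eq_iff restrict_def preimg_image)
  show ?thesis
    unfolding isomorphic_over_C_def Let_def
    by (rule exI[of _ "(`) ?\<beta>"], rule exI[of _ push], intro conjI allI impI)
      (auto simp: Spec_def h pre push_iso rs sc[unfolded Spec_def, simplified])
qed

end

section \<open>Polynomial functions on the reflection representation\<close>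

lemma poly_funs_sum:
  "(\<And>a. a \<in> A \<Longrightarrow> f a \<in> poly_funs n) \<Longrightarrow> (\<lambda>x. \<Sum>a\<in>A. f a x) \<in> poly_funs n"
  by (induction A rule: infinite_finite_induct) (auto intro: poly_funs.intros)

lemma poly_funs_prod:
  "(\<And>a. a \<in> A \<Longrightarrow> f a \<in> poly_funs n) \<Longrightarrow> (\<lambda>x. \<Prod>a\<in>A. f a x) \<in> poly_funs n"
  by (induction A rule: infinite_finite_induct) (auto intro: poly_funs.intros)

lemma poly_funs_uminus: "f \<in> poly_funs n \<Longrightarrow> (\<lambda>x. - f x) \<in> poly_funs n"
  using poly_funs.mult[OF poly_funs.const[of "-1"], of f n] by simp

lemma poly_funs_diff:
  "f \<in> poly_funs n \<Longrightarrow> g \<in> poly_funs n \<Longrightarrow> (\<lambda>x. f x - g x) \<in> poly_funs n"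
  using poly_funs.add[OF _ poly_funs_uminus, of f n g] by simp

lemma poly_funs_power: "f \<in> poly_funs n \<Longrightarrow> (\<lambda>x. f x ^ m) \<in> poly_funs n"
  by (induction m) (auto intro: poly_funs.intros)

lemma poly_funs_divide: "f \<in> poly_funs n \<Longrightarrow> (\<lambda>x. f x / c) \<in> poly_funs n"
  using poly_funs.mult[OF _ poly_funs.const[of "1 / c"], of f n] by simp

lemmas poly_funs_intros = poly_funs.intros poly_funs_sum poly_funs_prod poly_funs_diff
  poly_funs_uminus poly_funs_power poly_funs_divide

lemma poly_funs_compose:
  assumes "f \<in> poly_funs n" "\<And>k. k < n \<Longrightarrow> (\<lambda>x. c x k) \<in> poly_funs m"
  shows "(\<lambda>x. f (c x)) \<in> poly_funs m"
  using assms(1) by induction (auto intro: poly_funs.intros assms(2))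

lemma poly_funs_cong:
  assumes "f \<in> poly_funs n" "\<And>k. k < n \<Longrightarrow> x k = y k"
  shows "f x = f y"
  using assms(1) by induction (auto simp: assms(2))

text \<open>Restriction to a line reduces questions about polynomial functions to univariate
  polynomials; it yields cancellation on affine subspaces and, along rays, degree
  comparisons.\<close>

lemma poly_funs_on_line:
  assumes "f \<in> poly_funs n"
  shows "\<exists>P. \<forall>t. f (\<lambda>k. x k + t * v k) = poly P t"
  using assms
proof induction
  case (const c)
  show ?case by (rule exI[of _ "[:c:]"]) simp
next
  case (coord i)
  show ?case by (rule exI[of _ "[:x i, v i:]"]) (simp add: mult.commute)
next
  case (add f g)
  then obtain P Q where "\<forall>t. f (\<lambda>k. x k + t * v k) = poly P t"
    "\<forall>t. g (\<lambda>k. x k + t * v k) = poly Q t" by blast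
  then show ?case by (intro exI[of _ "P + Q"]) simp
next
  case (mult f g)
  then obtain P Q where "\<forall>t. f (\<lambda>k. x k + t * v k) = poly P t"
    "\<forall>t. g (\<lambda>k. x k + t * v k) = poly Q t" by blast
  then show ?case by (intro exI[of _ "P * Q"]) simp
qed

section \<open>Cancellation on affine subspaces\<close>

definition line_closed :: "(nat \<Rightarrow> complex) set \<Rightarrow> bool" where
  "line_closed U \<longleftrightarrow> (\<forall>x\<in>U. \<forall>y\<in>U. \<forall>t. (\<lambda>k. x k + t * (y k - x k)) \<in> U)"

text \<open>Affine subspaces are irreducible: on the line through \<open>x0\<close> and
  \<open>x1\<close> both functions become univariate polynomials with zero product, and the first is
  nonzero at \<open>x0\<close>.\<close>

lemma poly_funs_zero_product:
  assumes "line_closed U" "f \<in> poly_funs n" "g \<in> poly_funs n"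
    and fg: "\<And>x. x \<in> U \<Longrightarrow> f x * g x = 0"
    and x0: "x0 \<in> U" "f x0 \<noteq> 0" and x1: "x1 \<in> U"
  shows "g x1 = 0"
proof -
  obtain P where P: "\<And>t. f (\<lambda>k. x0 k + t * (x1 k - x0 k)) = poly P t"
    using poly_funs_on_line[OF assms(2), where v = "\<lambda>k. x1 k - x0 k"] by blast
  obtain Q where Q: "\<And>t. g (\<lambda>k. x0 k + t * (x1 k - x0 k)) = poly Q t"
    using poly_funs_on_line[OF assms(3), where v = "\<lambda>k. x1 k - x0 k"] by blast
  have "poly (P * Q) t = 0" for t
    using assms(1) x0(1) x1 fg by (simp add: line_closed_def flip: P Q)
  then have "P * Q = 0" using poly_all_0_iff_0 by blast
  moreover have "P \<noteq> 0" using P[of 0] x0(2) by auto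
  ultimately have "Q = 0" by simp
  then show ?thesis using Q[of 1] by simp
qed

lemma poly_funs_cancel:
  assumes "line_closed U" "f \<in> poly_funs n" "g \<in> poly_funs n" "h \<in> poly_funs n"
    and "\<And>x. x \<in> U \<Longrightarrow> f x * g x = f x * h x"
    and "x0 \<in> U" "f x0 \<noteq> 0" and "x \<in> U"
  shows "g x = h x"
  using poly_funs_zero_product[OF assms(1,2) poly_funs_diff[OF assms(3,4)] _ assms(6,7,8)] assms(5)
  by (simp add: algebra_simps)

text \<open>Partial derivatives are pinned down by the chain rule along every curve differentiable
  at 0. Lines would not be enough: composition with the invariants yields general curves, see
  \<open>chain_rule\<close>.\<close>

definition gradient ::
    "nat \<Rightarrow> ((nat \<Rightarrow> complex) \<Rightarrow> complex) \<Rightarrow> (nat \<Rightarrow> (nat \<Rightarrow> complex) \<Rightarrow> complex) \<Rightarrow> bool" where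
  "gradient n f d \<longleftrightarrow> (\<forall>k. d k \<in> poly_funs n) \<and>
    (\<forall>c c'. (\<forall>k<n. ((\<lambda>t. c t k) has_field_derivative c' k) (at 0)) \<longrightarrow>
       ((\<lambda>t. f (c t)) has_field_derivative (\<Sum>k<n. d k (c 0) * c' k)) (at (0::complex)))"

lemma gradientI:
  assumes "\<And>k. d k \<in> poly_funs n"
    and "\<And>c c'. \<forall>k<n. ((\<lambda>t. c t k) has_field_derivative c' k) (at 0) \<Longrightarrow>
       ((\<lambda>t. f (c t)) has_field_derivative (\<Sum>k<n. d k (c 0) * c' k)) (at (0::complex))"
  shows "gradient n f d"
  unfolding gradient_def using assms by blast

lemma gradient_poly_funs: "gradient n f d \<Longrightarrow> d k \<in> poly_funs n"
  unfolding gradient_def by blast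

lemma gradientD:
  assumes "gradient n f d"
    and "\<forall>k<n. ((\<lambda>t. c t k) has_field_derivative c' k) (at 0)"
  shows "((\<lambda>t. f (c t)) has_field_derivative (\<Sum>k<n. d k (c 0) * c' k)) (at (0::complex))"
  using assms unfolding gradient_def by blast

lemma poly_funs_gradient:
  assumes "f \<in> poly_funs n"
  shows "\<exists>d. gradient n f d"
  using assms
proof induction
  case (const a)
  show ?case by (rule exI[of _ "\<lambda>k x. 0"], rule gradientI) (auto intro: poly_funs.intros)
next
  case (coord i)
  have "(\<Sum>k<n. (if k = i then 1 else 0) * c' k) = c' i" for c' :: "nat \<Rightarrow> complex"
    using coord by (simp add: if_distrib[of "\<lambda>z. z * _"] cong: if_cong)
  then show ?case using coord
    by (intro exI[of _ "\<lambda>k x. if k = i then 1 else 0"] gradientI) (auto intro: poly_funs.intros)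
next
  case (add f g)
  then obtain d e where d: "gradient n f d" and e: "gradient n g e" by blast
  show ?case
  proof (intro exI[of _ "\<lambda>k x. d k x + e k x"] gradientI)
    show "(\<lambda>x. d k x + e k x) \<in> poly_funs n" for k
      by (intro poly_funs.add gradient_poly_funs[OF d] gradient_poly_funs[OF e])
    fix c :: "complex \<Rightarrow> nat \<Rightarrow> complex" and c' assume "\<forall>k<n. ((\<lambda>t. c t k) has_field_derivative c' k) (at 0)"
    from DERIV_add[OF gradientD[OF d this] gradientD[OF e this]]
    show "((\<lambda>t. f (c t) + g (c t)) has_field_derivative (\<Sum>k<n. (d k (c 0) + e k (c 0)) * c' k)) (at (0::complex))"
      by (simp add: distrib_right sum.distrib)
  qed
next
  case (mult f g)
  then obtain d e where d: "gradient n f d" and e: "gradient n g e" by blast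
  show ?case
  proof (intro exI[of _ "\<lambda>k x. d k x * g x + f x * e k x"] gradientI)
    show "(\<lambda>x. d k x * g x + f x * e k x) \<in> poly_funs n" for k
      by (intro poly_funs.add poly_funs.mult gradient_poly_funs[OF d] gradient_poly_funs[OF e] mult.hyps)
    fix c :: "complex \<Rightarrow> nat \<Rightarrow> complex" and c' assume "\<forall>k<n. ((\<lambda>t. c t k) has_field_derivative c' k) (at 0)"
    from DERIV_mult[OF gradientD[OF d this] gradientD[OF e this]]
    show "((\<lambda>t. f (c t) * g (c t)) has_field_derivative
        (\<Sum>k<n. (d k (c 0) * g (c 0) + f (c 0) * e k (c 0)) * c' k)) (at (0::complex))"
    proof (rule DERIV_cong)
      show "(\<Sum>k<n. d k (c 0) * c' k) * g (c 0) + (\<Sum>k<n. e k (c 0) * c' k) * f (c 0) =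
          (\<Sum>k<n. (d k (c 0) * g (c 0) + f (c 0) * e k (c 0)) * c' k)"
        unfolding sum_distrib_right sum.distrib[symmetric]
        by (intro sum.cong refl) (simp add: algebra_simps)
    qed
  qed
qed

section \<open>The space V, its mirrors and translation along (1, ..., 1)\<close>

definition mean :: "nat \<Rightarrow> (nat \<Rightarrow> complex) \<Rightarrow> complex" where
  "mean l x = (\<Sum>i\<le>l. x i) / of_nat (l + 1)"

text \<open>Kept at 0 beyond index \<open>l\<close>, so that the result lies in
  \<open>cspace (l + 1)\<close>. For \<open>x\<close> in V both \<open>x\<close> and
  \<open>c\<close> are recovered from the shifted point through \<open>mean\<close>, so a polynomial
  in the pair (x, c) is a polynomial in the \<open>l + 1\<close> coordinates of that point.\<close>

definition shift :: "nat \<Rightarrow> complex \<Rightarrow> (nat \<Rightarrow> complex) \<Rightarrow> nat \<Rightarrow> complex" where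
  "shift l c x = (\<lambda>k. if k \<le> l then x k - c else 0)"

definition hyper :: "nat \<Rightarrow> nat \<Rightarrow> nat \<Rightarrow> (nat \<Rightarrow> complex) set" where
  "hyper l i j = {x \<in> refl_space l. x i = x j}"

text \<open>The converse of a dependent sum, because finiteness and the cardinality 0 + ... +
  \<open>l\<close> are immediate in this form.\<close>

definition pairs :: "nat \<Rightarrow> (nat \<times> nat) set" where
  "pairs l = (SIGMA j:{..l}. {..<j})\<inverse>"

lemma mem_pairs: "(i, j) \<in> pairs l \<longleftrightarrow> i < j \<and> j \<le> l"
  by (auto simp: pairs_def)

lemma finite_pairs: "finite (pairs l)"
  unfolding pairs_def by simp

lemma hyper_subset: "x \<in> hyper l i j \<Longrightarrow> x \<in> refl_space l"
  by (simp add: hyper_def)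

lemma shift_mean_in_refl_space: "shift l (mean l x) x \<in> refl_space l"
proof -
  have "(\<Sum>i\<le>l. shift l (mean l x) x i) = (\<Sum>i\<le>l. x i) - of_nat (l + 1) * mean l x"
    by (simp add: shift_def sum_subtractf)
  also have "\<dots> = 0" unfolding mean_def by (simp add: field_simps del: of_nat_Suc of_nat_add)
  finally show ?thesis by (simp add: refl_space_def cspace_def shift_def)
qed

lemma shift_in_cspace: "shift l c x \<in> cspace (l + 1)"
  by (simp add: shift_def cspace_def)

lemma mean_shift:
  assumes "x \<in> refl_space l"
  shows "mean l (shift l c x) = - c"
  using assms unfolding mean_def shift_def refl_space_def
  by (simp add: sum_subtractf field_simps del: of_nat_Suc of_nat_add)

lemma shift_shift_mean:
  assumes "x \<in> refl_space l"
  shows "shift l (mean l (shift l c x)) (shift l c x) = x"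
  unfolding mean_shift[OF assms] using assms
  by (auto simp: shift_def refl_space_def cspace_def fun_eq_iff)

lemma shift_mean_shift:
  assumes "y \<in> cspace (l + 1)" "k \<le> l" "y k = 0"
  shows "shift l (shift l (mean l y) y k) (shift l (mean l y) y) = y"
  using assms by (auto simp: shift_def cspace_def fun_eq_iff)

lemma line_closed_refl_space: "line_closed (refl_space l)"
  unfolding line_closed_def refl_space_def cspace_def
  by (simp add: sum.distrib sum_subtractf flip: sum_distrib_left)

lemma line_closed_hyper: "line_closed (hyper l i j)"
  using line_closed_refl_space[of l] unfolding line_closed_def hyper_def by auto

lemma mean_poly_funs: "mean l \<in> poly_funs (l + 1)"
proof -
  have "(\<lambda>x. (\<Sum>i\<le>l. x i) / of_nat (l + 1)) \<in> poly_funs (l + 1)"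
    by (intro poly_funs_intros) auto
  then show ?thesis by (simp add: mean_def[abs_def])
qed

lemma poly_funs_shift:
  assumes "f \<in> poly_funs (l + 1)" "c \<in> poly_funs (l + 1)"
  shows "(\<lambda>x. f (shift l (c x) x)) \<in> poly_funs (l + 1)"
  using assms(1)
proof (rule poly_funs_compose)
  fix k assume "k < l + 1"
  then have "(\<lambda>x. shift l (c x) x k) = (\<lambda>x. x k - c x)" by (auto simp: shift_def)
  then show "(\<lambda>x. shift l (c x) x k) \<in> poly_funs (l + 1)"
    using assms(2) \<open>k < l + 1\<close> by (auto intro: poly_funs_intros)
qed

text \<open>A point on exactly one mirror: it witnesses that the other differences do not vanish
  identically on this mirror and can be cancelled there.\<close>

lemma hyper_generic_point:
  assumes "i < j" "j \<le> l"
  obtains x where "x \<in> hyper l i j"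
    and "\<And>a b. a \<le> l \<Longrightarrow> b \<le> l \<Longrightarrow> a \<noteq> b \<Longrightarrow> {a, b} \<noteq> {i, j} \<Longrightarrow> x a \<noteq> x b"
proof
  define y :: "nat \<Rightarrow> complex" where "y = (\<lambda>m. if m = j then of_nat i else of_nat m)"
  define x where "x = shift l (mean l y) y"
  show "x \<in> hyper l i j"
    using shift_mean_in_refl_space[of l y] assms by (simp add: hyper_def x_def shift_def y_def)
  show "x a \<noteq> x b" if "a \<le> l" "b \<le> l" "a \<noteq> b" "{a, b} \<noteq> {i, j}" for a b
    using that by (auto simp: x_def shift_def y_def)
qed

lemma refl_space_generic_point:
  obtains x where "x \<in> refl_space l" and "\<And>a b. a \<le> l \<Longrightarrow> b \<le> l \<Longrightarrow> a \<noteq> b \<Longrightarrow> x a \<noteq> x b"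
proof
  define y :: "nat \<Rightarrow> complex" where "y = of_nat"
  show "shift l (mean l y) y \<in> refl_space l" by (rule shift_mean_in_refl_space)
  show "shift l (mean l y) y a \<noteq> shift l (mean l y) y b" if "a \<le> l" "b \<le> l" "a \<noteq> b" for a b
    using that by (auto simp: shift_def y_def)
qed

text \<open>The midpoint projection onto \<open>x\<^sub>i = x\<^sub>j\<close> differs from the identity by a multiple of
  \<open>x\<^sub>i - x\<^sub>j\<close>, so this difference factors out of every polynomial.\<close>

lemma poly_funs_diff_projection:
  assumes "f \<in> poly_funs n" "i < n" "j < n" "i \<noteq> j"
  shows "\<exists>g\<in>poly_funs n. \<forall>x. f x - f (x(i := (x i + x j) / 2, j := (x i + x j) / 2)) = (x i - x j) * g x"
  using assms(1)
proof induction
  case (const c)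
  show ?case by (rule bexI[OF _ poly_funs.const[of 0]]) simp
next
  case (coord k)
  show ?case
    using \<open>i \<noteq> j\<close>
    by (intro bexI[OF _ poly_funs.const[of "if k = i then 1/2 else if k = j then -1/2 else 0"]])
      (auto simp: field_simps)
next
  case (add f g)
  define q where "q = (\<lambda>x::nat \<Rightarrow> complex. x(i := (x i + x j) / 2, j := (x i + x j) / 2))"
  obtain u v where uv: "u \<in> poly_funs n" "v \<in> poly_funs n"
    "\<And>x. f x - f (q x) = (x i - x j) * u x"
    "\<And>x. g x - g (q x) = (x i - x j) * v x" using add.IH unfolding q_def by blast
  have "f x + g x - (f (q x) + g (q x)) = (x i - x j) * (u x + v x)" for x
    using arg_cong2[OF uv(3)[of x] uv(4)[of x], of "(+)"] by (simp add: algebra_simps)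
  then show ?case unfolding q_def
    by (intro bexI[of _ "\<lambda>x. u x + v x"] allI poly_funs.add uv(1,2))
next
  case (mult f g)
  define q where "q = (\<lambda>x::nat \<Rightarrow> complex. x(i := (x i + x j) / 2, j := (x i + x j) / 2))"
  obtain u v where uv: "u \<in> poly_funs n" "v \<in> poly_funs n"
    "\<And>x. f x - f (q x) = (x i - x j) * u x"
    "\<And>x. g x - g (q x) = (x i - x j) * v x" using mult.IH unfolding q_def by blast
  have gq: "(\<lambda>x. g (q x)) \<in> poly_funs n"
    using mult.hyps(2)
  proof (rule poly_funs_compose)
    fix k assume "k < n"
    have "(\<lambda>x. q x k) = (if k = i \<or> k = j then (\<lambda>x. (x i + x j) / 2) else (\<lambda>x. x k))"
      by (auto simp: q_def)
    then show "(\<lambda>x. q x k) \<in> poly_funs n"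
      using assms(2,3) \<open>k < n\<close> by (auto intro!: poly_funs_intros)
  qed
  have "f x * g x - f (q x) * g (q x) = (x i - x j) * (f x * v x + u x * g (q x))" for x
  proof -
    have "f x * g x - f (q x) * g (q x) = f x * (g x - g (q x)) + (f x - f (q x)) * g (q x)"
      by (simp add: algebra_simps)
    then show ?thesis unfolding uv(3,4) by (simp add: algebra_simps)
  qed
  moreover have pf: "(\<lambda>x. f x * v x + u x * g (q x)) \<in> poly_funs n"
    by (intro poly_funs.add poly_funs.mult uv(1,2) gq mult.hyps)
  ultimately have "\<exists>h\<in>poly_funs n. \<forall>x. f x * g x - f (q x) * g (q x) = (x i - x j) * h x"
    by (intro bexI[OF _ pf]) simp
  then show ?case unfolding q_def .
qed

text \<open>The midpoint projection preserves the coordinate sum and so maps V into the mirror,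
  where \<open>f\<close> is 0; the difference factored above is then \<open>f\<close>
  itself.\<close>

lemma poly_funs_divisible:
  assumes "f \<in> poly_funs (l + 1)" "i < j" "j \<le> l"
    and "\<And>x. x \<in> hyper l i j \<Longrightarrow> f x = 0"
  shows "\<exists>g\<in>poly_funs (l + 1). \<forall>x\<in>refl_space l. f x = (x i - x j) * g x"
proof -
  obtain g where g: "g \<in> poly_funs (l + 1)"
    "\<And>x. f x - f (x(i := (x i + x j) / 2, j := (x i + x j) / 2)) = (x i - x j) * g x"
    using poly_funs_diff_projection[OF assms(1), of i j] assms(2,3) by auto
  have "x(i := (x i + x j) / 2, j := (x i + x j) / 2) \<in> hyper l i j" if "x \<in> refl_space l" for x
  proof -
    have rm: "(\<Sum>k\<le>l. y k) = y i + y j + (\<Sum>k\<in>{..l} - {i, j}. y k)" for y :: "nat \<Rightarrow> complex"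
    proof -
      have "(\<Sum>k\<le>l. y k) = (\<Sum>k\<in>{i, j}. y k) + (\<Sum>k\<in>{..l} - {i, j}. y k)"
        using assms(2,3) by (subst sum.subset_diff[of "{i, j}"]) auto
      then show ?thesis using assms(2) by simp
    qed
    have "(\<Sum>k\<in>{..l} - {i, j}. (x(i := (x i + x j) / 2, j := (x i + x j) / 2)) k) =
        (\<Sum>k\<in>{..l} - {i, j}. x k)" by (rule sum.cong) auto
    then have "(\<Sum>k\<le>l. (x(i := (x i + x j) / 2, j := (x i + x j) / 2)) k) = (\<Sum>k\<le>l. x k)"
      using assms(2) by (subst (1 2) rm) simp
    then show ?thesis using that assms(2,3) by (auto simp: hyper_def refl_space_def cspace_def)
  qed
  then show ?thesis using g assms(4) by (metis diff_zero)
qed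

text \<open>Divide by one difference at a time. The quotient still vanishes on the next mirror: the
  product divided out so far is nonzero at a generic point there, and the mirror is
  irreducible.\<close>

lemma poly_funs_divisible_pairs:
  assumes "P \<subseteq> pairs l" "f \<in> poly_funs (l + 1)"
    and "\<And>i j x. (i, j) \<in> P \<Longrightarrow> x \<in> hyper l i j \<Longrightarrow> f x = 0"
  shows "\<exists>g\<in>poly_funs (l + 1). \<forall>x\<in>refl_space l. f x = (\<Prod>(i, j)\<in>P. x i - x j) * g x"
proof -
  have "finite P" using assms(1) finite_pairs finite_subset by blast
  then show ?thesis using assms(1,3)
  proof induction
    case empty
    then show ?case using assms(2) by auto
  next
    case (insert q P)
    obtain i j where q: "q = (i, j)" by fastforce
    then have ij: "i < j" "j \<le> l" using insert.prems(1) by (auto simp: mem_pairs)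
    obtain g where g: "g \<in> poly_funs (l + 1)"
      "\<And>x. x \<in> refl_space l \<Longrightarrow> f x = (\<Prod>(i, j)\<in>P. x i - x j) * g x"
    proof -
      have "\<exists>g\<in>poly_funs (l + 1). \<forall>x\<in>refl_space l. f x = (\<Prod>(i, j)\<in>P. x i - x j) * g x"
        by (rule insert.IH) (use insert.prems in auto)
      then show ?thesis using that by blast
    qed
    obtain x0 where x0: "x0 \<in> hyper l i j"
      "\<And>a b. a \<le> l \<Longrightarrow> b \<le> l \<Longrightarrow> a \<noteq> b \<Longrightarrow> {a, b} \<noteq> {i, j} \<Longrightarrow> x0 a \<noteq> x0 b"
      using hyper_generic_point[OF ij] by metis
    have ne: "(\<Prod>(a, b)\<in>P. x0 a - x0 b) \<noteq> 0"
    proof -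
      have "x0 a \<noteq> x0 b" if "(a, b) \<in> P" for a b
      proof -
        have "(a, b) \<in> pairs l" "(a, b) \<noteq> (i, j)" using that insert.prems(1) insert.hyps q by auto
        then show ?thesis using x0(2)[of a b] ij by (auto simp: mem_pairs doubleton_eq_iff)
      qed
      then show ?thesis using insert.hyps(1) by (auto simp: prod_zero_iff)
    qed
    have pf: "(\<lambda>x. \<Prod>(a, b)\<in>P. x a - x b) \<in> poly_funs (l + 1)"
      using insert.prems(1) by (auto intro!: poly_funs_intros simp: case_prod_beta pairs_def)
    have "g x = 0" if "x \<in> hyper l i j" for x
      using poly_funs_zero_product[OF line_closed_hyper pf g(1) _ x0(1) ne that]
        g(2) insert.prems(2) q hyper_subset by fastforce
    from poly_funs_divisible[OF g(1) ij this]
    obtain h where "h \<in> poly_funs (l + 1)" "\<And>x. x \<in> refl_space l \<Longrightarrow> g x = (x i - x j) * h x"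
      by auto
    then show ?case using g(2) insert.hyps q by (intro bexI[of _ h]) auto
  qed
qed

text \<open>Newton interpolation at the nodes \<open>x\<^sub>0, \<dots>, x\<^sub>l\<close>: the value at the node \<open>t\<close> is encoded
  as a function of \<open>x - t\<close>, from which both \<open>x\<close> and \<open>t\<close> can be recovered as the sum of the
  coordinates of \<open>x\<close> vanishes.\<close>

lemma interpolation:
  assumes g: "\<And>i. i \<le> l \<Longrightarrow> g i \<in> poly_funs (l + 1)"
    and compat: "\<And>i j x. i < j \<Longrightarrow> j \<le> l \<Longrightarrow> x \<in> hyper l i j \<Longrightarrow> g i x = g j x"
    and "m \<le> l + 1"
  shows "\<exists>G\<in>poly_funs (l + 1). \<forall>i<m. \<forall>x\<in>refl_space l. G (shift l (x i) x) = g i x"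
  using assms(3)
proof (induction m)
  case 0
  show ?case by (auto intro: poly_funs.const)
next
  case (Suc m)
  then obtain G where G: "G \<in> poly_funs (l + 1)"
    "\<And>i x. i < m \<Longrightarrow> x \<in> refl_space l \<Longrightarrow> G (shift l (x i) x) = g i x" by auto
  define P where "P = (\<lambda>i. (i, m)) ` {..<m}"
  have P: "P \<subseteq> pairs l" using Suc.prems by (auto simp: P_def mem_pairs)
  have d: "(\<lambda>x. g m x - G (shift l (x m) x)) \<in> poly_funs (l + 1)"
    using Suc.prems by (intro poly_funs_diff g poly_funs_shift G(1) poly_funs.coord) auto
  have z: "g m x - G (shift l (x m) x) = 0" if "(i, j) \<in> P" "x \<in> hyper l i j" for i j x
  proof -
    have ij: "i < m" "j = m" using that by (auto simp: P_def)
    have "G (shift l (x m) x) = G (shift l (x i) x)" using that(2) ij by (simp add: hyper_def)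
    also have "\<dots> = g i x" using G(2)[OF ij(1) hyper_subset[OF that(2)]] .
    also have "\<dots> = g m x" using compat ij that(2) Suc.prems by simp
    finally show ?thesis by simp
  qed
  have "\<exists>e\<in>poly_funs (l + 1). \<forall>x\<in>refl_space l.
      g m x - G (shift l (x m) x) = (\<Prod>(i, j)\<in>P. x i - x j) * e x"
    by (rule poly_funs_divisible_pairs[OF P d]) (rule z)
  then obtain e where e: "e \<in> poly_funs (l + 1)"
    "\<And>x. x \<in> refl_space l \<Longrightarrow> g m x - G (shift l (x m) x) = (\<Prod>(i, j)\<in>P. x i - x j) * e x" by blast
  have prodP: "(\<Prod>(i, j)\<in>P. x i - x j) = (\<Prod>i<m. x i - x m)" for x :: "nat \<Rightarrow> complex"
    unfolding P_def by (subst prod.reindex) (auto simp: inj_on_def)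
  \<comment> \<open>Newton's correction term. For \<open>y = shift l (x m) x\<close> the product is
    the one just divided out and \<open>shift l (mean l y) y\<close> is \<open>x\<close>; at an
    earlier node \<open>x i\<close> the factor with index \<open>i\<close> is 0, so the values
    already attained are kept.\<close>
  define G' where "G' = (\<lambda>y. G y + e (shift l (mean l y) y) * (\<Prod>i<m. y i))"
  have "G' \<in> poly_funs (l + 1)"
    unfolding G'_def using G(1) e(1) mean_poly_funs Suc.prems
    by (intro poly_funs_intros poly_funs_shift) auto
  moreover have "G' (shift l (x i) x) = g i x" if "i < Suc m" "x \<in> refl_space l" for i x
  proof (cases "i = m")
    case True
    have "(\<Prod>i<m. shift l (x m) x i) = (\<Prod>i<m. x i - x m)"
      using Suc.prems by (intro prod.cong) (auto simp: shift_def)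
    then show ?thesis
      using True e(2)[OF that(2)] by (simp add: G'_def shift_shift_mean[OF that(2)] prodP algebra_simps)
  next
    case False
    then have "i < m" using that by simp
    then have "(\<Prod>k<m. shift l (x i) x k) = 0"
      using Suc.prems by (auto simp: prod_zero_iff shift_def)
    then show ?thesis using G(2) \<open>i < m\<close> that by (simp add: G'_def)
  qed
  ultimately show ?case by blast
qed

lemma coord_ring_cring: "cring (coord_ring n X)"
proof (intro cringI abelian_groupI comm_monoidI)
  fix f assume "f \<in> carrier (coord_ring n X)"
  then obtain F where "F \<in> poly_funs n" "f = restrict F X" by (auto simp: coord_ring_def)
  then have "restrict (\<lambda>x. - F x) X \<in> carrier (coord_ring n X)"
    "restrict (\<lambda>x. - F x) X \<oplus>\<^bsub>coord_ring n X\<^esub> f = \<zero>\<^bsub>coord_ring n X\<^esub>"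
    by (auto simp: coord_ring_def fun_eq_iff intro: poly_funs_uminus)
  then show "\<exists>g\<in>carrier (coord_ring n X). g \<oplus>\<^bsub>coord_ring n X\<^esub> f = \<zero>\<^bsub>coord_ring n X\<^esub>" by blast
next
  fix f g assume "f \<in> carrier (coord_ring n X)" "g \<in> carrier (coord_ring n X)"
  then obtain F G where FG: "F \<in> poly_funs n" "f = restrict F X" "G \<in> poly_funs n" "g = restrict G X"
    by (auto simp: coord_ring_def)
  have "f \<oplus>\<^bsub>coord_ring n X\<^esub> g = restrict (\<lambda>x. F x + G x) X"
    "f \<otimes>\<^bsub>coord_ring n X\<^esub> g = restrict (\<lambda>x. F x * G x) X"
    using FG by (auto simp: coord_ring_def fun_eq_iff)
  then show "f \<oplus>\<^bsub>coord_ring n X\<^esub> g \<in> carrier (coord_ring n X)"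
    "f \<otimes>\<^bsub>coord_ring n X\<^esub> g \<in> carrier (coord_ring n X)"
    using poly_funs.add[OF FG(1,3)] poly_funs.mult[OF FG(1,3)] by (auto simp: coord_ring_def)
next
  show "\<zero>\<^bsub>coord_ring n X\<^esub> \<in> carrier (coord_ring n X)" "\<one>\<^bsub>coord_ring n X\<^esub> \<in> carrier (coord_ring n X)"
    unfolding coord_ring_def by (auto intro: poly_funs.const)
qed (auto simp: coord_ring_def fun_eq_iff algebra_simps)

section \<open>The Jacobian matrix and its minors\<close>

lemma det_poly_funs:
  assumes "\<And>x. M x \<in> carrier_mat m m"
    and "\<And>i j. i < m \<Longrightarrow> j < m \<Longrightarrow> (\<lambda>x. M x $$ (i, j)) \<in> poly_funs n"
  shows "(\<lambda>x. det (M x)) \<in> poly_funs n"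
proof -
  have "(\<lambda>x. \<Sum>\<pi> | \<pi> permutes {0..<m}. signof \<pi> * (\<Prod>i = 0..<m. M x $$ (i, \<pi> i))) \<in> poly_funs n"
    by (intro poly_funs_intros assms(2)) (auto simp: permutes_in_image)
  then show ?thesis using det_def'[OF assms(1)] by simp
qed

lemma adj_mat_poly_funs:
  assumes "\<And>x. M x \<in> carrier_mat m m"
    and "\<And>i j. i < m \<Longrightarrow> j < m \<Longrightarrow> (\<lambda>x. M x $$ (i, j)) \<in> poly_funs n"
    and "r < m" "s < m"
  shows "(\<lambda>x. adj_mat (M x) $$ (s, r)) \<in> poly_funs n"
proof -
  have dim: "dim_row (M x) = m" "dim_col (M x) = m" for x using assms(1)[of x] by auto
  have "(\<lambda>x. det (mat_delete (M x) r s)) \<in> poly_funs n"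
  proof (rule det_poly_funs)
    show "mat_delete (M x) r s \<in> carrier_mat (m - 1) (m - 1)" for x
      by (rule mat_delete_carrier[OF assms(1)])
    show "(\<lambda>x. mat_delete (M x) r s $$ (i, j)) \<in> poly_funs n" if "i < m - 1" "j < m - 1" for i j
      using that by (auto simp: mat_delete_def dim intro!: assms(2))
  qed
  then have "(\<lambda>x. (-1) ^ (r + s) * det (mat_delete (M x) r s)) \<in> poly_funs n"
    by (intro poly_funs_intros)
  then show ?thesis using assms(3,4) by (simp add: adj_mat_def dim cofactor_def)
qed

lemma sum_in_refl_space:
  assumes "\<And>j. j < m \<Longrightarrow> v j \<in> refl_space l"
  shows "(\<lambda>k. \<Sum>j<m. c j * v j k) \<in> refl_space l"
proof -
  have "(\<Sum>k\<le>l. \<Sum>j<m. c j * v j k) = (\<Sum>j<m. c j * (\<Sum>k\<le>l. v j k))"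
    unfolding sum_distrib_left by (rule sum.swap)
  then show ?thesis using assms by (auto simp: refl_space_def cspace_def)
qed

lemma line_in_refl_space:
  "x \<in> refl_space l \<Longrightarrow> v \<in> refl_space l \<Longrightarrow> (\<lambda>k. x k + t * v k) \<in> refl_space l"
  by (auto simp: refl_space_def cspace_def sum.distrib simp flip: sum_distrib_left)

lemma scale_in_refl_space: "x \<in> refl_space l \<Longrightarrow> (\<lambda>k. t * x k) \<in> refl_space l"
  by (auto simp: refl_space_def cspace_def simp flip: sum_distrib_left)

section \<open>The Vandermonde product and its factors\<close>

definition vandermonde :: "nat \<Rightarrow> (nat \<Rightarrow> complex) \<Rightarrow> complex" where
  "vandermonde l x = (\<Prod>(i, j)\<in>pairs l. x i - x j)"

text \<open>The derivative at \<open>x k\<close> of the monic polynomial with roots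
  \<open>x 0\<close>, ..., \<open>x l\<close>; up to sign, the quotient of the Vandermonde product
  by the one without \<open>x k\<close>.\<close>

definition node_prod :: "nat \<Rightarrow> nat \<Rightarrow> (nat \<Rightarrow> complex) \<Rightarrow> complex" where
  "node_prod l k x = (\<Prod>m\<in>{..l} - {k}. x k - x m)"

lemma vandermonde_poly_funs: "vandermonde l \<in> poly_funs (l + 1)"
proof -
  have "(\<lambda>x. \<Prod>q\<in>pairs l. x (fst q) - x (snd q)) \<in> poly_funs (l + 1)"
    by (intro poly_funs_intros) (auto simp: pairs_def)
  then show ?thesis by (simp add: vandermonde_def[abs_def] case_prod_beta)
qed

lemma node_prod_poly_funs: "k \<le> l \<Longrightarrow> node_prod l k \<in> poly_funs (l + 1)"
  unfolding node_prod_def[abs_def] by (intro poly_funs_intros) auto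

lemma vandermonde_hyper: "i < j \<Longrightarrow> j \<le> l \<Longrightarrow> x \<in> hyper l i j \<Longrightarrow> vandermonde l x = 0"
  unfolding vandermonde_def using finite_pairs
  by (auto simp: prod_zero_iff mem_pairs hyper_def intro!: bexI[of _ "(i, j)"])

lemma vandermonde_nonzero:
  assumes "\<And>a b. a \<le> l \<Longrightarrow> b \<le> l \<Longrightarrow> a \<noteq> b \<Longrightarrow> x a \<noteq> x b"
  shows "vandermonde l x \<noteq> 0"
  unfolding vandermonde_def using finite_pairs assms by (auto simp: prod_zero_iff mem_pairs)

lemma vandermonde_nonzeroD:
  assumes "vandermonde l x \<noteq> 0" "a \<le> l" "b \<le> l" "a \<noteq> b"
  shows "x a \<noteq> x b"
proof -
  have "x i \<noteq> x j" if "(i, j) \<in> pairs l" for i j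
    using assms(1) that finite_pairs unfolding vandermonde_def by (force simp: prod_zero_iff)
  from this[of a b] this[of b a] show ?thesis using assms by (cases a b rule: linorder_cases) (auto simp: mem_pairs)
qed

lemma node_prod_hyper_nonzero:
  assumes "i < j" "j \<le> l" "k \<le> l" "k \<noteq> i" "k \<noteq> j"
  shows "\<exists>x\<in>hyper l i j. node_prod l k x \<noteq> 0"
proof -
  obtain x where x: "x \<in> hyper l i j"
    "\<And>a b. a \<le> l \<Longrightarrow> b \<le> l \<Longrightarrow> a \<noteq> b \<Longrightarrow> {a, b} \<noteq> {i, j} \<Longrightarrow> x a \<noteq> x b"
    using hyper_generic_point[OF assms(1,2)] by metis
  have "x k \<noteq> x m" if "m \<le> l" "m \<noteq> k" for m
    using x(2)[of k m] that assms by (auto simp: doubleton_eq_iff)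
  then show ?thesis using x(1) by (intro bexI[of _ x]) (auto simp: node_prod_def prod_zero_iff)
qed

lemma vandermonde_scale: "vandermonde l (\<lambda>k. t * x k) = t ^ (\<Sum>j\<le>l. j) * vandermonde l x"
proof -
  have "card (pairs l) = (\<Sum>j\<le>l. j)" by (simp add: pairs_def)
  then show ?thesis
    by (simp add: vandermonde_def case_prod_beta prod.distrib flip: right_diff_distrib)
qed

lemma vandermonde_factor:
  assumes "i < j" "j \<le> l"
  shows "vandermonde l x = (x i - x j) * (\<Prod>(a, b)\<in>pairs l - {(i, j)}. x a - x b)"
  unfolding vandermonde_def using finite_pairs assms
  by (subst prod.remove[of _ "(i, j)"]) (auto simp: mem_pairs)

lemma vandermonde_cofactor_nonzero:
  assumes "i < j" "j \<le> l"
  shows "\<exists>x\<in>hyper l i j. (\<Prod>(a, b)\<in>pairs l - {(i, j)}. x a - x b) \<noteq> 0"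
proof -
  obtain x where x: "x \<in> hyper l i j"
    "\<And>a b. a \<le> l \<Longrightarrow> b \<le> l \<Longrightarrow> a \<noteq> b \<Longrightarrow> {a, b} \<noteq> {i, j} \<Longrightarrow> x a \<noteq> x b"
    using hyper_generic_point[OF assms(1,2)] by metis
  have "x a - x b \<noteq> 0" if "(a, b) \<in> pairs l - {(i, j)}" for a b
    using x(2)[of a b] that assms by (auto simp: mem_pairs doubleton_eq_iff)
  then have "(\<Prod>(a, b)\<in>pairs l - {(i, j)}. x a - x b) \<noteq> 0"
    using finite_pairs by (subst prod_zero_iff) (auto simp del: right_minus_eq)
  then show ?thesis using x(1) by blast
qed

section \<open>Moments of a weight vector on the nodes\<close>

lemma moments_poly:
  fixes v x :: "nat \<Rightarrow> complex"
  assumes "degree \<phi> \<le> l"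
  shows "(\<Sum>k\<le>l. v k * poly \<phi> (x k)) = (\<Sum>r\<le>l. coeff \<phi> r * (\<Sum>k\<le>l. v k * x k ^ r))"
proof -
  have "poly \<phi> t = (\<Sum>r\<le>l. coeff \<phi> r * t ^ r)" for t
    unfolding poly_altdef using assms
    by (intro sum.mono_neutral_left) (auto simp: coeff_eq_0)
  then have "(\<Sum>k\<le>l. v k * poly \<phi> (x k)) = (\<Sum>k\<le>l. \<Sum>r\<le>l. coeff \<phi> r * (v k * x k ^ r))"
    by (simp add: sum_distrib_left mult_ac)
  also have "\<dots> = (\<Sum>r\<le>l. coeff \<phi> r * (\<Sum>k\<le>l. v k * x k ^ r))"
    unfolding sum_distrib_left by (rule sum.swap)
  finally show ?thesis .
qed

text \<open>The test polynomial with roots at the nodes in \<open>N\<close> kills every term but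
  that of \<open>k\<close>. A node other than \<open>k\<close> may be missing from \<open>N\<close>
  if its value occurs there or its weight is 0.\<close>

lemma moments_single:
  fixes v x :: "nat \<Rightarrow> complex"
  assumes "k \<le> l" "N \<subseteq> {..l} - {k}" "\<And>m. m \<le> l \<Longrightarrow> m \<noteq> k \<Longrightarrow> v m \<noteq> 0 \<Longrightarrow> x m \<in> x ` N"
  shows "(\<Sum>m\<le>l. v m * poly (\<Prod>a\<in>N. [:- x a, 1:]) (x m)) = v k * (\<Prod>a\<in>N. x k - x a)"
proof -
  have fin: "finite N" using assms(2) finite_subset by blast
  have "v m * poly (\<Prod>a\<in>N. [:- x a, 1:]) (x m) = 0" if "m \<le> l" "m \<noteq> k" for m
    using assms(3)[OF that] fin by (auto simp: poly_prod prod_zero_iff image_iff)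
  then have "(\<Sum>m\<le>l. v m * poly (\<Prod>a\<in>N. [:- x a, 1:]) (x m)) =
      (\<Sum>m\<in>{k}. v m * poly (\<Prod>a\<in>N. [:- x a, 1:]) (x m))"
    using assms(1) by (intro sum.mono_neutral_right) auto
  then show ?thesis by (simp add: poly_prod)
qed

lemma degree_linear_prod:
  fixes x :: "nat \<Rightarrow> complex"
  shows "degree (\<Prod>a\<in>N. [:- x a, 1:]) = card N"
  by (cases "finite N") (auto simp: degree_prod_eq_sum_degree)

text \<open>Lagrange interpolation: the monic polynomial of degree \<open>l\<close> with roots at
  all nodes but \<open>x k\<close> sees only the moment of order \<open>l\<close>. The resulting
  value does not depend on \<open>k\<close>.\<close>

lemma moments_node_prod:
  fixes v x :: "nat \<Rightarrow> complex"
  assumes "k \<le> l" "\<And>r. r < l \<Longrightarrow> (\<Sum>m\<le>l. v m * x m ^ r) = 0"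
  shows "v k * node_prod l k x = (\<Sum>m\<le>l. v m * x m ^ l)"
proof -
  define \<phi> where "\<phi> = (\<Prod>a\<in>{..l} - {k}. [:- x a, 1:])"
  have deg: "degree \<phi> = l" unfolding \<phi>_def degree_linear_prod using assms(1) by simp
  have lc: "coeff \<phi> l = 1"
    using deg lead_coeff_prod[of "\<lambda>a. [:- x a, 1:]" "{..l} - {k}"] unfolding \<phi>_def by simp
  have "v k * node_prod l k x = (\<Sum>m\<le>l. v m * poly \<phi> (x m))"
    unfolding \<phi>_def node_prod_def using assms(1) by (subst moments_single) auto
  also have "\<dots> = (\<Sum>r\<le>l. coeff \<phi> r * (\<Sum>k\<le>l. v k * x k ^ r))"
    by (rule moments_poly) (simp add: deg)
  also have "\<dots> = (\<Sum>r\<in>{l}. coeff \<phi> r * (\<Sum>k\<le>l. v k * x k ^ r))"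
    by (intro sum.mono_neutral_right) (auto simp: assms(2))
  finally show ?thesis by (simp add: lc)
qed

lemma moments_hyper:
  fixes v x :: "nat \<Rightarrow> complex"
  assumes "i < j" "j \<le> l" "k \<le> l" "k \<noteq> i" "k \<noteq> j" "x i = x j"
    and "\<And>r. r < l \<Longrightarrow> (\<Sum>m\<le>l. v m * x m ^ r) = 0"
  shows "v k * (\<Prod>a\<in>{..l} - {k, j}. x k - x a) = 0"
proof -
  define \<phi> where "\<phi> = (\<Prod>a\<in>{..l} - {k, j}. [:- x a, 1:])"
  have "card ({..l} - {k, j}) < l"
    using assms(1-5) by (subst card_Diff_subset) auto
  then have deg: "degree \<phi> < l" unfolding \<phi>_def degree_linear_prod .
  have "v k * (\<Prod>a\<in>{..l} - {k, j}. x k - x a) = (\<Sum>m\<le>l. v m * poly \<phi> (x m))"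
  proof -
    have "x m \<in> x ` ({..l} - {k, j})" if "m \<le> l" "m \<noteq> k" for m
    proof (cases "m = j")
      case True
      then show ?thesis using assms(1-6) by (intro image_eqI[of _ _ i]) auto
    qed (use that in auto)
    then show ?thesis unfolding \<phi>_def using assms(3) by (subst moments_single) auto
  qed
  also have "\<dots> = (\<Sum>r\<le>l. coeff \<phi> r * (\<Sum>k\<le>l. v k * x k ^ r))"
    using deg by (intro moments_poly) simp
  also have "\<dots> = 0"
    using assms(7) deg by (intro sum.neutral) (auto simp: coeff_eq_0 le_less)
  finally show ?thesis .
qed

text \<open>Along the ray through \<open>x\<close> both factors are univariate polynomials with a
  nonzero constant product, so both have degree 0.\<close>

lemma poly_funs_constant_if_unit:
  assumes "f \<in> poly_funs n" "g \<in> poly_funs n" "c \<noteq> 0"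
    and "\<And>x. x \<in> U \<Longrightarrow> f x * g x = c"
    and "\<And>x t. x \<in> U \<Longrightarrow> (\<lambda>k. t * x k) \<in> U"
    and "x \<in> U"
  shows "f x = f (\<lambda>k. 0)"
proof -
  obtain P where P: "\<And>t. f (\<lambda>k. 0 + t * x k) = poly P t"
    using poly_funs_on_line[OF assms(1), where x = "\<lambda>k. 0"] by blast
  obtain Q where Q: "\<And>t. g (\<lambda>k. 0 + t * x k) = poly Q t"
    using poly_funs_on_line[OF assms(2), where x = "\<lambda>k. 0"] by blast
  have "poly (P * Q) t = poly [:c:] t" for t
    using assms(4)[OF assms(5)[OF assms(6)], of t] by (simp flip: P Q)
  then have PQ: "P * Q = [:c:]" using poly_eq_poly_eq_iff by blast
  then have "P \<noteq> 0" "Q \<noteq> 0" using assms(3) by auto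
  then have "degree P = 0" using PQ degree_mult_eq[of P Q] by simp
  then have "poly P 1 = poly P 0" by (metis degree_eq_zeroE poly_pCons mult_zero_right poly_0)
  then show ?thesis using P[of 1] P[of 0] by simp
qed

section \<open>Basic invariants and their derivatives along V\<close>

locale invariants_type_A =
  fixes l :: nat
    and p :: "nat \<Rightarrow> (nat \<Rightarrow> complex) \<Rightarrow> complex"
    and b :: "nat \<Rightarrow> nat \<Rightarrow> complex"
  assumes l_pos: "l \<ge> 1"
    and invs: "basic_invariants l p"
    and coords: "linear_coordinates l b"
begin

abbreviation "n \<equiv> l + 1"
abbreviation "V \<equiv> refl_space l"

lemma b_in_V: "j < l \<Longrightarrow> b j \<in> V"
  using coords by (simp add: linear_coordinates_def)

text \<open>Coordinates with respect to \<open>b\<close> are needed as linear forms in the ambient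
  coordinates. The number \<open>\<beta> j k\<close> is the \<open>j\<close>-th coordinate of the
  projection \<open>e k\<close> of the \<open>k\<close>-th unit vector to V; a vector
  \<open>v\<close> of V is the combination of the \<open>e k\<close> with weights
  \<open>v k\<close>, as these sum to 0.\<close>

lemma coordinate_functionals:
  "\<exists>\<beta>. (\<forall>v\<in>V. v = (\<lambda>i. \<Sum>j<l. (\<Sum>k\<le>l. \<beta> j k * v k) * b j i)) \<and>
    (\<forall>c. \<forall>j<l. (\<Sum>k\<le>l. \<beta> j k * (\<Sum>j<l. c j * b j k)) = c j)"
proof -
  define e :: "nat \<Rightarrow> nat \<Rightarrow> complex" where
    "e k = shift l (1 / of_nat n) (\<lambda>i. if i = k then 1 else 0)" for k
  have e: "e k \<in> V" if "k \<le> l" for k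
  proof -
    have "mean l (\<lambda>i. if i = k then 1 else 0) = 1 / of_nat n"
      using that by (simp add: mean_def)
    then show ?thesis unfolding e_def using shift_mean_in_refl_space by metis
  qed
  have ex: "\<exists>c. e k = (\<lambda>i. \<Sum>j<l. c j * b j i)" if "k \<le> l" for k
    using coords e[OF that] unfolding linear_coordinates_def by meson
  then obtain \<gamma> where \<gamma>: "\<And>k. k \<le> l \<Longrightarrow> e k = (\<lambda>i. \<Sum>j<l. \<gamma> k j * b j i)" by metis
  define \<beta> where "\<beta> = (\<lambda>j k. \<gamma> k j)"
  have 1: "v = (\<lambda>i. \<Sum>j<l. (\<Sum>k\<le>l. \<beta> j k * v k) * b j i)" if v: "v \<in> V" for v
  proof
    fix i
    have "v i = (\<Sum>k\<le>l. v k * e k i)"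
    proof (cases "i \<le> l")
      case True
      have "(\<Sum>k\<le>l. v k * e k i) = (\<Sum>k\<le>l. (if k = i then v k else 0) - v k * (1 / of_nat n))"
        using True by (intro sum.cong) (auto simp: e_def shift_def algebra_simps)
      also have "\<dots> = v i - (\<Sum>k\<le>l. v k) * (1 / of_nat n)"
        using True by (simp add: sum_subtractf sum_divide_distrib)
      finally show ?thesis using v by (simp add: refl_space_def)
    next
      case False
      then show ?thesis using v by (simp add: e_def shift_def refl_space_def cspace_def)
    qed
    also have "\<dots> = (\<Sum>k\<le>l. \<Sum>j<l. v k * (\<gamma> k j * b j i))"
      by (intro sum.cong refl) (simp add: \<gamma> sum_distrib_left)
    also have "\<dots> = (\<Sum>j<l. \<Sum>k\<le>l. v k * (\<gamma> k j * b j i))" by (rule sum.swap)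
    also have "\<dots> = (\<Sum>j<l. (\<Sum>k\<le>l. \<beta> j k * v k) * b j i)"
      by (intro sum.cong refl) (simp add: \<beta>_def sum_distrib_left mult_ac)
    finally show "v i = (\<Sum>j<l. (\<Sum>k\<le>l. \<beta> j k * v k) * b j i)" .
  qed
  have 2: "(\<Sum>k\<le>l. \<beta> j k * (\<Sum>j<l. c j * b j k)) = c j" if j: "j < l" for c j
  proof -
    define v where "v = (\<lambda>i. \<Sum>j<l. c j * b j i)"
    have v: "v \<in> V" unfolding v_def by (rule sum_in_refl_space) (rule b_in_V)
    \<comment> \<open>Coordinates are unique within \<open>cspace l\<close>, so both families are
      set to 0 from index \<open>l\<close> on.\<close>
    define c1 where "c1 = (\<lambda>j. if j < l then c j else 0)"
    define c2 where "c2 = (\<lambda>j. if j < l then (\<Sum>k\<le>l. \<beta> j k * v k) else 0)"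
    have "c1 \<in> cspace l" "c2 \<in> cspace l" by (auto simp: cspace_def c1_def c2_def)
    moreover have "v = (\<lambda>i. \<Sum>j<l. c1 j * b j i)" by (simp add: v_def c1_def)
    moreover have "v = (\<lambda>i. \<Sum>j<l. c2 j * b j i)"
      using 1[OF v] by (simp add: c2_def)
    moreover have "\<exists>!c. c \<in> cspace l \<and> v = (\<lambda>i. \<Sum>j<l. c j * b j i)"
      using coords v unfolding linear_coordinates_def by blast
    ultimately have "c1 = c2" by blast
    then show ?thesis using j by (auto simp: c1_def c2_def v_def dest: fun_cong[of _ _ j])
  qed
  show ?thesis using 1 2 by (intro exI[of _ \<beta>]) blast
qed

definition \<beta> :: "nat \<Rightarrow> nat \<Rightarrow> complex" where
  "\<beta> = (SOME \<beta>. (\<forall>v\<in>V. v = (\<lambda>i. \<Sum>j<l. (\<Sum>k\<le>l. \<beta> j k * v k) * b j i)) \<and>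
    (\<forall>c. \<forall>j<l. (\<Sum>k\<le>l. \<beta> j k * (\<Sum>j<l. c j * b j k)) = c j))"

lemma expansion: "v \<in> V \<Longrightarrow> v = (\<lambda>i. \<Sum>j<l. (\<Sum>k\<le>l. \<beta> j k * v k) * b j i)"
  and coordinate_eq: "j < l \<Longrightarrow> (\<Sum>k\<le>l. \<beta> j k * (\<Sum>j<l. c j * b j k)) = c j"
  using someI_ex[OF coordinate_functionals, folded \<beta>_def] by blast+

text \<open>An invariant is only a function on V. \<open>P i\<close> is some polynomial on the
  ambient space that extends it and \<open>dP i\<close> some gradient of that; at points of V the
  derivatives \<open>dp\<close> along V depend on \<open>p i\<close> alone.\<close>

definition P :: "nat \<Rightarrow> (nat \<Rightarrow> complex) \<Rightarrow> complex" where
  "P i = (SOME F. F \<in> poly_funs n \<and> p i = restrict F V)"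

definition dP :: "nat \<Rightarrow> nat \<Rightarrow> (nat \<Rightarrow> complex) \<Rightarrow> complex" where
  "dP i = (SOME d. gradient n (P i) d)"

definition dp :: "nat \<Rightarrow> (nat \<Rightarrow> complex) \<Rightarrow> (nat \<Rightarrow> complex) \<Rightarrow> complex" where
  "dp i v x = (\<Sum>k\<le>l. dP i k x * v k)"

lemma P:
  assumes "i < l"
  shows "P i \<in> poly_funs n \<and> p i = restrict (P i) V"
proof -
  have "p i \<in> carrier (S_V l)"
    using invs assms by (simp add: basic_invariants_def invariants_def)
  then have "\<exists>F. F \<in> poly_funs n \<and> p i = restrict F V"
    unfolding S_V_def coord_ring_def by auto
  then show ?thesis unfolding P_def by (rule someI_ex)
qed

lemma dP: "i < l \<Longrightarrow> gradient n (P i) (dP i)"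
  unfolding dP_def using someI_ex[OF poly_funs_gradient[OF conjunct1[OF P]]] .

lemma p_eq_P: "i < l \<Longrightarrow> x \<in> V \<Longrightarrow> p i x = P i x"
  using P by simp

lemma dp_has_derivative:
  assumes "i < l" "x \<in> V" "v \<in> V"
  shows "((\<lambda>t. p i (\<lambda>k. x k + t * v k)) has_field_derivative dp i v x) (at 0)"
proof -
  have "((\<lambda>t. P i (\<lambda>k. x k + t * v k)) has_field_derivative
      (\<Sum>k<n. dP i k (\<lambda>k. x k + 0 * v k) * v k)) (at 0)"
    by (rule gradientD[OF dP[OF assms(1)]]) (auto intro!: derivative_eq_intros)
  moreover have "(\<lambda>t. P i (\<lambda>k. x k + t * v k)) = (\<lambda>t. p i (\<lambda>k. x k + t * v k))"
    using assms line_in_refl_space p_eq_P by auto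
  ultimately show ?thesis by (simp add: dp_def lessThan_Suc_atMost)
qed

text \<open>Agrees with \<open>jacobian_matrix\<close> on V and has polynomial entries everywhere,
  as the divisibility arguments require.\<close>

definition J :: "(nat \<Rightarrow> complex) \<Rightarrow> complex mat" where
  "J x = mat l l (\<lambda>(i, j). dp i (b j) x)"

lemma jacobian_matrix_eq: "x \<in> V \<Longrightarrow> jacobian_matrix l p b x = J x"
  unfolding jacobian_matrix_def J_def
  by (intro cong_mat refl) (auto intro!: DERIV_imp_deriv dp_has_derivative b_in_V)

lemma dp_poly_funs:
  assumes "i < l" "\<And>k. k \<le> l \<Longrightarrow> (\<lambda>x. v x k) \<in> poly_funs n"
  shows "(\<lambda>x. dp i (v x) x) \<in> poly_funs n"
  unfolding dp_def using gradient_poly_funs[OF dP[OF assms(1)]] assms(2)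
  by (intro poly_funs_intros) auto

lemma J_carrier: "J x \<in> carrier_mat l l"
  by (simp add: J_def)

lemma J_poly_funs: "i < l \<Longrightarrow> j < l \<Longrightarrow> (\<lambda>x. J x $$ (i, j)) \<in> poly_funs n"
  using dp_poly_funs[of i "\<lambda>_. b j"] by (simp add: J_def poly_funs.const)

lemma dp_sum: "dp i (\<lambda>k. \<Sum>j<m. c j * v j k) x = (\<Sum>j<m. c j * dp i (v j) x)"
proof -
  have "dp i (\<lambda>k. \<Sum>j<m. c j * v j k) x = (\<Sum>k\<le>l. \<Sum>j<m. c j * (dP i k x * v j k))"
    by (simp add: dp_def sum_distrib_left mult_ac)
  also have "\<dots> = (\<Sum>j<m. \<Sum>k\<le>l. c j * (dP i k x * v j k))" by (rule sum.swap)
  finally show ?thesis by (simp add: dp_def sum_distrib_left)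
qed

lemma dp_scale: "dp i (\<lambda>k. c * v k) x = c * dp i v x"
  by (simp add: dp_def sum_distrib_left mult_ac)

definition root_vec :: "nat \<Rightarrow> nat \<Rightarrow> nat \<Rightarrow> complex" where
  "root_vec i j = (\<lambda>k. if k = i then 1 else if k = j then -1 else 0)"

lemma root_vec_in_V:
  assumes "i < j" "j \<le> l"
  shows "root_vec i j \<in> V"
proof -
  have "(\<Sum>k\<le>l. root_vec i j k) = (\<Sum>k\<in>{i, j}. root_vec i j k)"
    using assms by (intro sum.mono_neutral_right) (auto simp: root_vec_def)
  then show ?thesis using assms by (auto simp: refl_space_def cspace_def root_vec_def)
qed

text \<open>An invariant is even along the root orthogonal to a mirror.\<close>

lemma dp_root:
  assumes "r < l" "i < j" "j \<le> l" "x \<in> hyper l i j"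
  shows "dp r (root_vec i j) x = 0"
proof -
  let ?v = "root_vec i j"
  let ?f = "\<lambda>t. p r (\<lambda>k. x k + t * ?v k)"
  have x: "x \<in> V" using assms(4) by (rule hyper_subset)
  note v = root_vec_in_V[OF assms(2,3)]
  have even: "?f (- t) = ?f t" for t
  proof -
    have "Transposition.transpose i j permutes {..l}"
      using assms by (intro permutes_swap_id) auto
    moreover have "p r \<in> invariants l" using invs assms(1) by (simp add: basic_invariants_def)
    ultimately have "p r ((\<lambda>k. x k + t * ?v k) \<circ> Transposition.transpose i j) = ?f t"
      using line_in_refl_space[OF x v] by (simp add: invariants_def)
    moreover have "(\<lambda>k. x k + t * ?v k) \<circ> Transposition.transpose i j = (\<lambda>k. x k + - t * ?v k)"
      using assms by (auto simp: fun_eq_iff root_vec_def Transposition.transpose_def hyper_def)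
    ultimately show ?thesis by simp
  qed
  have 1: "(?f has_field_derivative dp r ?v x) (at 0)"
    by (rule dp_has_derivative[OF assms(1) x v])
  then have "((\<lambda>t. ?f (- t)) has_field_derivative - dp r ?v x) (at 0)"
    using DERIV_chain2[OF _ DERIV_minus[OF DERIV_ident], of ?f "dp r ?v x" 0 UNIV] by simp
  then have "dp r ?v x = - dp r ?v x" using 1 DERIV_unique unfolding even by blast
  then show ?thesis by simp
qed

section \<open>Comparison with the power sums\<close>

definition power_sum :: "nat \<Rightarrow> (nat \<Rightarrow> complex) \<Rightarrow> complex" where
  "power_sum r x = (\<Sum>k\<le>l. x k ^ (r + 2))"

text \<open>On V the power sum of degree 1 is 0, and the offset 2 makes \<open>r < l\<close> run
  through the degrees 2, ..., \<open>l + 1\<close>. The derivative along \<open>v\<close> is, up to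
  the factor \<open>r + 2\<close>, the moment of order \<open>r + 1\<close> of the weights
  \<open>v\<close> at the nodes \<open>x\<close>.\<close>

definition d_power_sum :: "nat \<Rightarrow> (nat \<Rightarrow> complex) \<Rightarrow> (nat \<Rightarrow> complex) \<Rightarrow> complex" where
  "d_power_sum r v x = of_nat (r + 2) * (\<Sum>k\<le>l. v k * x k ^ (r + 1))"

lemma d_power_sum_has_derivative:
  "((\<lambda>t. power_sum r (\<lambda>k. x k + t * v k)) has_field_derivative d_power_sum r v x) (at 0)"
proof -
  have "((\<lambda>t. (x k + t * v k) ^ (r + 2)) has_field_derivative of_nat (r + 2) * (v k * x k ^ (r + 1))) (at 0)" for k
  proof (rule DERIV_cong)
    have "((\<lambda>t. x k + t * v k) has_field_derivative v k) (at 0)" by (auto intro!: derivative_eq_intros)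
    then show "((\<lambda>t. (x k + t * v k) ^ (r + 2)) has_field_derivative
        of_nat (r + 2) * (v k * (x k + 0 * v k) ^ (r + 2 - Suc 0))) (at 0)"
      by (rule DERIV_power)
  qed simp
  then show ?thesis unfolding power_sum_def d_power_sum_def sum_distrib_left by (rule DERIV_sum)
qed

lemma power_sum_invariant: "restrict (power_sum r) V \<in> invariants l"
proof -
  have "power_sum r \<in> poly_funs n" unfolding power_sum_def[abs_def] by (intro poly_funs_intros) auto
  moreover have "restrict (power_sum r) V (x \<circ> \<pi>) = restrict (power_sum r) V x"
    if \<pi>: "\<pi> permutes {..l}" and x: "x \<in> V" for \<pi> x
  proof -
    have s: "(\<Sum>k\<le>l. f (x (\<pi> k))) = (\<Sum>k\<le>l. f (x k))" for f :: "complex \<Rightarrow> complex"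
      using sum.permute[OF \<pi>, of "\<lambda>k. f (x k)"] by (simp add: o_def)
    have "x \<circ> \<pi> \<in> V"
      using x s[of "\<lambda>z. z"] permutes_not_in[OF \<pi>] by (auto simp: refl_space_def cspace_def)
    then show ?thesis using x s[of "\<lambda>z. z ^ (r + 2)"] by (simp add: power_sum_def)
  qed
  ultimately show ?thesis by (auto simp: invariants_def S_V_def coord_ring_def)
qed

text \<open>The power sums are invariant, hence polynomials in the \<open>p i\<close>;
  differentiation expresses the rows of \<open>Jq\<close> by those of \<open>J\<close>. This is
  where it enters that the \<open>p i\<close> generate all invariants.\<close>

lemma chain_rule:
  "\<exists>T. (\<forall>i. T i \<in> poly_funs n) \<and> (\<forall>x\<in>V. \<forall>v\<in>V. d_power_sum r v x = (\<Sum>i<l. T i x * dp i v x))"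
proof -
  obtain F where F: "F \<in> poly_funs l" "restrict (power_sum r) V = (\<lambda>x\<in>V. F (\<lambda>i. p i x))"
    using power_sum_invariant[of r] invs unfolding basic_invariants_def by blast
  obtain d where d: "gradient l F d" using poly_funs_gradient[OF F(1)] by blast
  \<comment> \<open>The extensions \<open>P j\<close> in place of \<open>p j\<close> make the
    coefficients polynomials on the ambient space.\<close>
  define T where "T i = (\<lambda>x. d i (\<lambda>j. P j x))" for i
  have "T i \<in> poly_funs n" for i
    unfolding T_def using gradient_poly_funs[OF d] by (rule poly_funs_compose) (use P in auto)
  moreover have "d_power_sum r v x = (\<Sum>i<l. T i x * dp i v x)" if x: "x \<in> V" and v: "v \<in> V" for x v
  proof -
    have "((\<lambda>t. F (\<lambda>i. p i (\<lambda>k. x k + t * v k))) has_field_derivative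
        (\<Sum>i<l. d i (\<lambda>i. p i (\<lambda>k. x k + 0 * v k)) * dp i v x)) (at 0)"
      by (rule gradientD[OF d]) (use dp_has_derivative x v in auto)
    moreover have "(\<lambda>t. F (\<lambda>i. p i (\<lambda>k. x k + t * v k))) = (\<lambda>t. power_sum r (\<lambda>k. x k + t * v k))"
    proof
      fix t
      show "F (\<lambda>i. p i (\<lambda>k. x k + t * v k)) = power_sum r (\<lambda>k. x k + t * v k)"
        using line_in_refl_space[OF x v] fun_cong[OF F(2), of "\<lambda>k. x k + t * v k"] by simp
    qed
    ultimately have "d_power_sum r v x = (\<Sum>i<l. d i (\<lambda>i. p i x) * dp i v x)"
      using d_power_sum_has_derivative[of r x v] by (simp add: DERIV_unique)
    also have "\<dots> = (\<Sum>i<l. T i x * dp i v x)"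
      unfolding T_def using x p_eq_P
      by (intro sum.cong refl arg_cong2[where f = "(*)"] poly_funs_cong[OF gradient_poly_funs[OF d]]) auto
    finally show ?thesis .
  qed
  ultimately show ?thesis by blast
qed

definition T :: "nat \<Rightarrow> nat \<Rightarrow> (nat \<Rightarrow> complex) \<Rightarrow> complex" where
  "T r = (SOME T. (\<forall>i. T i \<in> poly_funs n) \<and> (\<forall>x\<in>V. \<forall>v\<in>V. d_power_sum r v x = (\<Sum>i<l. T i x * dp i v x)))"

lemma T_poly_funs: "T r i \<in> poly_funs n"
  and d_power_sum_eq: "x \<in> V \<Longrightarrow> v \<in> V \<Longrightarrow> d_power_sum r v x = (\<Sum>i<l. T r i x * dp i v x)"
  using someI_ex[OF chain_rule[of r]] unfolding T_def[symmetric] by blast+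

text \<open>\<open>d_power_sum r\<close> controls the moment of order \<open>r + 1\<close>, and the
  moment of order 0 is 0 for vectors of V; so \<open>m\<close> vanishing derivatives give
  \<open>m + 1\<close> vanishing moments.\<close>

lemma moments_zero:
  assumes "v \<in> V" "\<And>r. r < m \<Longrightarrow> d_power_sum r v x = 0" "r \<le> m"
  shows "(\<Sum>k\<le>l. v k * x k ^ r) = 0"
proof (cases r)
  case 0
  then show ?thesis using assms(1) by (simp add: refl_space_def)
next
  case (Suc s)
  have "of_nat (s + 2) * (\<Sum>k\<le>l. v k * x k ^ (s + 1)) = 0"
    using assms(2)[of s] assms(3) Suc unfolding d_power_sum_def by simp
  moreover have "(of_nat (s + 2) :: complex) \<noteq> 0" by (simp del: of_nat_add of_nat_Suc)
  ultimately show ?thesis using Suc by simp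
qed

definition Jq :: "(nat \<Rightarrow> complex) \<Rightarrow> complex mat" where
  "Jq x = mat l l (\<lambda>(r, j). d_power_sum r (b j) x)"

lemma Jq_carrier: "Jq x \<in> carrier_mat l l"
  by (simp add: Jq_def)

lemma Jq_poly_funs: "r < l \<Longrightarrow> j < l \<Longrightarrow> (\<lambda>x. Jq x $$ (r, j)) \<in> poly_funs n"
  by (simp add: Jq_def d_power_sum_def) (intro poly_funs_intros, auto)

lemma d_power_sum_sum: "d_power_sum i (\<lambda>k. \<Sum>j<m. c j * v j k) x = (\<Sum>j<m. c j * d_power_sum i (v j) x)"
proof -
  have "d_power_sum i (\<lambda>k. \<Sum>j<m. c j * v j k) x =
      of_nat (i + 2) * (\<Sum>k\<le>l. \<Sum>j<m. c j * (v j k * x k ^ (i + 1)))"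
    by (simp only: d_power_sum_def sum_distrib_right mult.assoc)
  also have "\<dots> = of_nat (i + 2) * (\<Sum>j<m. \<Sum>k\<le>l. c j * (v j k * x k ^ (i + 1)))"
    by (subst sum.swap) (rule refl)
  finally show ?thesis by (simp add: d_power_sum_def sum_distrib_left mult_ac)
qed

text \<open>A kernel vector of \<open>Jq x\<close> is a vector of V whose moments of orders 0 to
  \<open>l\<close> vanish; at distinct nodes Lagrange interpolation forces it to be 0.\<close>

lemma Jq_det_nonzero:
  assumes "x \<in> V" and ne: "\<And>a b. a \<le> l \<Longrightarrow> b \<le> l \<Longrightarrow> a \<noteq> b \<Longrightarrow> x a \<noteq> x b"
  shows "det (Jq x) \<noteq> 0"
proof
  assume "det (Jq x) = 0"
  then obtain c where c: "c \<in> carrier_vec l" "c \<noteq> 0\<^sub>v l" "Jq x *\<^sub>v c = 0\<^sub>v l"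
    using det_0_iff_vec_prod_zero[OF Jq_carrier] by blast
  define v where "v = (\<lambda>k. \<Sum>j<l. c $ j * b j k)"
  have v: "v \<in> V" unfolding v_def by (rule sum_in_refl_space) (rule b_in_V)
  have d_power_sumv: "d_power_sum r v x = 0" if "r < l" for r
  proof -
    have "d_power_sum r v x = (\<Sum>j<l. c $ j * d_power_sum r (b j) x)" unfolding v_def by (rule d_power_sum_sum)
    also have "\<dots> = (Jq x *\<^sub>v c) $ r"
      using that c(1) by (auto simp: Jq_def mult_mat_vec_def scalar_prod_def lessThan_atLeast0 mult.commute intro!: sum.cong)
    also have "\<dots> = 0" using c(3) that by simp
    finally show ?thesis .
  qed
  note mom = moments_zero[OF v d_power_sumv]
  have "v k = 0" for k
  proof (cases "k \<le> l")
    case True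
    have "v k * node_prod l k x = (\<Sum>m\<le>l. v m * x m ^ l)"
      by (rule moments_node_prod[OF True]) (rule mom, auto)
    also have "\<dots> = 0" by (rule mom) auto
    finally have "v k * node_prod l k x = 0" .
    moreover have "node_prod l k x \<noteq> 0"
      using ne True unfolding node_prod_def by (auto simp: prod_zero_iff)
    ultimately show ?thesis by simp
  next
    case False
    then show ?thesis using v by (simp add: refl_space_def cspace_def)
  qed
  then have v0: "v = (\<lambda>k. 0)" by blast
  have "c $ j = 0" if "j < l" for j
    using coordinate_eq[OF that, of "\<lambda>j. c $ j"] fun_cong[OF v0] unfolding v_def by simp
  then show False using c(1,2) by auto
qed

text \<open>Row \<open>r\<close> is homogeneous of degree \<open>r + 1\<close>, so the determinant
  has degree 1 + ... + \<open>l\<close>, which is the degree of the Vandermonde product.\<close>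

lemma Jq_scale:
  "det (Jq (\<lambda>k. t * x k)) = t ^ (\<Sum>j\<le>l. j) * det (Jq x)"
proof -
  define D where "D = mat l l (\<lambda>(i, j). if i = j then t ^ (i + 1) else 0)"
  have D: "D \<in> carrier_mat l l" by (simp add: D_def)
  have "Jq (\<lambda>k. t * x k) = D * Jq x"
  proof (rule eq_matI)
    fix i j assume "i < dim_row (D * Jq x)" "j < dim_col (D * Jq x)"
    then have ij: "i < l" "j < l" by (auto simp: D_def Jq_def)
    have "(D * Jq x) $$ (i, j) = (\<Sum>k = 0..<l. (if i = k then t ^ (i + 1) else 0) * d_power_sum k (b j) x)"
      using ij by (auto simp: D_def Jq_def times_mat_def scalar_prod_def intro!: sum.cong)
    also have "\<dots> = t ^ (i + 1) * d_power_sum i (b j) x"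
      using ij by (simp add: if_distrib[of "\<lambda>z. z * _"] cong: if_cong)
    also have "\<dots> = d_power_sum i (b j) (\<lambda>k. t * x k)"
      by (simp add: d_power_sum_def power_mult_distrib sum_distrib_left mult_ac)
    finally show "Jq (\<lambda>k. t * x k) $$ (i, j) = (D * Jq x) $$ (i, j)" using ij by (simp add: Jq_def)
  qed (auto simp: D_def Jq_def)
  moreover have "det D = t ^ (\<Sum>j\<le>l. j)"
  proof -
    have "det D = (\<Prod>i = 0..<l. t ^ (i + 1))"
      by (subst det_upper_triangular[OF _ D])
        (auto simp: D_def upper_triangular_def prod_list_diag_prod)
    also have "\<dots> = t ^ (\<Sum>i = 0..<l. i + 1)" by (simp add: power_sum)
    also have "(\<Sum>i = 0..<l. i + 1) = (\<Sum>j\<le>l. j)"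
      by (simp add: sum.atMost_shift lessThan_atLeast0)
    finally show ?thesis .
  qed
  ultimately show ?thesis using det_mult[OF D Jq_carrier] by simp
qed


section \<open>The determinants of \<open>J\<close> and \<open>Jq\<close>\<close>

lemma V_generic:
  obtains x where "x \<in> V" "vandermonde l x \<noteq> 0"
  using refl_space_generic_point vandermonde_nonzero by metis

lemma zero_in_V: "(\<lambda>k. 0) \<in> V"
  by (simp add: refl_space_def cspace_def)

lemma cancel_vandermonde:
  assumes "f \<in> poly_funs n" "g \<in> poly_funs n"
    and "\<And>x. x \<in> V \<Longrightarrow> vandermonde l x * f x = vandermonde l x * g x" "x \<in> V"
  shows "f x = g x"
proof -
  obtain x0 where "x0 \<in> V" "vandermonde l x0 \<noteq> 0" by (rule V_generic)
  then show ?thesis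
    using poly_funs_cancel[OF line_closed_refl_space vandermonde_poly_funs assms(1,2,3)] assms(4) by blast
qed

lemma divisible_by_vandermonde:
  assumes "f \<in> poly_funs n" "\<And>i j x. i < j \<Longrightarrow> j \<le> l \<Longrightarrow> x \<in> hyper l i j \<Longrightarrow> f x = 0"
  shows "\<exists>g\<in>poly_funs n. \<forall>x\<in>V. f x = vandermonde l x * g x"
  unfolding vandermonde_def
  by (rule poly_funs_divisible_pairs[OF subset_refl assms(1)]) (auto simp: mem_pairs assms(2))

definition Tm :: "(nat \<Rightarrow> complex) \<Rightarrow> complex mat" where
  "Tm x = mat l l (\<lambda>(r, i). T r i x)"

lemma Jq_eq: "x \<in> V \<Longrightarrow> Jq x = Tm x * J x"
  by (rule eq_matI)
    (auto simp: Jq_def Tm_def J_def times_mat_def scalar_prod_def d_power_sum_eq b_in_V lessThan_atLeast0)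

text \<open>No invariant has a derivative along the root, so the coordinates of the root with
  respect to \<open>b\<close> form a nonzero kernel vector of \<open>J x\<close>.\<close>

lemma det_J_hyper:
  assumes "i < j" "j \<le> l" "x \<in> hyper l i j"
  shows "det (J x) = 0"
proof -
  define c where "c = vec l (\<lambda>s. \<Sum>k\<le>l. \<beta> s k * root_vec i j k)"
  have ex: "root_vec i j = (\<lambda>k. \<Sum>s<l. c $ s * b s k)"
    using expansion[OF root_vec_in_V[OF assms(1,2)]] by (simp add: c_def)
  have "J x *\<^sub>v c = 0\<^sub>v l"
  proof (rule eq_vecI)
    fix r assume "r < dim_vec (0\<^sub>v l :: complex vec)"
    then have r: "r < l" by simp
    have "(J x *\<^sub>v c) $ r = (\<Sum>s<l. c $ s * dp r (b s) x)"
      using r by (auto simp: J_def c_def mult_mat_vec_def scalar_prod_def lessThan_atLeast0 mult.commute intro!: sum.cong)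
    also have "\<dots> = dp r (root_vec i j) x"
      by (subst ex) (rule dp_sum[symmetric])
    also have "\<dots> = 0" by (rule dp_root[OF r assms])
    finally show "(J x *\<^sub>v c) $ r = 0\<^sub>v l $ r" using r by simp
  qed (simp add: J_def)
  moreover have "c \<noteq> 0\<^sub>v l"
  proof
    assume c0: "c = 0\<^sub>v l"
    have "root_vec i j i = 0" by (subst ex) (simp add: c0)
    then show False by (simp add: root_vec_def)
  qed
  moreover have "c \<in> carrier_vec l" by (simp add: c_def)
  ultimately show ?thesis using det_0_iff_vec_prod_zero[OF J_carrier] by blast
qed

text \<open>The factor \<open>h\<close> of \<open>det J = vandermonde * h\<close> divides the factor \<open>u\<close> of
  \<open>det Jq = vandermonde * u\<close>, and \<open>u\<close> is constant as \<open>det Jq\<close> and \<open>vandermonde\<close> have the same degree.\<close>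

lemma dets_vandermonde:
  "\<exists>h0 u0. h0 \<noteq> 0 \<and> u0 \<noteq> 0 \<and> (\<forall>x\<in>V. det (J x) = h0 * vandermonde l x) \<and>
     (\<forall>x\<in>V. det (Jq x) = u0 * vandermonde l x)"
proof -
  have detJ: "(\<lambda>x. det (J x)) \<in> poly_funs n"
    by (rule det_poly_funs[OF J_carrier J_poly_funs])
  obtain h where h: "h \<in> poly_funs n" "\<And>x. x \<in> V \<Longrightarrow> det (J x) = vandermonde l x * h x"
    using divisible_by_vandermonde[OF detJ] det_J_hyper by blast
  have Tmc: "Tm x \<in> carrier_mat l l" for x by (simp add: Tm_def)
  have detT: "(\<lambda>x. det (Tm x)) \<in> poly_funs n"
    by (rule det_poly_funs[OF Tmc]) (use T_poly_funs in \<open>simp add: Tm_def\<close>)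
  define u where "u = (\<lambda>x. h x * det (Tm x))"
  have u: "u \<in> poly_funs n" unfolding u_def by (intro poly_funs.mult h(1) detT)
  have Jqu: "det (Jq x) = vandermonde l x * u x" if "x \<in> V" for x
    using Jq_eq[OF that] det_mult[OF Tmc J_carrier] h(2)[OF that] by (simp add: u_def)
  define u0 where "u0 = u (\<lambda>k. 0)"
  have gen: "u x = u0" if x: "x \<in> V" "vandermonde l x \<noteq> 0" for x
  proof -
    obtain Q where Q: "\<And>t. u (\<lambda>k. 0 + t * x k) = poly Q t"
      using poly_funs_on_line[OF u, where x = "\<lambda>k. 0"] by blast
    have "t \<noteq> 0 \<Longrightarrow> poly Q t = u x" for t
      using Jqu[OF scale_in_refl_space[OF x(1), of t]] Jqu[OF x(1)] x(2)
      by (simp add: Jq_scale vandermonde_scale flip: Q)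
    \<comment> \<open>The comparison of powers of \<open>t\<close> excludes \<open>t = 0\<close>;
      the extra factor \<open>[:0, 1:]\<close> vanishes at this exceptional value.\<close>
    then have "poly ([:0, 1:] * (Q - [:u x:])) t = 0" for t by (cases "t = 0") auto
    then have "[:0, 1:] * (Q - [:u x:]) = 0" using poly_all_0_iff_0 by blast
    then have "Q = [:u x:]" by simp
    then show ?thesis using Q[of 0] by (simp add: u0_def)
  qed
  have uV: "u x = u0" if "x \<in> V" for x
    by (rule cancel_vandermonde[OF u poly_funs.const[of u0] _ that]) (use gen in fastforce)
  obtain x1 where x1: "x1 \<in> V" "vandermonde l x1 \<noteq> 0" by (rule V_generic)
  have "det (Jq x1) \<noteq> 0"
    by (rule Jq_det_nonzero[OF x1(1)]) (rule vandermonde_nonzeroD[OF x1(2)])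
  then have u0: "u0 \<noteq> 0" using Jqu[OF x1(1)] uV[OF x1(1)] by auto
  have hV: "h x = h (\<lambda>k. 0)" if "x \<in> V" for x
    by (rule poly_funs_constant_if_unit[OF h(1) detT u0, of V])
      (use uV that scale_in_refl_space in \<open>auto simp: u_def\<close>)
  have "h (\<lambda>k. 0) \<noteq> 0" using uV[OF zero_in_V] u0 by (auto simp: u_def)
  moreover have "det (J x) = h (\<lambda>k. 0) * vandermonde l x" if "x \<in> V" for x
    using h(2)[OF that] hV[OF that] by simp
  moreover have "det (Jq x) = u0 * vandermonde l x" if "x \<in> V" for x
    using Jqu[OF that] uV[OF that] by simp
  ultimately show ?thesis using u0 by blast
qed

section \<open>The vector field with coordinates \<open>E k\<close>\<close>

definition E :: "nat \<Rightarrow> (nat \<Rightarrow> complex) \<Rightarrow> complex" where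
  "E k x = (\<Sum>s<l. adj_mat (Jq x) $$ (s, l - 1) * b s k)"

lemma E_poly_funs: "E k \<in> poly_funs n"
  unfolding E_def[abs_def] using l_pos
  by (intro poly_funs_sum poly_funs.mult poly_funs.const adj_mat_poly_funs[OF Jq_carrier Jq_poly_funs]) auto

lemma E_in_V: "(\<lambda>k. E k x) \<in> V"
  unfolding E_def by (rule sum_in_refl_space) (rule b_in_V)

text \<open>With respect to \<open>b\<close> the field is the last column of the adjugate, so these
  derivatives form a column of \<open>Jq x * adj_mat (Jq x)\<close>. As the field takes values in V,
  its moments of orders 0 to \<open>l - 1\<close> vanish.\<close>

lemma d_power_sum_E:
  assumes "r < l"
  shows "d_power_sum r (\<lambda>k. E k x) x = (if r = l - 1 then det (Jq x) else 0)"
proof -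
  have "d_power_sum r (\<lambda>k. E k x) x = (\<Sum>s<l. adj_mat (Jq x) $$ (s, l - 1) * d_power_sum r (b s) x)"
    unfolding E_def by (rule d_power_sum_sum)
  also have "\<dots> = (Jq x * adj_mat (Jq x)) $$ (r, l - 1)"
    using assms adj_mat(1)[OF Jq_carrier[of x]]
    by (auto simp: Jq_def times_mat_def scalar_prod_def lessThan_atLeast0 mult.commute intro!: sum.cong)
  also have "\<dots> = (if r = l - 1 then det (Jq x) else 0)"
    using assms by (auto simp: adj_mat(2)[OF Jq_carrier])
  finally show ?thesis .
qed

lemma E_node_prod:
  "\<exists>\<epsilon>. \<epsilon> \<noteq> 0 \<and> (\<forall>k\<le>l. \<forall>x\<in>V. E k x * node_prod l k x = \<epsilon> * vandermonde l x)"
proof -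
  obtain u0 where u0: "u0 \<noteq> 0" "\<And>x. x \<in> V \<Longrightarrow> det (Jq x) = u0 * vandermonde l x"
    using dets_vandermonde by blast
  \<comment> \<open>The denominator \<open>l + 1\<close> comes from differentiating the power sum of
    degree \<open>l + 1\<close>.\<close>
  have "E k x * node_prod l k x = u0 / of_nat (l + 1) * vandermonde l x" if k: "k \<le> l" and x: "x \<in> V" for k x
  proof -
    have "E k x * node_prod l k x = (\<Sum>m\<le>l. E m x * x m ^ l)"
    proof (rule moments_node_prod[OF k])
      fix r assume "r < l"
      then show "(\<Sum>m\<le>l. E m x * x m ^ r) = 0"
        by (intro moments_zero[OF E_in_V, where m = "l - 1"]) (auto simp: d_power_sum_E)
    qed
    moreover have "of_nat (l + 1) * (\<Sum>m\<le>l. E m x * x m ^ l) = det (Jq x)"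
      using d_power_sum_E[of "l - 1" x] l_pos unfolding d_power_sum_def by simp
    ultimately show ?thesis using u0(2)[OF x] by (simp add: field_simps del: of_nat_Suc of_nat_add)
  qed
  then show ?thesis using u0(1) by (intro exI[of _ "u0 / of_nat (l + 1)"]) (auto simp del: of_nat_Suc of_nat_add)
qed

text \<open>On the mirror the Vandermonde product vanishes while \<open>node_prod l k\<close> is not
  identically zero, so the factor \<open>E k\<close> must vanish.\<close>

lemma E_hyper_zero:
  assumes "i < j" "j \<le> l" "k \<le> l" "k \<noteq> i" "k \<noteq> j" "x \<in> hyper l i j"
  shows "E k x = 0"
proof -
  obtain \<epsilon> where \<epsilon>: "\<And>x. x \<in> V \<Longrightarrow> E k x * node_prod l k x = \<epsilon> * vandermonde l x"
    using E_node_prod assms(3) by blast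
  obtain x0 where "x0 \<in> hyper l i j" "node_prod l k x0 \<noteq> 0"
    using node_prod_hyper_nonzero[OF assms(1-5)] by blast
  moreover have "node_prod l k x * E k x = 0" if "x \<in> hyper l i j" for x
    using \<epsilon>[OF hyper_subset[OF that]] vandermonde_hyper[OF assms(1,2) that] by (simp add: mult.commute)
  ultimately show ?thesis
    using poly_funs_zero_product[OF line_closed_hyper node_prod_poly_funs[OF assms(3)] E_poly_funs]
      assms(6) by blast
qed

text \<open>A vector of V supported on the indices \<open>i\<close> and \<open>j\<close> is a
  multiple of the root.\<close>

lemma E_hyper:
  assumes "i < j" "j \<le> l" "x \<in> hyper l i j"
  shows "(\<lambda>k. E k x) = (\<lambda>k. E i x * root_vec i j k)"
proof -
  have z: "E k x = 0" if "k \<noteq> i" "k \<noteq> j" for k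
    using E_hyper_zero[OF assms(1,2) _ that assms(3)] E_in_V[of x]
    by (cases "k \<le> l") (auto simp: refl_space_def cspace_def)
  have "0 = (\<Sum>k\<le>l. E k x)" using E_in_V[of x] by (simp add: refl_space_def)
  also have "\<dots> = (\<Sum>k\<in>{i, j}. E k x)"
    using assms z by (intro sum.mono_neutral_right) auto
  finally have "E j x = - E i x" using assms(1) by (simp add: add_eq_0_iff)
  then show ?thesis using z by (auto simp: root_vec_def)
qed

text \<open>Otherwise \<open>x i - x j\<close> would divide \<open>E i\<close>; as it also divides
  \<open>node_prod l i\<close>, its square would divide the Vandermonde product. After one factor is
  cancelled on V, a generic point of the mirror gives the contradiction.\<close>

lemma E_hyper_nonzero:
  assumes "i < j" "j \<le> l"
  shows "\<exists>x\<in>hyper l i j. E i x \<noteq> 0"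
proof (rule ccontr)
  assume "\<not> ?thesis"
  then obtain e where e: "e \<in> poly_funs n" "\<And>x. x \<in> V \<Longrightarrow> E i x = (x i - x j) * e x"
    using poly_funs_divisible[OF E_poly_funs assms, of i] by blast
  obtain \<epsilon> where \<epsilon>: "\<epsilon> \<noteq> 0" "\<And>x. x \<in> V \<Longrightarrow> E i x * node_prod l i x = \<epsilon> * vandermonde l x"
    using E_node_prod assms by (metis less_imp_le le_trans)
  define r where "r = (\<lambda>x. \<Prod>(a, b)\<in>pairs l - {(i, j)}. x a - (x b :: complex))"
  define s where "s = (\<lambda>x. \<Prod>m\<in>{..l} - {i} - {j}. x i - (x m :: complex))"
  have pf: "(\<lambda>x. \<epsilon> * r x) \<in> poly_funs n" "(\<lambda>x. e x * ((x i - x j) * s x)) \<in> poly_funs n"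
    "(\<lambda>x. x i - x j) \<in> poly_funs n"
    using assms e(1) unfolding r_def s_def case_prod_beta
    by (auto intro!: poly_funs_intros simp: pairs_def)
  have np: "node_prod l i x = (x i - x j) * s x" for x
    unfolding node_prod_def s_def using assms by (intro prod.remove) auto
  have eq: "(x i - x j) * (\<epsilon> * r x) = (x i - x j) * (e x * ((x i - x j) * s x))" if "x \<in> V" for x
  proof -
    have "(x i - x j) * (\<epsilon> * r x) = \<epsilon> * vandermonde l x"
      by (simp add: vandermonde_factor[OF assms] r_def)
    also have "\<dots> = E i x * node_prod l i x" using \<epsilon>(2)[OF that] by simp
    also have "\<dots> = (x i - x j) * (e x * ((x i - x j) * s x))" by (simp add: e(2)[OF that] np)
    finally show ?thesis .
  qed
  obtain x1 where x1: "x1 \<in> V" "\<And>a b. a \<le> l \<Longrightarrow> b \<le> l \<Longrightarrow> a \<noteq> b \<Longrightarrow> x1 a \<noteq> x1 b"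
    using refl_space_generic_point by metis
  have "x1 i - x1 j \<noteq> 0" using x1(2)[of i j] assms by auto
  from poly_funs_cancel[OF line_closed_refl_space pf(3,1,2) eq x1(1) this]
  have *: "\<epsilon> * r x = e x * ((x i - x j) * s x)" if "x \<in> V" for x using that by blast
  obtain x0 where "x0 \<in> hyper l i j" "r x0 \<noteq> 0"
    unfolding r_def using vandermonde_cofactor_nonzero[OF assms] by blast
  then show False using *[of x0] \<epsilon>(1) by (auto simp: hyper_def)
qed

text \<open>\<open>node_prod l k\<close> supplies the zeros on the mirrors involving
  \<open>k\<close>, so its product with \<open>h\<close> is divisible by the Vandermonde product;
  cancelling \<open>node_prod l k\<close> leaves a multiple of \<open>E k\<close>. The criterion
  serves both for the adjugate of \<open>J\<close> and for endomorphisms.\<close>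

lemma E_divides:
  assumes k: "k \<le> l" and h: "h \<in> poly_funs n"
    and z: "\<And>i j x. i < j \<Longrightarrow> j \<le> l \<Longrightarrow> k \<noteq> i \<Longrightarrow> k \<noteq> j \<Longrightarrow> x \<in> hyper l i j \<Longrightarrow> h x = 0"
  shows "\<exists>g\<in>poly_funs n. \<forall>x\<in>V. h x = g x * E k x"
proof -
  obtain \<epsilon> where \<epsilon>: "\<epsilon> \<noteq> 0" "\<And>x. x \<in> V \<Longrightarrow> E k x * node_prod l k x = \<epsilon> * vandermonde l x"
    using E_node_prod k by blast
  note npf = node_prod_poly_funs[OF k]
  have hn: "(\<lambda>x. h x * node_prod l k x) \<in> poly_funs n" by (intro poly_funs.mult h npf)
  have "h x * node_prod l k x = 0" if "i < j" "j \<le> l" "x \<in> hyper l i j" for i j x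
  proof (cases "k = i \<or> k = j")
    case True
    then have "node_prod l k x = 0" unfolding node_prod_def
      using that by (intro prod_zero bexI[of _ "if k = i then j else i"]) (auto simp: hyper_def)
    then show ?thesis by simp
  qed (use z that in auto)
  then obtain g where g: "g \<in> poly_funs n" "\<And>x. x \<in> V \<Longrightarrow> h x * node_prod l k x = vandermonde l x * g x"
    using divisible_by_vandermonde[OF hn] by blast
  have g': "(\<lambda>x. g x / \<epsilon>) \<in> poly_funs n" by (intro poly_funs_divide g(1))
  have ge: "(\<lambda>x. g x / \<epsilon> * E k x) \<in> poly_funs n" by (intro poly_funs.mult g' E_poly_funs)
  have eq: "node_prod l k x * h x = node_prod l k x * (g x / \<epsilon> * E k x)" if "x \<in> V" for x
    using g(2)[OF that] \<epsilon>(2)[OF that] \<epsilon>(1) by (simp add: field_simps)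
  obtain x1 where x1: "x1 \<in> V" "\<And>a b. a \<le> l \<Longrightarrow> b \<le> l \<Longrightarrow> a \<noteq> b \<Longrightarrow> x1 a \<noteq> x1 b"
    using refl_space_generic_point by metis
  have "node_prod l k x1 \<noteq> 0" using x1(2) k by (auto simp: node_prod_def prod_zero_iff)
  from poly_funs_cancel[OF line_closed_refl_space npf h ge eq x1(1) this]
  show ?thesis using g' by (intro bexI[of _ "\<lambda>x. g x / \<epsilon>"]) auto
qed

section \<open>Minors of \<open>J\<close> as combinations of the \<open>E k\<close>, and
  conversely\<close>

definition adj_field :: "nat \<Rightarrow> nat \<Rightarrow> (nat \<Rightarrow> complex) \<Rightarrow> complex" where
  "adj_field r k x = (\<Sum>s<l. adj_mat (J x) $$ (s, r) * b s k)"

lemma adj_field_poly_funs: "r < l \<Longrightarrow> adj_field r k \<in> poly_funs n"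
  unfolding adj_field_def[abs_def]
  by (intro poly_funs_sum poly_funs.mult poly_funs.const adj_mat_poly_funs[OF J_carrier J_poly_funs]) auto

lemma adj_field_in_V: "(\<lambda>k. adj_field r k x) \<in> V"
  unfolding adj_field_def by (rule sum_in_refl_space) (rule b_in_V)

lemma dp_adj_field:
  assumes "i < l" "r < l"
  shows "dp i (\<lambda>k. adj_field r k x) x = (if i = r then det (J x) else 0)"
proof -
  have "dp i (\<lambda>k. adj_field r k x) x = (\<Sum>s<l. adj_mat (J x) $$ (s, r) * dp i (b s) x)"
    unfolding adj_field_def by (rule dp_sum)
  also have "\<dots> = (J x * adj_mat (J x)) $$ (i, r)"
    using assms adj_mat(1)[OF J_carrier[of x]]
    by (auto simp: J_def times_mat_def scalar_prod_def lessThan_atLeast0 mult.commute intro!: sum.cong)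
  also have "\<dots> = (if i = r then det (J x) else 0)"
    using assms by (auto simp: adj_mat(2)[OF J_carrier])
  finally show ?thesis .
qed

text \<open>On a mirror the field \<open>adj_field r\<close> is annihilated by all \<open>dp i\<close>, hence by the
  differentials of all power sums, which forces it to be a multiple of the root.\<close>

lemma adj_field_eq_E:
  assumes "r < l" "k \<le> l"
  shows "\<exists>g\<in>poly_funs n. \<forall>x\<in>V. adj_field r k x = g x * E k x"
proof (rule E_divides[OF assms(2) adj_field_poly_funs[OF assms(1)]])
  fix i j x assume ij: "i < j" "j \<le> l" "k \<noteq> i" "k \<noteq> j" and x: "x \<in> hyper l i j"
  \<comment> \<open>This is \<open>node_prod l k\<close> without the node \<open>j\<close>, as in
    \<open>moments_hyper\<close>; it does not vanish identically on the mirror and can be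
    cancelled.\<close>
  define N where "N = (\<lambda>x. \<Prod>a\<in>{..l} - {k, j}. x k - (x a :: complex))"
  have Npf: "N \<in> poly_funs n" unfolding N_def using assms by (intro poly_funs_intros) auto
  have "N y * adj_field r k y = 0" if y: "y \<in> hyper l i j" for y
  proof -
    have yV: "y \<in> V" using y by (rule hyper_subset)
    have "d_power_sum s (\<lambda>k. adj_field r k y) y = 0" for s
      unfolding d_power_sum_eq[OF yV adj_field_in_V] using dp_adj_field[OF _ assms(1)] det_J_hyper[OF ij(1,2) y]
      by (intro sum.neutral) auto
    then have "(\<Sum>m\<le>l. adj_field r m y * y m ^ t) = 0" if "t < l" for t
      using moments_zero[OF adj_field_in_V, of l r y y t] that by auto
    then have "adj_field r k y * N y = 0" unfolding N_def
      using y ij assms by (intro moments_hyper[of i]) (auto simp: hyper_def)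
    then show ?thesis by auto
  qed
  moreover obtain x0 where "x0 \<in> hyper l i j" "N x0 \<noteq> 0"
  proof -
    obtain x0 where "x0 \<in> hyper l i j" "node_prod l k x0 \<noteq> 0"
      using node_prod_hyper_nonzero[OF ij(1,2) assms(2) ij(3,4)] by blast
    moreover have "N x0 \<noteq> 0"
      using \<open>node_prod l k x0 \<noteq> 0\<close> unfolding N_def node_prod_def by (auto simp: prod_zero_iff)
    ultimately show ?thesis using that by blast
  qed
  ultimately show "adj_field r k x = 0"
    using poly_funs_zero_product[OF line_closed_hyper Npf adj_field_poly_funs[OF assms(1)]] x by blast
qed

lemma adj_mat_minor:
  assumes "r < l" "s < l" "x \<in> V"
  shows "adj_mat (J x) $$ (s, r) = (-1) ^ (r + s) * jacobian_minor l p b r s x"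
  using assms J_carrier[of x]
  by (simp add: adj_mat_def cofactor_def jacobian_minor_def jacobian_matrix_eq)

lemma minor_adj_mat:
  assumes "r < l" "s < l" "x \<in> V"
  shows "jacobian_minor l p b r s x = (-1) ^ (r + s) * adj_mat (J x) $$ (s, r)"
proof -
  have "(-1) ^ (r + s) * ((-1) ^ (r + s) * z) = (z :: complex)" for z
    by (simp flip: mult.assoc power_mult_distrib)
  then show ?thesis using adj_mat_minor[OF assms] by simp
qed

lemma minor_poly_funs:
  assumes "r < l" "s < l"
  shows "\<exists>f\<in>poly_funs n. jacobian_minor l p b r s = restrict f V"
proof
  show "(\<lambda>x. (-1) ^ (r + s) * adj_mat (J x) $$ (s, r)) \<in> poly_funs n"
    by (intro poly_funs_intros adj_mat_poly_funs[OF J_carrier J_poly_funs] assms) auto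
  show "jacobian_minor l p b r s = restrict (\<lambda>x. (-1) ^ (r + s) * adj_mat (J x) $$ (s, r)) V"
    using minor_adj_mat[OF assms] by (auto simp: fun_eq_iff jacobian_minor_def)
qed

text \<open>Up to sign the minor is the \<open>s\<close>-th coordinate of \<open>adj_field r\<close>
  with respect to \<open>b\<close>. The functionals \<open>\<beta>\<close> express it by the ambient
  coordinates, each of which is a multiple of \<open>E k\<close>.\<close>

lemma minor_combination:
  assumes "r < l" "s < l"
  shows "\<exists>c. (\<forall>k. c k \<in> poly_funs n) \<and> (\<forall>x\<in>V. jacobian_minor l p b r s x = (\<Sum>k\<le>l. c k x * E k x))"
proof -
  have "\<exists>g. \<forall>k\<le>l. g k \<in> poly_funs n \<and> (\<forall>x\<in>V. adj_field r k x = g k x * E k x)"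
    using adj_field_eq_E[OF assms(1)] by metis
  then obtain g where g: "\<And>k. k \<le> l \<Longrightarrow> g k \<in> poly_funs n"
    "\<And>k x. k \<le> l \<Longrightarrow> x \<in> V \<Longrightarrow> adj_field r k x = g k x * E k x" by blast
  define c where "c = (\<lambda>k x. if k \<le> l then (-1) ^ (r + s) * \<beta> s k * g k x else 0)"
  have "c k \<in> poly_funs n" for k
    using g(1)[of k] by (cases "k \<le> l") (auto simp: c_def intro!: poly_funs_intros)
  moreover have "jacobian_minor l p b r s x = (\<Sum>k\<le>l. c k x * E k x)" if x: "x \<in> V" for x
  proof -
    have "jacobian_minor l p b r s x = (-1) ^ (r + s) * (\<Sum>k\<le>l. \<beta> s k * adj_field r k x)"
      unfolding minor_adj_mat[OF assms x] adj_field_def by (simp only: coordinate_eq[OF assms(2)])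
    also have "\<dots> = (\<Sum>k\<le>l. c k x * E k x)"
      unfolding sum_distrib_left by (intro sum.cong) (auto simp: c_def g(2)[OF _ x])
    finally show ?thesis .
  qed
  ultimately show ?thesis by blast
qed

text \<open>On every mirror the field is a multiple of the root, so its derivatives
  \<open>dp r\<close> vanish there and are divisible by the Vandermonde product, that is by
  \<open>det (J x)\<close>. Cramer's rule then writes the field as a polynomial combination of the
  columns of the adjugate of \<open>J\<close>.\<close>

lemma E_combination:
  "\<exists>c. (\<forall>r s. c r s \<in> poly_funs n) \<and>
    (\<forall>x\<in>V. E k x = (\<Sum>r<l. \<Sum>s<l. c r s x * jacobian_minor l p b r s x))"
proof -
  \<comment> \<open>The coordinates of the field with respect to \<open>b\<close>; unrelated to the
    constant in \<open>E_node_prod\<close>.\<close>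
  define \<epsilon> where "\<epsilon> s x = adj_mat (Jq x) $$ (s, l - 1)" for s x
  have \<epsilon>_pf: "\<epsilon> s \<in> poly_funs n" if "s < l" for s
    unfolding \<epsilon>_def[abs_def] using that l_pos
    by (intro adj_mat_poly_funs[OF Jq_carrier Jq_poly_funs]) auto
  obtain h0 where h0: "h0 \<noteq> 0" "\<And>x. x \<in> V \<Longrightarrow> det (J x) = h0 * vandermonde l x"
    using dets_vandermonde by blast
  have "\<exists>g\<in>poly_funs n. \<forall>x\<in>V. dp r (\<lambda>k. E k x) x = vandermonde l x * g x" if r: "r < l" for r
  proof (rule divisible_by_vandermonde)
    show "(\<lambda>x. dp r (\<lambda>k. E k x) x) \<in> poly_funs n"
      by (intro dp_poly_funs r E_poly_funs)
    show "dp r (\<lambda>k. E k x) x = 0" if "i < j" "j \<le> l" "x \<in> hyper l i j" for i j x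
      unfolding E_hyper[OF that] dp_scale using dp_root[OF r that] by simp
  qed
  then have "\<exists>g. \<forall>r<l. g r \<in> poly_funs n \<and> (\<forall>x\<in>V. dp r (\<lambda>k. E k x) x = vandermonde l x * g r x)"
    by metis
  then obtain g where g: "\<And>r. r < l \<Longrightarrow> g r \<in> poly_funs n"
    "\<And>r x. r < l \<Longrightarrow> x \<in> V \<Longrightarrow> dp r (\<lambda>k. E k x) x = vandermonde l x * g r x" by blast
  define S where "S s x = (\<Sum>r<l. g r x / h0 * ((-1) ^ (r + s) * jacobian_minor l p b r s x))" for s x
  \<comment> \<open>The same combination written with adjugate entries: these are polynomials
    everywhere, as cancellation requires, whereas the minors are functions restricted to V.\<close>
  define S' where "S' s x = (\<Sum>r<l. g r x / h0 * adj_mat (J x) $$ (s, r))" for s x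
  have S'_pf: "S' s \<in> poly_funs n" if "s < l" for s
    unfolding S'_def[abs_def]
    by (intro poly_funs_sum poly_funs.mult poly_funs_divide g(1) adj_mat_poly_funs[OF J_carrier J_poly_funs])
      (use that in auto)
  have SS: "S s x = S' s x" if "s < l" "x \<in> V" for s x
    unfolding S_def S'_def using adj_mat_minor that by (intro sum.cong) auto
  have "\<epsilon> s x = S' s x" if s: "s < l" and "x \<in> V" for s x
  proof (rule cancel_vandermonde[OF \<epsilon>_pf[OF s] S'_pf[OF s] _ \<open>x \<in> V\<close>])
    fix x assume x: "x \<in> V"
    define v where "v = vec l (\<lambda>s. \<epsilon> s x)"
    have v: "v \<in> carrier_vec l" by (simp add: v_def)
    have Jv: "(J x *\<^sub>v v) $ r = vandermonde l x * g r x" if "r < l" for r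
    proof -
      have "(J x *\<^sub>v v) $ r = (\<Sum>s<l. \<epsilon> s x * dp r (b s) x)"
        using that by (auto simp: J_def v_def mult_mat_vec_def scalar_prod_def lessThan_atLeast0 mult.commute intro!: sum.cong)
      also have "\<dots> = dp r (\<lambda>k. E k x) x"
        unfolding E_def \<epsilon>_def by (rule dp_sum[symmetric])
      finally show ?thesis using g(2)[OF that x] by simp
    qed
    have "(det (J x) \<cdot>\<^sub>m 1\<^sub>m l) *\<^sub>v v = adj_mat (J x) *\<^sub>v (J x *\<^sub>v v)"
      using assoc_mult_mat_vec[OF adj_mat(1)[OF J_carrier] J_carrier v, of x x] adj_mat(3)[OF J_carrier[of x]] by simp
    moreover have "((det (J x) \<cdot>\<^sub>m 1\<^sub>m l) *\<^sub>v v) $ s = det (J x) * \<epsilon> s x"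
    proof -
      have "(det (J x) \<cdot>\<^sub>m 1\<^sub>m l) *\<^sub>v v = det (J x) \<cdot>\<^sub>v (1\<^sub>m l *\<^sub>v v)" using v by auto
      then show ?thesis using s v by (simp add: v_def)
    qed
    moreover have "(adj_mat (J x) *\<^sub>v (J x *\<^sub>v v)) $ s = (\<Sum>r<l. adj_mat (J x) $$ (s, r) * (vandermonde l x * g r x))"
    proof -
      have "dim_vec (J x *\<^sub>v v) = l" by (simp add: J_def)
      then show ?thesis
        using s adj_mat(1)[OF J_carrier[of x]] Jv
        by (auto simp: mult_mat_vec_def[of "adj_mat (J x)"] scalar_prod_def lessThan_atLeast0 intro!: sum.cong)
    qed
    ultimately have "det (J x) * \<epsilon> s x = (\<Sum>r<l. adj_mat (J x) $$ (s, r) * (vandermonde l x * g r x))"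
      by simp
    then have "h0 * (vandermonde l x * \<epsilon> s x) = h0 * (vandermonde l x * S' s x)"
      unfolding h0(2)[OF x] S'_def sum_distrib_left using h0(1) by (simp add: mult_ac)
    then show "vandermonde l x * \<epsilon> s x = vandermonde l x * S' s x" using h0(1) by simp
  qed
  then have \<epsilon>S: "\<epsilon> s x = S s x" if "s < l" "x \<in> V" for s x using that SS by simp
  define c where "c = (\<lambda>r s x. if r < l then b s k * (g r x / h0 * (-1) ^ (r + s)) else 0)"
  have "c r s \<in> poly_funs n" for r s
    using g(1)[of r] by (cases "r < l") (auto simp: c_def intro!: poly_funs_intros)
  moreover have "E k x = (\<Sum>r<l. \<Sum>s<l. c r s x * jacobian_minor l p b r s x)" if x: "x \<in> V" for x
  proof -
    have "E k x = (\<Sum>s<l. S s x * b s k)"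
      unfolding E_def using \<epsilon>S[OF _ x] by (intro sum.cong) (auto simp: \<epsilon>_def)
    also have "\<dots> = (\<Sum>s<l. \<Sum>r<l. c r s x * jacobian_minor l p b r s x)"
      unfolding S_def sum_distrib_right by (intro sum.cong refl) (simp add: c_def mult_ac)
    also have "\<dots> = (\<Sum>r<l. \<Sum>s<l. c r s x * jacobian_minor l p b r s x)" by (rule sum.swap)
    finally show ?thesis .
  qed
  ultimately show ?thesis by blast
qed

lemma Delta_eq: "\<exists>h0. h0 \<noteq> 0 \<and> Delta l p b = (\<lambda>x\<in>V. h0 * vandermonde l x)"
proof -
  obtain h0 where "h0 \<noteq> 0" "\<And>x. x \<in> V \<Longrightarrow> det (J x) = h0 * vandermonde l x"
    using dets_vandermonde by blast
  then show ?thesis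
    by (intro exI[of _ h0]) (auto simp: Delta_def fun_eq_iff jacobian_matrix_eq)
qed

section \<open>The total ring of fractions of the arrangement\<close>

definition cl :: "((nat \<Rightarrow> complex) \<Rightarrow> complex) \<Rightarrow> ((nat \<Rightarrow> complex) \<Rightarrow> complex) set" where
  "cl f = to_S_A l p b (restrict f V)"

definition mirrors :: "(nat \<Rightarrow> complex) set" where
  "mirrors = {x. \<exists>i j. i < j \<and> j \<le> l \<and> x \<in> hyper l i j}"

lemma mirrorsI: "i < j \<Longrightarrow> j \<le> l \<Longrightarrow> x \<in> hyper l i j \<Longrightarrow> x \<in> mirrors"
  by (auto simp: mirrors_def)

lemma mirrors_subset: "mirrors \<subseteq> V"
  by (auto simp: mirrors_def hyper_def)

lemma S_V_cring: "cring (S_V l)"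
  unfolding S_V_def by (rule coord_ring_cring)

lemma Delta_ideal: "ideal (PIdl\<^bsub>S_V l\<^esub> (Delta l p b)) (S_V l)"
proof -
  interpret cring "S_V l" by (rule S_V_cring)
  obtain h0 where "Delta l p b = (\<lambda>x\<in>V. h0 * vandermonde l x)" using Delta_eq by blast
  then have "Delta l p b \<in> carrier (S_V l)"
    unfolding S_V_def coord_ring_def
    using poly_funs.mult[OF poly_funs.const[of h0] vandermonde_poly_funs[of l]] by auto
  then show ?thesis by (rule cgenideal_ideal)
qed

text \<open>The Vandermonde product is reduced: vanishing on all mirrors already gives divisibility,
  so the ideal is the full vanishing ideal of the arrangement.\<close>

lemma mem_Delta_ideal:
  assumes f: "f \<in> poly_funs n"
  shows "restrict f V \<in> PIdl\<^bsub>S_V l\<^esub> (Delta l p b) \<longleftrightarrow> (\<forall>x\<in>mirrors. f x = 0)"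
proof -
  obtain h0 where h0: "h0 \<noteq> 0" "Delta l p b = (\<lambda>x\<in>V. h0 * vandermonde l x)" using Delta_eq by blast
  show ?thesis
  proof
    assume "restrict f V \<in> PIdl\<^bsub>S_V l\<^esub> (Delta l p b)"
    then obtain g where g: "restrict f V = g \<otimes>\<^bsub>S_V l\<^esub> Delta l p b" by (auto simp: cgenideal_def)
    show "\<forall>x\<in>mirrors. f x = 0"
    proof
      fix x assume x: "x \<in> mirrors"
      then have "vandermonde l x = 0" using vandermonde_hyper by (auto simp: mirrors_def)
      then show "f x = 0"
        using fun_cong[OF g, of x] x mirrors_subset by (auto simp: S_V_def coord_ring_def h0)
    qed
  next
    assume "\<forall>x\<in>mirrors. f x = 0"
    then obtain g where g: "g \<in> poly_funs n" "\<And>x. x \<in> V \<Longrightarrow> f x = vandermonde l x * g x"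
      using divisible_by_vandermonde[OF f] mirrorsI by blast
    have "restrict f V = restrict (\<lambda>x. g x / h0) V \<otimes>\<^bsub>S_V l\<^esub> Delta l p b"
      using g(2) h0 by (auto simp: S_V_def coord_ring_def fun_eq_iff)
    moreover have "restrict (\<lambda>x. g x / h0) V \<in> carrier (S_V l)"
      unfolding S_V_def coord_ring_def using poly_funs_divide[OF g(1)] by auto
    ultimately show "restrict f V \<in> PIdl\<^bsub>S_V l\<^esub> (Delta l p b)" by (auto simp: cgenideal_def)
  qed
qed

lemma S_A_cring: "cring (S_A l p b)"
  unfolding S_A_def by (rule ideal.quotient_is_cring[OF Delta_ideal S_V_cring])

lemma restrict_in_S_V: "f \<in> poly_funs n \<Longrightarrow> restrict f V \<in> carrier (S_V l)"
  unfolding S_V_def coord_ring_def by auto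

lemma carrier_S_A: "carrier (S_A l p b) = cl ` poly_funs n"
  unfolding S_A_def cl_def to_S_A_def
  by (auto simp: FactRing_def A_RCOSETS_def' S_V_def coord_ring_def)

lemma cl_hom: "(\<lambda>f. to_S_A l p b f) \<in> Ring.ring_hom (S_V l) (S_A l p b)"
  unfolding S_A_def to_S_A_def by (rule ideal.rcos_ring_hom[OF Delta_ideal])

lemma cl_mult:
  assumes "f \<in> poly_funs n" "g \<in> poly_funs n"
  shows "cl f \<otimes>\<^bsub>S_A l p b\<^esub> cl g = cl (\<lambda>x. f x * g x)"
proof -
  have "restrict f V \<otimes>\<^bsub>S_V l\<^esub> restrict g V = restrict (\<lambda>x. f x * g x) V"
    by (auto simp: S_V_def coord_ring_def fun_eq_iff)
  then show ?thesis
    using ring_hom_mult[OF cl_hom restrict_in_S_V[OF assms(1)] restrict_in_S_V[OF assms(2)]]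
    by (simp add: cl_def)
qed

lemma cl_add:
  assumes "f \<in> poly_funs n" "g \<in> poly_funs n"
  shows "cl f \<oplus>\<^bsub>S_A l p b\<^esub> cl g = cl (\<lambda>x. f x + g x)"
proof -
  have "restrict f V \<oplus>\<^bsub>S_V l\<^esub> restrict g V = restrict (\<lambda>x. f x + g x) V"
    by (auto simp: S_V_def coord_ring_def fun_eq_iff)
  then show ?thesis
    using ring_hom_add[OF cl_hom restrict_in_S_V[OF assms(1)] restrict_in_S_V[OF assms(2)]]
    by (simp add: cl_def)
qed

lemma cl_one: "\<one>\<^bsub>S_A l p b\<^esub> = cl (\<lambda>x. 1)"
  using ring_hom_one[OF cl_hom] by (simp add: cl_def S_V_def coord_ring_def)

lemma cl_zero: "\<zero>\<^bsub>S_A l p b\<^esub> = cl (\<lambda>x. 0)"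
proof -
  have "ring (S_V l)" "ring (S_A l p b)" using S_V_cring S_A_cring by (auto simp: cring_def)
  from ring_hom_zero[OF cl_hom this] show ?thesis by (simp add: cl_def S_V_def coord_ring_def)
qed

text \<open>Thus \<open>S_A\<close> is the ring of polynomial functions on the union of the mirrors,
  and identities in it can be checked pointwise.\<close>

lemma cl_eq_iff:
  assumes "f \<in> poly_funs n" "g \<in> poly_funs n"
  shows "cl f = cl g \<longleftrightarrow> (\<forall>x\<in>mirrors. f x = g x)"
proof -
  interpret cring "S_V l" by (rule S_V_cring)
  have "\<ominus>\<^bsub>S_V l\<^esub> restrict g V = restrict (\<lambda>x. - g x) V"
    using assms by (intro minus_equality restrict_in_S_V poly_funs_uminus)
      (auto simp: S_V_def coord_ring_def fun_eq_iff)
  then have "restrict f V \<ominus>\<^bsub>S_V l\<^esub> restrict g V = restrict (\<lambda>x. f x - g x) V"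
    by (auto simp: a_minus_def S_V_def coord_ring_def fun_eq_iff)
  then show ?thesis
    using quotient_eq_iff_same_a_r_cos[OF Delta_ideal restrict_in_S_V[OF assms(1)] restrict_in_S_V[OF assms(2)]]
      mem_Delta_ideal[OF poly_funs_diff[OF assms]]
    by (auto simp: cl_def to_S_A_def)
qed

section \<open>Nonzerodivisors and fractions through their values on the mirrors\<close>

definition regular :: "((nat \<Rightarrow> complex) \<Rightarrow> complex) \<Rightarrow> bool" where
  "regular s \<longleftrightarrow> s \<in> poly_funs n \<and> (\<forall>i j. i < j \<longrightarrow> j \<le> l \<longrightarrow> (\<exists>x\<in>hyper l i j. s x \<noteq> 0))"

lemma regular_poly_funs: "regular s \<Longrightarrow> s \<in> poly_funs n"
  by (simp add: regular_def)

lemma regular_cancel: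
  assumes "regular s" "f \<in> poly_funs n" "g \<in> poly_funs n" "i < j" "j \<le> l"
    and "\<And>x. x \<in> hyper l i j \<Longrightarrow> s x * f x = s x * g x" "x \<in> hyper l i j"
  shows "f x = g x"
proof -
  obtain x0 where "x0 \<in> hyper l i j" "s x0 \<noteq> 0" using assms(1,4,5) by (auto simp: regular_def)
  then show ?thesis
    using poly_funs_cancel[OF line_closed_hyper regular_poly_funs[OF assms(1)] assms(2,3,6)] assms(7) by blast
qed

lemma mirrors_cancel:
  assumes "regular s" "f \<in> poly_funs n" "g \<in> poly_funs n"
    and eq: "\<And>x. x \<in> mirrors \<Longrightarrow> s x * f x = s x * g x" and x: "x \<in> mirrors"
  shows "f x = g x"
proof -
  obtain i j where ij: "i < j" "j \<le> l" "x \<in> hyper l i j" using x by (auto simp: mirrors_def)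
  show ?thesis
    by (rule regular_cancel[OF assms(1-3) ij(1,2) _ ij(3)]) (rule eq, rule mirrorsI[OF ij(1,2)])
qed

lemma regular_mult:
  assumes "regular s" "regular t"
  shows "regular (\<lambda>x. s x * t x)"
  unfolding regular_def
proof (intro conjI allI impI)
  show "(\<lambda>x. s x * t x) \<in> poly_funs n"
    using assms by (intro poly_funs.mult) (auto simp: regular_def)
  fix i j assume ij: "i < j" "j \<le> l"
  obtain x where x: "x \<in> hyper l i j" "t x \<noteq> 0" using assms(2) ij by (auto simp: regular_def)
  show "\<exists>x\<in>hyper l i j. s x * t x \<noteq> 0"
  proof (rule ccontr)
    assume "\<not> ?thesis"
    then have "t x = 0"
      using regular_cancel[OF assms(1) regular_poly_funs[OF assms(2)] poly_funs.const[of 0] ij _ x(1)] by auto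
    then show False using x by simp
  qed
qed

lemma regular_one: "regular (\<lambda>x. 1)"
proof -
  have "\<exists>x. x \<in> hyper l i j" if "i < j" "j \<le> l" for i j
    using hyper_generic_point[OF that] by metis
  then show ?thesis unfolding regular_def by (auto intro: poly_funs.const)
qed

abbreviation "NZ \<equiv> nonzerodivisors (S_A l p b)"

text \<open>The mirrors are the irreducible components. If \<open>s\<close> vanishes on one of them,
  the product of all other differences is a nonzero class killed by \<open>s\<close>.\<close>

lemma cl_in_NZ_iff:
  assumes s: "s \<in> poly_funs n"
  shows "cl s \<in> NZ \<longleftrightarrow> regular s"
proof -
  have eq: "cl s \<otimes>\<^bsub>S_A l p b\<^esub> cl a = \<zero>\<^bsub>S_A l p b\<^esub> \<longleftrightarrow> (\<forall>x\<in>mirrors. s x * a x = 0)"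
    "cl a = \<zero>\<^bsub>S_A l p b\<^esub> \<longleftrightarrow> (\<forall>x\<in>mirrors. a x = 0)"
    if "a \<in> poly_funs n" for a
    using that s by (auto simp: cl_mult cl_zero cl_eq_iff poly_funs.mult poly_funs.const)
  have NZ: "cl s \<in> NZ \<longleftrightarrow> (\<forall>a\<in>poly_funs n. (\<forall>x\<in>mirrors. s x * a x = 0) \<longrightarrow> (\<forall>x\<in>mirrors. a x = 0))"
    unfolding nonzerodivisors_def carrier_S_A using s eq by auto
  show ?thesis
  proof
    assume reg: "regular s"
    show "cl s \<in> NZ" unfolding NZ
    proof (intro ballI impI)
      fix a x assume "a \<in> poly_funs n" "\<forall>x\<in>mirrors. s x * a x = 0" "x \<in> mirrors"
      then show "a x = 0"
        using mirrors_cancel[OF reg _ poly_funs.const[of 0]] by simp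
    qed
  next
    assume nz: "cl s \<in> NZ"
    have "\<exists>x\<in>hyper l i j. s x \<noteq> 0" if ij: "i < j" "j \<le> l" for i j
    proof (rule ccontr)
      assume no: "\<not> ?thesis"
      define a where "a = (\<lambda>x. \<Prod>(a, b)\<in>pairs l - {(i, j)}. x a - (x b :: complex))"
      have apf: "a \<in> poly_funs n"
        unfolding a_def case_prod_beta by (auto intro!: poly_funs_intros simp: pairs_def)
      have "s x * a x = 0" if x: "x \<in> mirrors" for x
      proof -
        obtain i' j' where ij': "i' < j'" "j' \<le> l" "x \<in> hyper l i' j'" using x by (auto simp: mirrors_def)
        show ?thesis
        proof (cases "(i', j') = (i, j)")
          case True
          then show ?thesis using no ij' by auto
        next
          case False
          then have "a x = 0" unfolding a_def using ij' finite_pairs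
            by (intro prod_zero bexI[of _ "(i', j')"]) (auto simp: mem_pairs hyper_def)
          then show ?thesis by simp
        qed
      qed
      then have "\<forall>x\<in>mirrors. a x = 0" using nz apf unfolding NZ by blast
      then show False
        using vandermonde_cofactor_nonzero[OF ij] ij unfolding a_def by (auto intro: mirrorsI)
    qed
    then show "regular s" using s by (simp add: regular_def)
  qed
qed

definition fr :: "((nat \<Rightarrow> complex) \<Rightarrow> complex) \<Rightarrow> ((nat \<Rightarrow> complex) \<Rightarrow> complex) \<Rightarrow>
    (((nat \<Rightarrow> complex) \<Rightarrow> complex) set \<times> ((nat \<Rightarrow> complex) \<Rightarrow> complex) set) set" where
  "fr a s = fraction (S_A l p b) NZ (cl a) (cl s)"

text \<open>The auxiliary factor \<open>u\<close> of the localization is regular and cancels, which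
  leaves a cross-multiplied identity of values.\<close>

lemma mem_fr_iff:
  assumes "a \<in> poly_funs n" "s \<in> poly_funs n"
  shows "z \<in> fr a s \<longleftrightarrow> (\<exists>c t. z = (cl c, cl t) \<and> c \<in> poly_funs n \<and> regular t \<and>
      (\<forall>x\<in>mirrors. t x * a x = s x * c x))"
proof -
  have key: "(\<exists>u\<in>NZ. u \<otimes>\<^bsub>S_A l p b\<^esub> (cl t \<otimes>\<^bsub>S_A l p b\<^esub> cl a) = u \<otimes>\<^bsub>S_A l p b\<^esub> (cl s \<otimes>\<^bsub>S_A l p b\<^esub> cl c)) \<longleftrightarrow>
      (\<forall>x\<in>mirrors. t x * a x = s x * c x)" (is "?lhs \<longleftrightarrow> ?rhs")
    if c: "c \<in> poly_funs n" and t: "regular t" for c t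
  proof
    note tp = regular_poly_funs[OF t]
    have pf: "(\<lambda>x. t x * a x) \<in> poly_funs n" "(\<lambda>x. s x * c x) \<in> poly_funs n"
      by (intro poly_funs.mult tp assms c)+
    {
      assume ?lhs
      then obtain u where u: "u \<in> poly_funs n" "cl u \<in> NZ"
        "cl u \<otimes>\<^bsub>S_A l p b\<^esub> (cl t \<otimes>\<^bsub>S_A l p b\<^esub> cl a) = cl u \<otimes>\<^bsub>S_A l p b\<^esub> (cl s \<otimes>\<^bsub>S_A l p b\<^esub> cl c)"
        unfolding nonzerodivisors_def carrier_S_A by auto
      have reg: "regular u" using u cl_in_NZ_iff by simp
      have "\<forall>x\<in>mirrors. u x * (t x * a x) = u x * (s x * c x)"
        using u(3) tp assms c u(1) pf by (simp add: cl_mult cl_eq_iff poly_funs.mult)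
      then show ?rhs using mirrors_cancel[OF reg pf] by blast
    next
      assume ?rhs
      then have "cl t \<otimes>\<^bsub>S_A l p b\<^esub> cl a = cl s \<otimes>\<^bsub>S_A l p b\<^esub> cl c"
        using tp assms c pf by (simp add: cl_mult cl_eq_iff)
      moreover have "cl (\<lambda>x. 1) \<in> NZ" using cl_in_NZ_iff regular_one regular_poly_funs by blast
      ultimately show ?lhs by auto
    }
  qed
  have "z \<in> fr a s \<longleftrightarrow> (\<exists>c t. z = (cl c, cl t) \<and> c \<in> poly_funs n \<and> t \<in> poly_funs n \<and> cl t \<in> NZ \<and>
      (\<exists>u\<in>NZ. u \<otimes>\<^bsub>S_A l p b\<^esub> (cl t \<otimes>\<^bsub>S_A l p b\<^esub> cl a) = u \<otimes>\<^bsub>S_A l p b\<^esub> (cl s \<otimes>\<^bsub>S_A l p b\<^esub> cl c)))"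
  proof -
    have "NZ \<subseteq> cl ` poly_funs n" unfolding nonzerodivisors_def carrier_S_A by auto
    then show ?thesis unfolding fr_def fraction_def carrier_S_A by blast
  qed
  also have "\<dots> \<longleftrightarrow> (\<exists>c t. z = (cl c, cl t) \<and> c \<in> poly_funs n \<and> regular t \<and>
      (\<forall>x\<in>mirrors. t x * a x = s x * c x))"
    using key cl_in_NZ_iff regular_poly_funs by metis
  finally show ?thesis .
qed

lemma fr_self: "a \<in> poly_funs n \<Longrightarrow> regular s \<Longrightarrow> (cl a, cl s) \<in> fr a s"
  unfolding mem_fr_iff[OF _ regular_poly_funs] by (intro exI[of _ a] exI[of _ s]) simp

lemma fr_subset:
  assumes a: "a \<in> poly_funs n" "a' \<in> poly_funs n" and s: "regular s" "regular s'"
    and eq: "\<And>x. x \<in> mirrors \<Longrightarrow> s' x * a x = s x * a' x"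
  shows "fr a s \<subseteq> fr a' s'"
proof
  fix z assume "z \<in> fr a s"
  then obtain c t where z: "z = (cl c, cl t)" and c: "c \<in> poly_funs n" and t: "regular t"
    and ct: "\<And>x. x \<in> mirrors \<Longrightarrow> t x * a x = s x * c x"
    using mem_fr_iff[OF a(1) regular_poly_funs[OF s(1)]] by auto
  have pf: "(\<lambda>x. t x * a' x) \<in> poly_funs n" "(\<lambda>x. s' x * c x) \<in> poly_funs n"
    by (intro poly_funs.mult regular_poly_funs t s a c)+
  have "t x * a' x = s' x * c x" if x: "x \<in> mirrors" for x
  proof (rule mirrors_cancel[OF s(1) pf _ x])
    fix y assume y: "y \<in> mirrors"
    have "s y * (t y * a' y) = t y * (s y * a' y)" by (rule mult.left_commute)
    also have "\<dots> = s' y * (t y * a y)" unfolding eq[OF y, symmetric] by (rule mult.left_commute)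
    also have "\<dots> = s y * (s' y * c y)" unfolding ct[OF y] by (rule mult.left_commute)
    finally show "s y * (t y * a' y) = s y * (s' y * c y)" .
  qed
  then show "z \<in> fr a' s'"
    unfolding mem_fr_iff[OF a(2) regular_poly_funs[OF s(2)]] using z c t by blast
qed

lemma fr_eqI:
  assumes "a \<in> poly_funs n" "a' \<in> poly_funs n" "regular s" "regular s'"
    and "\<And>x. x \<in> mirrors \<Longrightarrow> s' x * a x = s x * a' x"
  shows "fr a s = fr a' s'"
  by (intro equalityI fr_subset assms assms(5)[symmetric])

lemma fr_eqD:
  assumes a: "a \<in> poly_funs n" "a' \<in> poly_funs n" and s: "regular s" "regular s'"
    and eq: "fr a s = fr a' s'" and x: "x \<in> mirrors"
  shows "s x * a' x = s' x * a x"
proof -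
  obtain c t where ct: "cl a = cl c" "cl s = cl t" "c \<in> poly_funs n" "regular t"
    "\<forall>x\<in>mirrors. t x * a' x = s' x * c x"
    using fr_self[OF a(1) s(1)] unfolding eq mem_fr_iff[OF a(2) regular_poly_funs[OF s(2)]] by auto
  then have "a x = c x" "s x = t x"
    using cl_eq_iff a s regular_poly_funs x by blast+
  then show ?thesis using ct x by simp
qed

text \<open>Every choice of representatives contributes the same class, and by
  \<open>fr_self\<close> there is at least one choice; so the union is that class.\<close>

lemma fr_mult:
  assumes a: "a \<in> poly_funs n" "a' \<in> poly_funs n" and s: "regular s" "regular s'"
  shows "fr a s \<otimes>\<^bsub>Q_A l p b\<^esub> fr a' s' = fr (\<lambda>x. a x * a' x) (\<lambda>x. s x * s' x)"
proof -
  have const: "fraction (S_A l p b) NZ (c \<otimes>\<^bsub>S_A l p b\<^esub> c') (t \<otimes>\<^bsub>S_A l p b\<^esub> t') =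
      fr (\<lambda>x. a x * a' x) (\<lambda>x. s x * s' x)"
    if "(c, t) \<in> fr a s" "(c', t') \<in> fr a' s'" for c t c' t'
  proof -
    obtain d u where d: "c = cl d" "t = cl u" "d \<in> poly_funs n" "regular u"
      "\<And>x. x \<in> mirrors \<Longrightarrow> u x * a x = s x * d x"
      using \<open>(c, t) \<in> fr a s\<close> mem_fr_iff a s regular_poly_funs by auto
    obtain d' u' where d': "c' = cl d'" "t' = cl u'" "d' \<in> poly_funs n" "regular u'"
      "\<And>x. x \<in> mirrors \<Longrightarrow> u' x * a' x = s' x * d' x"
      using \<open>(c', t') \<in> fr a' s'\<close> mem_fr_iff a s regular_poly_funs by auto
    have "fraction (S_A l p b) NZ (c \<otimes>\<^bsub>S_A l p b\<^esub> c') (t \<otimes>\<^bsub>S_A l p b\<^esub> t') =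
        fr (\<lambda>x. d x * d' x) (\<lambda>x. u x * u' x)"
      by (simp add: d(1,2) d'(1,2) fr_def cl_mult[OF d(3) d'(3)]
        cl_mult[OF regular_poly_funs[OF d(4)] regular_poly_funs[OF d'(4)]])
    also have "\<dots> = fr (\<lambda>x. a x * a' x) (\<lambda>x. s x * s' x)"
    proof (rule fr_eqI)
      fix x assume x: "x \<in> mirrors"
      have "s x * s' x * (d x * d' x) = (s x * d x) * (s' x * d' x)" by (simp add: mult_ac)
      also have "\<dots> = (u x * a x) * (u' x * a' x)" using d(5)[OF x] d'(5)[OF x] by simp
      finally show "s x * s' x * (d x * d' x) = u x * u' x * (a x * a' x)" by (simp add: mult_ac)
    qed (intro poly_funs.mult regular_mult a s d(3,4) d'(3,4))+
    finally show ?thesis .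
  qed
  have "fr a s \<otimes>\<^bsub>Q_A l p b\<^esub> fr a' s' = (\<Union>(c, t)\<in>fr a s. \<Union>(c', t')\<in>fr a' s'.
      fraction (S_A l p b) NZ (c \<otimes>\<^bsub>S_A l p b\<^esub> c') (t \<otimes>\<^bsub>S_A l p b\<^esub> t'))"
    by (simp add: Q_A_def total_fractions_def localization_def)
  also have "\<dots> = (\<Union>(c, t)\<in>fr a s. \<Union>(c', t')\<in>fr a' s'. fr (\<lambda>x. a x * a' x) (\<lambda>x. s x * s' x))"
    using const by (intro SUP_cong refl) auto
  also have "\<dots> = fr (\<lambda>x. a x * a' x) (\<lambda>x. s x * s' x)"
    using fr_self[OF a(1) s(1)] fr_self[OF a(2) s(2)] by auto
  finally show ?thesis .
qed

lemma fr_add: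
  assumes a: "a \<in> poly_funs n" "a' \<in> poly_funs n" and s: "regular s" "regular s'"
  shows "fr a s \<oplus>\<^bsub>Q_A l p b\<^esub> fr a' s' = fr (\<lambda>x. s' x * a x + s x * a' x) (\<lambda>x. s x * s' x)"
proof -
  let ?R = "fr (\<lambda>x. s' x * a x + s x * a' x) (\<lambda>x. s x * s' x)"
  have const: "fraction (S_A l p b) NZ ((t' \<otimes>\<^bsub>S_A l p b\<^esub> c) \<oplus>\<^bsub>S_A l p b\<^esub> (t \<otimes>\<^bsub>S_A l p b\<^esub> c'))
      (t \<otimes>\<^bsub>S_A l p b\<^esub> t') = ?R"
    if "(c, t) \<in> fr a s" "(c', t') \<in> fr a' s'" for c t c' t'
  proof -
    obtain d u where d: "c = cl d" "t = cl u" "d \<in> poly_funs n" "regular u"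
      "\<And>x. x \<in> mirrors \<Longrightarrow> u x * a x = s x * d x"
      using \<open>(c, t) \<in> fr a s\<close> mem_fr_iff a s regular_poly_funs by auto
    obtain d' u' where d': "c' = cl d'" "t' = cl u'" "d' \<in> poly_funs n" "regular u'"
      "\<And>x. x \<in> mirrors \<Longrightarrow> u' x * a' x = s' x * d' x"
      using \<open>(c', t') \<in> fr a' s'\<close> mem_fr_iff a s regular_poly_funs by auto
    have "fraction (S_A l p b) NZ ((t' \<otimes>\<^bsub>S_A l p b\<^esub> c) \<oplus>\<^bsub>S_A l p b\<^esub> (t \<otimes>\<^bsub>S_A l p b\<^esub> c'))
        (t \<otimes>\<^bsub>S_A l p b\<^esub> t') = fr (\<lambda>x. u' x * d x + u x * d' x) (\<lambda>x. u x * u' x)"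
      by (simp add: d(1,2) d'(1,2) fr_def cl_mult[OF regular_poly_funs[OF d'(4)] d(3)]
        cl_mult[OF regular_poly_funs[OF d(4)] d'(3)]
        cl_mult[OF regular_poly_funs[OF d(4)] regular_poly_funs[OF d'(4)]]
        cl_add[OF poly_funs.mult[OF regular_poly_funs[OF d'(4)] d(3)]
          poly_funs.mult[OF regular_poly_funs[OF d(4)] d'(3)]])
    also have "\<dots> = ?R"
    proof (rule fr_eqI)
      fix x assume x: "x \<in> mirrors"
      have "s x * s' x * (u' x * d x + u x * d' x) =
          s' x * u' x * (s x * d x) + s x * u x * (s' x * d' x)" by (simp add: algebra_simps)
      also have "\<dots> = s' x * u' x * (u x * a x) + s x * u x * (u' x * a' x)"
        using d(5)[OF x] d'(5)[OF x] by simp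
      finally show "s x * s' x * (u' x * d x + u x * d' x) = u x * u' x * (s' x * a x + s x * a' x)"
        by (simp add: algebra_simps)
    qed (intro poly_funs.add poly_funs.mult regular_mult a s d(3,4) d'(3,4)
      s[THEN regular_poly_funs] d(4)[THEN regular_poly_funs] d'(4)[THEN regular_poly_funs])+
    finally show ?thesis .
  qed
  have "fr a s \<oplus>\<^bsub>Q_A l p b\<^esub> fr a' s' = (\<Union>(c, t)\<in>fr a s. \<Union>(c', t')\<in>fr a' s'.
      fraction (S_A l p b) NZ ((t' \<otimes>\<^bsub>S_A l p b\<^esub> c) \<oplus>\<^bsub>S_A l p b\<^esub> (t \<otimes>\<^bsub>S_A l p b\<^esub> c')) (t \<otimes>\<^bsub>S_A l p b\<^esub> t'))"
    by (simp add: Q_A_def total_fractions_def localization_def)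
  also have "\<dots> = (\<Union>(c, t)\<in>fr a s. \<Union>(c', t')\<in>fr a' s'. ?R)"
    using const by (intro SUP_cong refl) auto
  also have "\<dots> = ?R"
    using fr_self[OF a(1) s(1)] fr_self[OF a(2) s(2)] by auto
  finally show ?thesis .
qed

lemma carrier_Q_A: "carrier (Q_A l p b) = {fr a s | a s. a \<in> poly_funs n \<and> regular s}"
proof -
  have "NZ = cl ` {s. regular s}"
  proof -
    have "NZ \<subseteq> cl ` poly_funs n" unfolding nonzerodivisors_def carrier_S_A by auto
    then show ?thesis using cl_in_NZ_iff regular_poly_funs by blast
  qed
  then show ?thesis
    unfolding Q_A_def total_fractions_def localization_def carrier_S_A fr_def by auto
qed

lemma to_fractions_cl: "to_fractions (S_A l p b) (cl a) = fr a (\<lambda>x. 1)"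
  by (simp add: to_fractions_def fr_def cl_one)

section \<open>The ideal of minors\<close>

lemma ideal_cl_sum:
  assumes I: "ideal I (S_A l p b)" and "finite K"
    and "\<And>k. k \<in> K \<Longrightarrow> f k \<in> poly_funs n" "\<And>k. k \<in> K \<Longrightarrow> cl (f k) \<in> I"
  shows "cl (\<lambda>x. \<Sum>k\<in>K. f k x) \<in> I"
  using assms(2-)
proof induction
  case empty
  show ?case
    using additive_subgroup.zero_closed[OF ideal.axioms(1)[OF I]] by (simp add: cl_zero)
next
  case (insert k K)
  have "cl (f k) \<oplus>\<^bsub>S_A l p b\<^esub> cl (\<lambda>x. \<Sum>k\<in>K. f k x) \<in> I"
    using insert by (intro additive_subgroup.a_closed[OF ideal.axioms(1)[OF I]]) auto
  moreover have "f k \<in> poly_funs n" "(\<lambda>x. \<Sum>k\<in>K. f k x) \<in> poly_funs n"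
    using insert.prems(1) by (auto intro: poly_funs_sum)
  ultimately show ?case using insert.hyps cl_add by simp
qed

lemma ideal_cl_mult:
  assumes I: "ideal I (S_A l p b)" and "f \<in> poly_funs n" "g \<in> poly_funs n" "cl g \<in> I"
  shows "cl (\<lambda>x. f x * g x) \<in> I"
  using ideal.I_l_closed[OF I assms(4), of "cl f"] assms(2,3) by (simp add: carrier_S_A cl_mult)

text \<open>The right-hand side is an ideal containing the minors by
  \<open>minor_combination\<close>, so it contains the ideal they generate; conversely
  \<open>E_combination\<close> puts every \<open>E k\<close> into that ideal.\<close>

lemma I_tilde_eq:
  "I_tilde l p b = {cl (\<lambda>x. \<Sum>k\<le>l. c k x * E k x) | c. \<forall>k. c k \<in> poly_funs n}" (is "_ = ?I")
proof -
  interpret SA: cring "S_A l p b" by (rule S_A_cring)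
  let ?G = "{to_S_A l p b (jacobian_minor l p b i j) | i j. i < l \<and> j < l}"
  have cpf: "(\<lambda>x. \<Sum>k\<le>l. c k x * E k x) \<in> poly_funs n" if "\<forall>k. c k \<in> poly_funs n" for c
    using that by (intro poly_funs_sum poly_funs.mult E_poly_funs) auto
  have idl: "ideal ?I (S_A l p b)"
  proof (rule idealI)
    show "ring (S_A l p b)" by unfold_locales
    show "subgroup ?I (add_monoid (S_A l p b))"
    proof (rule subgroup.intro)
      show "?I \<subseteq> carrier (add_monoid (S_A l p b))"
        using cpf by (auto simp: carrier_S_A)
      show "x \<otimes>\<^bsub>add_monoid (S_A l p b)\<^esub> y \<in> ?I" if xy: "x \<in> ?I" "y \<in> ?I" for x y
      proof -
        obtain c d where cd: "x = cl (\<lambda>x. \<Sum>k\<le>l. c k x * E k x)" "\<forall>k. c k \<in> poly_funs n"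
          "y = cl (\<lambda>x. \<Sum>k\<le>l. d k x * E k x)" "\<forall>k. d k \<in> poly_funs n" using xy by blast
        then have "x \<oplus>\<^bsub>S_A l p b\<^esub> y = cl (\<lambda>x. \<Sum>k\<le>l. (c k x + d k x) * E k x)"
          using cpf by (simp add: cl_add distrib_right sum.distrib)
        then show ?thesis using cd poly_funs.add[of _ n]
          by (auto intro!: exI[of _ "\<lambda>k x. c k x + d k x"])
      qed
      show "\<one>\<^bsub>add_monoid (S_A l p b)\<^esub> \<in> ?I"
        by (auto simp: cl_zero intro!: exI[of _ "\<lambda>k x. 0"] poly_funs.const)
      show "inv\<^bsub>add_monoid (S_A l p b)\<^esub> x \<in> ?I" if x: "x \<in> ?I" for x
      proof -
        obtain c where c: "x = cl (\<lambda>x. \<Sum>k\<le>l. c k x * E k x)" "\<forall>k. c k \<in> poly_funs n" using x by blast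
        have c': "\<forall>k. (\<lambda>x. - c k x) \<in> poly_funs n" using c(2) poly_funs_uminus by blast
        have "\<ominus>\<^bsub>S_A l p b\<^esub> x = cl (\<lambda>x. \<Sum>k\<le>l. - c k x * E k x)"
        proof (rule SA.minus_equality)
          show "cl (\<lambda>x. \<Sum>k\<le>l. - c k x * E k x) \<oplus>\<^bsub>S_A l p b\<^esub> x = \<zero>\<^bsub>S_A l p b\<^esub>"
            unfolding c(1) using cl_add[OF cpf[OF c'] cpf[OF c(2)]]
            by (simp add: cl_zero sum_negf)
          show "x \<in> carrier (S_A l p b)" "cl (\<lambda>x. \<Sum>k\<le>l. - c k x * E k x) \<in> carrier (S_A l p b)"
            using c(1) cpf[OF c(2)] cpf[OF c'] by (auto simp: carrier_S_A)
        qed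
        then have "inv\<^bsub>add_monoid (S_A l p b)\<^esub> x = cl (\<lambda>x. \<Sum>k\<le>l. - c k x * E k x)"
          by (simp only: a_inv_def)
        then show ?thesis using c' by (intro CollectI exI[of _ "\<lambda>k x. - c k x"] conjI)
      qed
    qed
    show mult: "y \<otimes>\<^bsub>S_A l p b\<^esub> x \<in> ?I" if x: "x \<in> ?I" and y: "y \<in> carrier (S_A l p b)" for x y
    proof -
      obtain c where c: "x = cl (\<lambda>x. \<Sum>k\<le>l. c k x * E k x)" "\<forall>k. c k \<in> poly_funs n" using x by blast
      obtain f where f: "y = cl f" "f \<in> poly_funs n" using y by (auto simp: carrier_S_A)
      have "y \<otimes>\<^bsub>S_A l p b\<^esub> x = cl (\<lambda>x. \<Sum>k\<le>l. (f x * c k x) * E k x)"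
        using c f cl_mult[OF f(2) cpf[OF c(2)]] by (simp add: sum_distrib_left mult.assoc)
      then show ?thesis using c(2) poly_funs.mult[OF f(2)]
        by (auto intro!: exI[of _ "\<lambda>k x. f x * c k x"])
    qed
    show "x \<otimes>\<^bsub>S_A l p b\<^esub> y \<in> ?I" if x: "x \<in> ?I" and y: "y \<in> carrier (S_A l p b)" for x y
    proof -
      have "x \<in> carrier (S_A l p b)" using x cpf by (auto simp: carrier_S_A)
      then show ?thesis using mult[OF x y] SA.m_comm[of x y] y by simp
    qed
  qed
  have "?G \<subseteq> ?I"
  proof
    fix z assume "z \<in> ?G"
    then obtain r s where rs: "r < l" "s < l" "z = to_S_A l p b (jacobian_minor l p b r s)" by blast
    obtain c where c: "\<forall>k. c k \<in> poly_funs n"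
      "\<And>x. x \<in> V \<Longrightarrow> jacobian_minor l p b r s x = (\<Sum>k\<le>l. c k x * E k x)"
      using minor_combination[OF rs(1,2)] by blast
    have "jacobian_minor l p b r s = restrict (\<lambda>x. \<Sum>k\<le>l. c k x * E k x) V"
      using c(2) by (auto simp: fun_eq_iff jacobian_minor_def)
    then show "z \<in> ?I" using rs(3) c(1) by (auto simp: cl_def)
  qed
  then have sub: "I_tilde l p b \<subseteq> ?I"
    unfolding I_tilde_def by (rule SA.genideal_minimal[OF idl])
  have Gc: "?G \<subseteq> carrier (S_A l p b)"
    using minor_poly_funs by (fastforce simp: carrier_S_A cl_def)
  have It: "ideal (I_tilde l p b) (S_A l p b)"
    unfolding I_tilde_def by (rule SA.genideal_ideal[OF Gc])
  have G_sub: "?G \<subseteq> I_tilde l p b"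
    unfolding I_tilde_def by (rule SA.genideal_self[OF Gc])
  have E_mem: "cl (E k) \<in> I_tilde l p b" for k
  proof -
    obtain c where c: "\<And>r s. c r s \<in> poly_funs n"
      "\<And>x. x \<in> V \<Longrightarrow> E k x = (\<Sum>r<l. \<Sum>s<l. c r s x * jacobian_minor l p b r s x)"
      using E_combination[of k] by blast
    have "\<exists>m. \<forall>r<l. \<forall>s<l. m r s \<in> poly_funs n \<and> jacobian_minor l p b r s = restrict (m r s) V"
      using minor_poly_funs by metis
    then obtain m where m: "\<And>r s. r < l \<Longrightarrow> s < l \<Longrightarrow> m r s \<in> poly_funs n"
      "\<And>r s. r < l \<Longrightarrow> s < l \<Longrightarrow> jacobian_minor l p b r s = restrict (m r s) V" by blast
    have m_mem: "cl (m r s) \<in> I_tilde l p b" if "r < l" "s < l" for r s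
    proof -
      have "cl (m r s) = to_S_A l p b (jacobian_minor l p b r s)"
        unfolding cl_def m(2)[OF that] ..
      then have "cl (m r s) \<in> ?G" using that by blast
      then show ?thesis using G_sub by blast
    qed
    have "cl (\<lambda>x. \<Sum>r<l. \<Sum>s<l. c r s x * m r s x) \<in> I_tilde l p b"
      by (intro ideal_cl_sum[OF It] ideal_cl_mult[OF It] poly_funs_sum poly_funs.mult c(1) m(1) m_mem) auto
    moreover have "cl (\<lambda>x. \<Sum>r<l. \<Sum>s<l. c r s x * m r s x) = cl (E k)"
      unfolding cl_def using c(2) m(2) by (intro arg_cong[of _ _ "to_S_A l p b"]) (auto simp: fun_eq_iff)
    ultimately show ?thesis by simp
  qed
  have "?I \<subseteq> I_tilde l p b"
  proof
    fix z assume "z \<in> ?I"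
    then obtain c where c: "z = cl (\<lambda>x. \<Sum>k\<le>l. c k x * E k x)" "\<forall>k. c k \<in> poly_funs n" by blast
    have "cl (\<lambda>x. c k x * E k x) \<in> I_tilde l p b" for k
      using ideal_cl_mult[OF It _ E_poly_funs E_mem] c(2) by blast
    moreover have "(\<lambda>x. c k x * E k x) \<in> poly_funs n" for k
      using poly_funs.mult[OF _ E_poly_funs] c(2) by blast
    ultimately show "z \<in> I_tilde l p b"
      unfolding c(1) by (intro ideal_cl_sum[OF It finite_atMost])
  qed
  then show ?thesis using sub by blast
qed


section \<open>The isomorphism between the coordinate ring of L and \<open>S_tilde\<close>\<close>

abbreviation "L \<equiv> L_arr l"

lemma L_arr_cases:
  assumes "y \<in> L"
  obtains i j where "i < j" "j \<le> l" "y i = 0" "y j = 0" "y \<in> cspace n"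
  using assms by (auto simp: L_arr_def)

lemma shift_in_L:
  assumes "i < j" "j \<le> l" "x \<in> hyper l i j"
  shows "shift l (x i) x \<in> L"
proof -
  have "shift l (x i) x i = 0" "shift l (x i) x j = 0"
    using assms by (auto simp: shift_def hyper_def)
  then show ?thesis using assms shift_in_cspace[of l "x i" x] unfolding L_arr_def by blast
qed

lemma L_arr_shift:
  assumes "y \<in> L"
  obtains i j x where "i < j" "j \<le> l" "x \<in> hyper l i j" "y = shift l (x i) x"
proof -
  obtain i j where ij: "i < j" "j \<le> l" "y i = 0" "y j = 0" "y \<in> cspace n"
    using assms by (rule L_arr_cases)
  define x where "x = shift l (mean l y) y"
  have "x \<in> hyper l i j"
    using shift_mean_in_refl_space[of l y] ij by (simp add: hyper_def x_def shift_def)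
  moreover have "shift l (x i) x = y"
    unfolding x_def by (rule shift_mean_shift) (use ij in auto)
  ultimately show ?thesis using that ij by metis
qed

text \<open>A common denominator for all mirrors: on x_i = x_j only two terms survive and leave (i -
  j) * \<open>E i\<close>. The weights have to be distinct, as the \<open>E k\<close> sum to
  0.\<close>

definition \<delta> :: "(nat \<Rightarrow> complex) \<Rightarrow> complex" where
  "\<delta> x = (\<Sum>k\<le>l. of_nat k * E k x)"

text \<open>On a mirror the two surviving terms shift by the same coordinate, so the value of
  \<open>G\<close> there is a common factor and the quotient by \<open>\<delta>\<close> is this
  value.\<close>

definition numer :: "((nat \<Rightarrow> complex) \<Rightarrow> complex) \<Rightarrow> (nat \<Rightarrow> complex) \<Rightarrow> complex" where
  "numer G x = (\<Sum>k\<le>l. of_nat k * (G (shift l (x k) x) * E k x))"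

lemma sum_E_hyper:
  assumes "i < j" "j \<le> l" "x \<in> hyper l i j"
  shows "(\<Sum>k\<le>l. f k * E k x) = (f i - f j) * E i x"
proof -
  note Ek = fun_cong[OF E_hyper[OF assms]]
  have "E k x = 0" if "k \<noteq> i" "k \<noteq> j" for k using Ek[of k] that by (simp add: root_vec_def)
  then have "(\<Sum>k\<le>l. f k * E k x) = (\<Sum>k\<in>{i, j}. f k * E k x)"
    using assms by (intro sum.mono_neutral_right) auto
  also have "\<dots> = (f i - f j) * E i x"
    using assms Ek[of j] by (simp add: root_vec_def algebra_simps)
  finally show ?thesis .
qed

lemma shift_poly_funs: "G \<in> poly_funs n \<Longrightarrow> k \<le> l \<Longrightarrow> (\<lambda>x. G (shift l (x k) x)) \<in> poly_funs n"
  by (intro poly_funs_shift poly_funs.coord) auto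

lemma numer_poly_funs: "G \<in> poly_funs n \<Longrightarrow> numer G \<in> poly_funs n"
  unfolding numer_def[abs_def]
  by (intro poly_funs_sum poly_funs.mult poly_funs.const E_poly_funs shift_poly_funs) auto

lemma regular_\<delta>: "regular \<delta>"
  unfolding regular_def
proof (intro conjI allI impI)
  show "\<delta> \<in> poly_funs n" unfolding \<delta>_def[abs_def]
    by (intro poly_funs_sum poly_funs.mult poly_funs.const E_poly_funs)
  fix i j assume ij: "i < j" "j \<le> l"
  obtain x where "x \<in> hyper l i j" "E i x \<noteq> 0" using E_hyper_nonzero[OF ij] by blast
  then show "\<exists>x\<in>hyper l i j. \<delta> x \<noteq> 0"
    unfolding \<delta>_def using sum_E_hyper[OF ij, of x of_nat] ij by (intro bexI[of _ x]) auto
qed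

lemma numer_hyper:
  assumes "i < j" "j \<le> l" "x \<in> hyper l i j"
  shows "numer G x = \<delta> x * G (shift l (x i) x)"
proof -
  have "x i = x j" using assms by (simp add: hyper_def)
  moreover have "numer G x = (of_nat i * G (shift l (x i) x) - of_nat j * G (shift l (x j) x)) * E i x"
    using sum_E_hyper[OF assms, of "\<lambda>k. of_nat k * G (shift l (x k) x)"]
    by (simp add: numer_def mult.assoc)
  ultimately have "numer G x = (of_nat i - of_nat j) * E i x * G (shift l (x i) x)"
    by (simp add: algebra_simps)
  then show ?thesis unfolding \<delta>_def using sum_E_hyper[OF assms, of of_nat] by simp
qed

text \<open>A function \<open>g\<close> on \<open>L\<close> becomes the element of the total ring of fractions which takes the
  value \<open>g (x - x\<^sub>i (1, \<dots>, 1))\<close> at a point \<open>x\<close> of the mirror \<open>x\<^sub>i = x\<^sub>j\<close>.\<close>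

definition psi :: "((nat \<Rightarrow> complex) \<Rightarrow> complex) \<Rightarrow>
    (((nat \<Rightarrow> complex) \<Rightarrow> complex) set \<times> ((nat \<Rightarrow> complex) \<Rightarrow> complex) set) set" where
  "psi g = fr (numer (SOME G. G \<in> poly_funs n \<and> g = restrict G L)) \<delta>"

text \<open>Any fraction with the right values on the mirrors represents \<open>psi\<close>. This
  settles the arbitrary choice in the definition of \<open>psi\<close> and allows denominators other
  than \<open>\<delta>\<close>.\<close>

lemma psi_restrict:
  assumes G: "G \<in> poly_funs n" and a: "a \<in> poly_funs n" and s: "regular s"
    and eq: "\<And>i j x. i < j \<Longrightarrow> j \<le> l \<Longrightarrow> x \<in> hyper l i j \<Longrightarrow> a x = s x * G (shift l (x i) x)"
  shows "psi (restrict G L) = fr a s"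
proof -
  define H where "H = (SOME H. H \<in> poly_funs n \<and> restrict G L = restrict H L)"
  have H: "H \<in> poly_funs n" "restrict G L = restrict H L"
    using someI[of "\<lambda>H. H \<in> poly_funs n \<and> restrict G L = restrict H L" G] G unfolding H_def by auto
  have GH: "G y = H y" if "y \<in> L" for y using fun_cong[OF H(2), of y] that by simp
  have "fr (numer H) \<delta> = fr a s"
  proof (rule fr_eqI[OF numer_poly_funs[OF H(1)] a regular_\<delta> s])
    fix x assume "x \<in> mirrors"
    then obtain i j where ij: "i < j" "j \<le> l" "x \<in> hyper l i j" by (auto simp: mirrors_def)
    show "s x * numer H x = \<delta> x * a x"
      by (simp add: numer_hyper[OF ij] eq[OF ij] GH[OF shift_in_L[OF ij]])
  qed
  then show ?thesis by (simp add: psi_def H_def)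
qed

lemma psi_eq_fr: "G \<in> poly_funs n \<Longrightarrow> psi (restrict G L) = fr (numer G) \<delta>"
  by (rule psi_restrict[OF _ numer_poly_funs regular_\<delta> numer_hyper])

text \<open>Every point of L is a shifted point of a mirror. On that mirror equality of the
  fractions becomes equality of the values after multiplication by the square of
  \<open>\<delta>\<close>, which is regular and cancels.\<close>

lemma psi_inj:
  assumes "G \<in> poly_funs n" "H \<in> poly_funs n" "psi (restrict G L) = psi (restrict H L)"
  shows "restrict G L = restrict H L"
proof
  fix y
  have eq: "fr (numer G) \<delta> = fr (numer H) \<delta>" using assms psi_eq_fr by simp
  show "restrict G L y = restrict H L y"
  proof (cases "y \<in> L")
    case True
    then obtain i j x where ij: "i < j" "j \<le> l" and x: "x \<in> hyper l i j" and y: "y = shift l (x i) x"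
      by (rule L_arr_shift)
    have il: "i \<le> l" using ij by simp
    have "G (shift l (x i) x) = H (shift l (x i) x)"
    proof (rule regular_cancel[OF regular_mult[OF regular_\<delta> regular_\<delta>]
          shift_poly_funs[OF assms(1) il] shift_poly_funs[OF assms(2) il] ij _ x])
      fix z assume z: "z \<in> hyper l i j"
      show "\<delta> z * \<delta> z * G (shift l (z i) z) = \<delta> z * \<delta> z * H (shift l (z i) z)"
        using fr_eqD[OF numer_poly_funs[OF assms(1)] numer_poly_funs[OF assms(2)] regular_\<delta> regular_\<delta> eq
            mirrorsI[OF ij z]]
        by (auto simp: numer_hyper[OF ij z])
    qed
    then show ?thesis using y by simp
  qed simp
qed

lemma carrier_S_tilde:
  "carrier (S_tilde l p b) = {q \<in> carrier (Q_A l p b). \<forall>c. (\<forall>k. c k \<in> poly_funs n) \<longrightarrow>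
     (\<exists>d. (\<forall>k. d k \<in> poly_funs n) \<and>
       q \<otimes>\<^bsub>Q_A l p b\<^esub> fr (\<lambda>x. \<Sum>k\<le>l. c k x * E k x) (\<lambda>x. 1) = fr (\<lambda>x. \<Sum>k\<le>l. d k x * E k x) (\<lambda>x. 1))}"
  (is "_ = ?R")
proof -
  let ?e = "\<lambda>c x. \<Sum>k\<le>l. c k x * E k x"
  have img: "to_fractions (S_A l p b) ` I_tilde l p b = {fr (?e d) (\<lambda>x. 1) | d. \<forall>k. d k \<in> poly_funs n}"
    unfolding I_tilde_eq using to_fractions_cl by (auto simp: image_iff)
  have "carrier (S_tilde l p b) = {q \<in> carrier (Q_A l p b). \<forall>c. (\<forall>k. c k \<in> poly_funs n) \<longrightarrow>
      q \<otimes>\<^bsub>Q_A l p b\<^esub> to_fractions (S_A l p b) (cl (?e c)) \<in> to_fractions (S_A l p b) ` I_tilde l p b}"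
    unfolding S_tilde_def by (auto simp: I_tilde_eq)
  also have "\<dots> = ?R" unfolding img to_fractions_cl by blast
  finally show ?thesis .
qed

lemma E_sum_poly_funs: "\<forall>k. c k \<in> poly_funs n \<Longrightarrow> (\<lambda>x. \<Sum>k\<le>l. c k x * E k x) \<in> poly_funs n"
  by (intro poly_funs_sum poly_funs.mult E_poly_funs) auto

text \<open>Since \<open>E k\<close> lives on the mirrors involving \<open>x\<^sub>k\<close>, multiplication by \<open>psi g\<close> multiplies it
  by the polynomial \<open>g (x - x\<^sub>k (1, \<dots>, 1))\<close>.\<close>

lemma psi_in_S_tilde:
  assumes G: "G \<in> poly_funs n"
  shows "psi (restrict G L) \<in> carrier (S_tilde l p b)"
proof -
  have "\<exists>d. (\<forall>k. d k \<in> poly_funs n) \<and>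
      psi (restrict G L) \<otimes>\<^bsub>Q_A l p b\<^esub> fr (\<lambda>x. \<Sum>k\<le>l. c k x * E k x) (\<lambda>x. 1) = fr (\<lambda>x. \<Sum>k\<le>l. d k x * E k x) (\<lambda>x. 1)"
    if c: "\<forall>k. c k \<in> poly_funs n" for c
  proof -
    define d where "d k = (if k \<le> l then (\<lambda>x. G (shift l (x k) x) * c k x) else (\<lambda>x. 0))" for k
    have d: "\<forall>k. d k \<in> poly_funs n"
      using c shift_poly_funs[OF G] by (auto simp: d_def intro!: poly_funs.mult poly_funs.const)
    have "psi (restrict G L) \<otimes>\<^bsub>Q_A l p b\<^esub> fr (\<lambda>x. \<Sum>k\<le>l. c k x * E k x) (\<lambda>x. 1) =
        fr (\<lambda>x. numer G x * (\<Sum>k\<le>l. c k x * E k x)) (\<lambda>x. \<delta> x * 1)"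
      unfolding psi_eq_fr[OF G]
      by (rule fr_mult[OF numer_poly_funs[OF G] E_sum_poly_funs[OF c] regular_\<delta> regular_one])
    also have "\<dots> = fr (\<lambda>x. \<Sum>k\<le>l. d k x * E k x) (\<lambda>x. 1)"
    proof (rule fr_eqI[OF poly_funs.mult[OF numer_poly_funs[OF G] E_sum_poly_funs[OF c]]
          E_sum_poly_funs[OF d] regular_mult[OF regular_\<delta> regular_one] regular_one])
      fix x assume "x \<in> mirrors"
      then obtain i j where ij: "i < j" "j \<le> l" "x \<in> hyper l i j" by (auto simp: mirrors_def)
      have "d i x = G (shift l (x i) x) * c i x" "d j x = G (shift l (x i) x) * c j x"
        using ij by (auto simp: d_def hyper_def)
      then show "1 * (numer G x * (\<Sum>k\<le>l. c k x * E k x)) = \<delta> x * 1 * (\<Sum>k\<le>l. d k x * E k x)"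
        unfolding sum_E_hyper[OF ij] numer_hyper[OF ij] by (simp add: algebra_simps)
    qed
    finally show ?thesis using d by blast
  qed
  moreover have "psi (restrict G L) \<in> carrier (Q_A l p b)"
    unfolding psi_eq_fr[OF G] carrier_Q_A using numer_poly_funs[OF G] regular_\<delta> by blast
  ultimately show ?thesis unfolding carrier_S_tilde by blast
qed

lemma psi_surj:
  assumes "u \<in> carrier (S_tilde l p b)"
  shows "\<exists>G\<in>poly_funs n. u = psi (restrict G L)"
proof -
  obtain a s where u: "u = fr a s" and a: "a \<in> poly_funs n" and s: "regular s"
    using assms unfolding carrier_S_tilde carrier_Q_A by blast
  have ex: "\<exists>g\<in>poly_funs n. \<forall>x\<in>mirrors. s x * (g x * E k x) = a x * E k x" if k: "k \<le> l" for k
  proof -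
    \<comment> \<open>These coefficients single out the generator \<open>E k\<close>, to which the
      endomorphism is applied.\<close>
    define c where "c m = (if m = k then (\<lambda>x::nat \<Rightarrow> complex. 1 :: complex) else (\<lambda>x. 0))" for m
    have "\<forall>m. c m \<in> poly_funs n" by (auto simp: c_def intro: poly_funs.const)
    then obtain d where d: "\<forall>m. d m \<in> poly_funs n"
      "u \<otimes>\<^bsub>Q_A l p b\<^esub> fr (\<lambda>x. \<Sum>m\<le>l. c m x * E m x) (\<lambda>x. 1) = fr (\<lambda>x. \<Sum>m\<le>l. d m x * E m x) (\<lambda>x. 1)"
      using assms unfolding carrier_S_tilde by blast
    define h where "h = (\<lambda>x. \<Sum>m\<le>l. d m x * E m x)"
    have h: "h \<in> poly_funs n" unfolding h_def by (rule E_sum_poly_funs[OF d(1)])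
    have "(\<Sum>m\<le>l. c m x * E m x) = E k x" for x
    proof -
      have "(\<Sum>m\<le>l. c m x * E m x) = (\<Sum>m\<le>l. if m = k then E m x else 0)"
        by (intro sum.cong) (auto simp: c_def)
      then show ?thesis using k by simp
    qed
    then have "fr a s \<otimes>\<^bsub>Q_A l p b\<^esub> fr (E k) (\<lambda>x. 1) = fr h (\<lambda>x. 1)"
      using d(2) unfolding h_def u by simp
    then have eq: "fr (\<lambda>x. a x * E k x) (\<lambda>x. s x * 1) = fr h (\<lambda>x. 1)"
      using fr_mult[OF a E_poly_funs s regular_one] by simp
    have sh: "s x * h x = a x * E k x" if "x \<in> mirrors" for x
      using fr_eqD[OF poly_funs.mult[OF a E_poly_funs] h regular_mult[OF s regular_one] regular_one eq that]
      by simp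
    \<comment> \<open>On a mirror that does not involve \<open>k\<close> the function
      \<open>E k\<close> is 0, hence so is \<open>s\<close> times \<open>h\<close>, and
      \<open>s\<close> cancels; this is the hypothesis of \<open>E_divides\<close>.\<close>
    have "h x = 0" if ij: "i < j" "j \<le> l" "k \<noteq> i" "k \<noteq> j" "x \<in> hyper l i j" for i j x
    proof (rule regular_cancel[OF s h poly_funs.const ij(1,2) _ ij(5)])
      fix z assume z: "z \<in> hyper l i j"
      show "s z * h z = s z * 0"
        using sh[OF mirrorsI[OF ij(1,2) z]] E_hyper_zero[OF ij(1,2) k ij(3,4) z] by simp
    qed
    then obtain g where g: "g \<in> poly_funs n" "\<And>x. x \<in> V \<Longrightarrow> h x = g x * E k x"
      using E_divides[OF k h] by blast
    have "s x * (g x * E k x) = a x * E k x" if "x \<in> mirrors" for x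
      using sh[OF that] g(2)[OF subsetD[OF mirrors_subset that]] by simp
    then show ?thesis using g(1) by blast
  qed
  then have "\<exists>g. \<forall>k\<le>l. g k \<in> poly_funs n \<and> (\<forall>x\<in>mirrors. s x * (g k x * E k x) = a x * E k x)" by metis
  then obtain g where g: "\<And>k. k \<le> l \<Longrightarrow> g k \<in> poly_funs n"
    "\<And>k x. k \<le> l \<Longrightarrow> x \<in> mirrors \<Longrightarrow> s x * (g k x * E k x) = a x * E k x" by blast
  \<comment> \<open>\<open>E k\<close> is not identically zero on a mirror involving
    \<open>k\<close> and cancels there, so \<open>g k\<close> has the values of the fraction
    \<open>a / s\<close>. This holds for both indices of the mirror, whence
    \<open>compat\<close>.\<close>
  have sg: "s x * g k x = a x" if ij: "i < j" "j \<le> l" "x \<in> hyper l i j" and k: "k = i \<or> k = j" for i j k x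
  proof -
    have kl: "k \<le> l" using k ij by auto
    obtain x0 where x0: "x0 \<in> hyper l i j" "E i x0 \<noteq> 0" using E_hyper_nonzero[OF ij(1,2)] by blast
    have "E k x0 \<noteq> 0"
      using fun_cong[OF E_hyper[OF ij(1,2) x0(1)], of k] x0(2) k by (auto simp: root_vec_def)
    then show ?thesis
      using poly_funs_cancel[OF line_closed_hyper E_poly_funs
          poly_funs.mult[OF regular_poly_funs[OF s] g(1)[OF kl]] a _ x0(1) _ ij(3), of k]
        g(2)[OF kl mirrorsI[OF ij(1,2)]] by (simp add: mult_ac)
  qed
  have compat: "g i x = g j x" if ij: "i < j" "j \<le> l" "x \<in> hyper l i j" for i j x
  proof (rule regular_cancel[OF s g(1) g(1) ij(1,2) _ ij(3)])
    show "s z * g i z = s z * g j z" if z: "z \<in> hyper l i j" for z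
      using sg[OF ij(1,2) z] by simp
  qed (use ij in auto)
  obtain G where G: "G \<in> poly_funs n" "\<And>i x. i \<le> l \<Longrightarrow> x \<in> V \<Longrightarrow> G (shift l (x i) x) = g i x"
    using interpolation[of l g "l + 1"] g(1) compat by auto
  have "psi (restrict G L) = fr a s"
  proof (rule psi_restrict[OF G(1) a s])
    fix i j x assume ij: "i < j" "j \<le> l" "x \<in> hyper l i j"
    show "a x = s x * G (shift l (x i) x)"
      using G(2)[of i x] sg[OF ij, of i] ij hyper_subset by simp
  qed
  then show ?thesis using G(1) u by blast
qed

lemma psi_iso: "psi \<in> ring_iso (coord_ring n L) (S_tilde l p b)"
proof (rule ring_iso_memI)
  let ?C = "coord_ring n L"
  have car: "carrier ?C = {restrict G L | G. G \<in> poly_funs n}" by (simp add: coord_ring_def)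
  have ops: "x \<otimes>\<^bsub>S_tilde l p b\<^esub> y = x \<otimes>\<^bsub>Q_A l p b\<^esub> y" "x \<oplus>\<^bsub>S_tilde l p b\<^esub> y = x \<oplus>\<^bsub>Q_A l p b\<^esub> y" for x y
    by (auto simp: S_tilde_def)
  show "psi f \<in> carrier (S_tilde l p b)" if "f \<in> carrier ?C" for f
    using that psi_in_S_tilde unfolding car by auto
  note nd = numer_poly_funs regular_\<delta>
  show "psi (f \<otimes>\<^bsub>?C\<^esub> g) = psi f \<otimes>\<^bsub>S_tilde l p b\<^esub> psi g" if fg: "f \<in> carrier ?C" "g \<in> carrier ?C" for f g
  proof -
    obtain F G where F: "F \<in> poly_funs n" "f = restrict F L" and G: "G \<in> poly_funs n" "g = restrict G L"
      using fg unfolding car by blast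
    have 1: "f \<otimes>\<^bsub>?C\<^esub> g = restrict (\<lambda>x. F x * G x) L" using F G by (auto simp: coord_ring_def fun_eq_iff)
    have "psi (restrict (\<lambda>x. F x * G x) L) = fr (\<lambda>x. numer F x * numer G x) (\<lambda>x. \<delta> x * \<delta> x)"
      by (rule psi_restrict)
        ((intro poly_funs.mult regular_mult nd(2) F(1) G(1) nd(1)[OF F(1)] nd(1)[OF G(1)])+,
          simp add: numer_hyper)
    also have "\<dots> = psi f \<otimes>\<^bsub>Q_A l p b\<^esub> psi g"
      using fr_mult[OF nd(1)[OF F(1)] nd(1)[OF G(1)] nd(2,2)] F G by (simp add: psi_eq_fr)
    finally show ?thesis unfolding ops 1 .
  qed
  show "psi (f \<oplus>\<^bsub>?C\<^esub> g) = psi f \<oplus>\<^bsub>S_tilde l p b\<^esub> psi g" if fg: "f \<in> carrier ?C" "g \<in> carrier ?C" for f g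
  proof -
    obtain F G where F: "F \<in> poly_funs n" "f = restrict F L" and G: "G \<in> poly_funs n" "g = restrict G L"
      using fg unfolding car by blast
    have 1: "f \<oplus>\<^bsub>?C\<^esub> g = restrict (\<lambda>x. F x + G x) L" using F G by (auto simp: coord_ring_def fun_eq_iff)
    have "psi (restrict (\<lambda>x. F x + G x) L) = fr (\<lambda>x. \<delta> x * numer F x + \<delta> x * numer G x) (\<lambda>x. \<delta> x * \<delta> x)"
      by (rule psi_restrict)
        ((intro poly_funs.add poly_funs.mult regular_mult nd(2) F(1) G(1) nd(1)[OF F(1)] nd(1)[OF G(1)]
            regular_poly_funs[OF regular_\<delta>])+,
          simp add: numer_hyper algebra_simps)
    also have "\<dots> = psi f \<oplus>\<^bsub>Q_A l p b\<^esub> psi g"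
      using fr_add[OF nd(1)[OF F(1)] nd(1)[OF G(1)] nd(2,2)] F G by (simp add: psi_eq_fr)
    finally show ?thesis unfolding ops 1 .
  qed
  show "psi \<one>\<^bsub>?C\<^esub> = \<one>\<^bsub>S_tilde l p b\<^esub>"
  proof -
    have "\<one>\<^bsub>S_tilde l p b\<^esub> = fr (\<lambda>x. 1) (\<lambda>x. 1)"
      by (simp add: S_tilde_def Q_A_def total_fractions_def localization_def fr_def cl_one)
    moreover have "psi (restrict (\<lambda>x. 1) L) = fr (\<lambda>x. 1) (\<lambda>x. 1)"
      by (rule psi_restrict[OF poly_funs.const poly_funs.const regular_one]) simp
    ultimately show ?thesis by (simp add: coord_ring_def)
  qed
  show "bij_betw psi (carrier ?C) (carrier (S_tilde l p b))"
  proof (rule bij_betw_imageI)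
    show "inj_on psi (carrier ?C)" using psi_inj unfolding car inj_on_def by blast
    show "psi ` carrier ?C = carrier (S_tilde l p b)"
      using psi_in_S_tilde psi_surj unfolding car by blast
  qed
qed

lemma psi_const:
  "psi (const_fun L c) = S_tilde_const l p b c"
proof -
  have "psi (restrict (\<lambda>x. c) L) = fr (\<lambda>x. c) (\<lambda>x. 1)"
    by (rule psi_restrict[OF poly_funs.const poly_funs.const regular_one]) simp
  then show ?thesis
    unfolding S_tilde_const_def const_fun_def using to_fractions_cl[of "\<lambda>x. c"] by (simp add: cl_def)
qed

text \<open>Membership in \<open>ring_iso\<close> says nothing about zero, and transporting the ring
  axioms along \<open>psi\<close> yields a ring whose zero is the image of zero.\<close>

lemma psi_zero: "psi \<zero>\<^bsub>coord_ring n L\<^esub> = \<zero>\<^bsub>S_tilde l p b\<^esub>"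
proof -
  have "\<zero>\<^bsub>S_tilde l p b\<^esub> = fr (\<lambda>x. 0) (\<lambda>x. 1)"
    by (simp add: S_tilde_def Q_A_def total_fractions_def localization_def fr_def cl_one cl_zero)
  moreover have "psi (restrict (\<lambda>x. 0) L) = fr (\<lambda>x. 0) (\<lambda>x. 1)"
    by (rule psi_restrict[OF poly_funs.const poly_funs.const regular_one]) simp
  ultimately show ?thesis by (simp add: coord_ring_def)
qed

text \<open>The ring axioms of \<open>S_tilde\<close> are transported from the coordinate ring
  instead of being verified for fractions.\<close>

lemma psi_cring_iso: "cring_iso (coord_ring n L) (S_tilde l p b) psi"
proof -
  have "cring (S_tilde l p b \<lparr>zero := psi \<zero>\<^bsub>coord_ring n L\<^esub>\<rparr>)"
    by (rule cring.ring_iso_imp_img_cring[OF coord_ring_cring psi_iso])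
  then have "cring (S_tilde l p b)" unfolding psi_zero by simp
  then show ?thesis
    by (intro cring_iso.intro cring_iso_axioms.intro coord_ring_cring psi_iso)
qed

end

theorem proposition4p25:
  fixes l :: nat
    and p :: "nat \<Rightarrow> (nat \<Rightarrow> complex) \<Rightarrow> complex"
    and b :: "nat \<Rightarrow> nat \<Rightarrow> complex"
  assumes "l \<ge> 1"
    and "basic_invariants l p"
    and "linear_coordinates l b"
  shows "Spec (S_tilde l p b) (S_tilde_const l p b) \<cong>\<^sub>C variety (l + 1) (L_arr l)"
proof -
  interpret invariants_type_A l p b using assms by unfold_locales
  show ?thesis
    unfolding variety_def
  \<comment> \<open>\<open>psi\<close> runs from the coordinate ring of L to \<open>S_tilde\<close>,
    so the induced map of spaces runs from the spectrum of \<open>S_tilde\<close> to L, as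
    claimed.\<close>
  proof (rule cring_iso.Spec_isomorphic[OF psi_cring_iso])
    show "const_fun L c \<in> carrier (coord_ring n L)" for c
      unfolding const_fun_def coord_ring_def by (auto intro: poly_funs.const)
  qed (rule psi_const)
qed

end
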